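(* Let $\Omega\subset\mathbb{R}^d$, $d\in\mathbb{N}$, be a bounded domain, let $p\in(1,\infty)$, and let $u\in W^{1,p}(\Omega)$ satisfy $-\operatorname{div}(|\nabla u|^{p-2}\nabla u)\le 0$ in $\Omega$ in the distributional sense, i.e. the functional $$F(v):=\int_\Omega|\nabla u|^{p-2}\nabla u\cdot\nabla v\,\mathrm{d}x,\qquad v\in W^{1,p}(\Omega),$$ satisfies $F(v)\le 0$ for all $v\in W^{1,p}_0(\Omega)$ with $v\ge 0$ in $\Omega$. Define $$\mathcal{J}(v):=\int_\Omega\frac1p|\nabla v|^p\,\mathrm{d}x-F(v),\qquad v\in W^{1,p}(\Omega).$$ Let $U\in W^{1,p}(\Omega)$ and let $U^*:=\min\{U,\ \sup_{\partial\Omega}U\}$. Then $$\mathcal{J}(U^* )\le\mathcal{J}(U)\qquad\text{and thus}\qquad\mathcal{J}(U^* )-\mathcal{J}(u)\le\mathcal{J}(U)-\mathcal{J}(u).$$ Moreover, if $U\in u+W^{1,p}_0(\Omega)$, and if $c,C>0$ are constants such that $$c\,\big(\mathcal{J}(v)-\mathcal{J}(u)\big)\le|||v-u|||^2_{(\nabla u)}\le C\,\big(\mathcal{J}(v)-\mathcal{J}(u)\big)\qquad\text{for all } v\in u+W^{1,p}_0(\Omega)$$ (it is a known fact that such constants exist), then $$\sqrt{c}\;|||u-U^*|||_{(\nabla u)}\le\sqrt{C}\;|||u-U|||_{(\nabla u)}.$$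
   Context: $W^{1,p}(\Omega)$ is the Sobolev space of (real-valued) $p$-integrable functions with $p$-integrable weak derivatives; $W^{1,p}_0(\Omega)$ is its subspace of functions with vanishing trace on $\partial\Omega$ (the closure of $C_c^\infty(\Omega)$ in $W^{1,p}(\Omega)$). Boundary suprema are understood in the Sobolev (trace) sense: $\sup_{\partial\Omega}U:=\inf\{\ell\in\mathbb{R}:(U-\ell)^+\in W^{1,p}_0(\Omega)\}$, with value $+\infty$ if no such $\ell$ exists, in which case $U^*=U$; here $w^+=\max\{0,w\}$. The quasi-norm distance (Barrett-Liu) of $v\in u+W^{1,p}_0(\Omega)$ to $u$ is the nonnegative number $|||v-u|||_{(\nabla u)}=|||u-v|||_{(\nabla u)}$ defined by $$|||v-u|||^2_{(\nabla u)}:=\int_\Omega\big(|\nabla u|+|\nabla v|\big)^{p-2}|\nabla u-\nabla v|^2\,\mathrm{d}x,$$ where the integrand is taken to be $0$ wherever $\nabla u=\nabla v=0$, and $|\nabla u|^{p-2}\nabla u$ is taken to be $0$ wherever $\nabla u=0$. *)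

theory Defs
  imports "HOL-Analysis.Analysis"
begin

text \<open>
  Functions on a domain \<open>\<Omega>\<close> are represented by total functions, of which only the values
  on \<open>\<Omega>\<close>, up to Lebesgue null sets, are relevant.
\<close>

primrec C_k :: "nat \<Rightarrow> ('a::euclidean_space \<Rightarrow> real) \<Rightarrow> bool" where
  "C_k 0 f \<longleftrightarrow> continuous_on UNIV f"
| "C_k (Suc k) f \<longleftrightarrow>
     (\<forall>x. f differentiable (at x)) \<and>
     (\<forall>b\<in>Basis. C_k k (\<lambda>x. frechet_derivative f (at x) b))"

text \<open>Test functions on \<open>\<Omega>\<close>, extended by zero to the whole space.\<close>

definition C_c_infinity :: "'a::euclidean_space set \<Rightarrow> ('a \<Rightarrow> real) set" where
  "C_c_infinity \<Omega> =
     {\<phi>. (\<forall>k. C_k k \<phi>) \<and> compact (closure {x. \<phi> x \<noteq> 0}) \<and> closure {x. \<phi> x \<noteq> 0} \<subseteq> \<Omega>}"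

definition Lp :: "'a::euclidean_space set \<Rightarrow> real \<Rightarrow> ('a \<Rightarrow> 'b::euclidean_space) set" where
  "Lp \<Omega> p = {f \<in> borel_measurable (lebesgue_on \<Omega>).
              integrable (lebesgue_on \<Omega>) (\<lambda>x. norm (f x) powr p)}"

definition L1_loc :: "'a::euclidean_space set \<Rightarrow> ('a \<Rightarrow> 'b::euclidean_space) set" where
  "L1_loc \<Omega> = {f. \<forall>K. compact K \<and> K \<subseteq> \<Omega> \<longrightarrow> f absolutely_integrable_on K}"

definition is_weak_gradient ::
    "'a::euclidean_space set \<Rightarrow> ('a \<Rightarrow> real) \<Rightarrow> ('a \<Rightarrow> 'a) \<Rightarrow> bool" where
  "is_weak_gradient \<Omega> u g \<longleftrightarrow>
     u \<in> L1_loc \<Omega> \<and> g \<in> L1_loc \<Omega> \<and>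
     (\<forall>\<phi>\<in>C_c_infinity \<Omega>. \<forall>b\<in>Basis.
        (\<integral>x. u x * frechet_derivative \<phi> (at x) b \<partial>lebesgue_on \<Omega>) =
        - (\<integral>x. (g x \<bullet> b) * \<phi> x \<partial>lebesgue_on \<Omega>))"

text \<open>Weak gradients are unique only up to null sets, so a representative is chosen.\<close>

definition weak_grad :: "'a::euclidean_space set \<Rightarrow> ('a \<Rightarrow> real) \<Rightarrow> 'a \<Rightarrow> 'a" where
  "weak_grad \<Omega> u = (SOME g. is_weak_gradient \<Omega> u g)"

definition W1p :: "'a::euclidean_space set \<Rightarrow> real \<Rightarrow> ('a \<Rightarrow> real) set" where
  "W1p \<Omega> p = {u \<in> Lp \<Omega> p. \<exists>g\<in>Lp \<Omega> p. is_weak_gradient \<Omega> u g}"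

definition W1p_norm :: "'a::euclidean_space set \<Rightarrow> real \<Rightarrow> ('a \<Rightarrow> real) \<Rightarrow> real" where
  "W1p_norm \<Omega> p u =
     ((\<integral>x. \<bar>u x\<bar> powr p \<partial>lebesgue_on \<Omega>) +
      (\<integral>x. norm (weak_grad \<Omega> u x) powr p \<partial>lebesgue_on \<Omega>)) powr (1 / p)"

definition W1p0 :: "'a::euclidean_space set \<Rightarrow> real \<Rightarrow> ('a \<Rightarrow> real) set" where
  "W1p0 \<Omega> p = {u \<in> W1p \<Omega> p.
     \<forall>\<epsilon>>0. \<exists>\<phi>\<in>C_c_infinity \<Omega>. W1p_norm \<Omega> p (\<lambda>x. u x - \<phi> x) < \<epsilon>}"

text \<open>The affine space \<open>u + W\<^sub>0\<close> of Sobolev functions with the boundary values of \<open>u\<close>.\<close>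

definition W1p0_shift ::
    "'a::euclidean_space set \<Rightarrow> real \<Rightarrow> ('a \<Rightarrow> real) \<Rightarrow> ('a \<Rightarrow> real) set" where
  "W1p0_shift \<Omega> p u = {v. (\<lambda>x. v x - u x) \<in> W1p0 \<Omega> p}"

text \<open>The infimum over the empty set is \<open>\<infinity>\<close> in \<open>ereal\<close>.\<close>

definition bdry_sup :: "'a::euclidean_space set \<Rightarrow> real \<Rightarrow> ('a \<Rightarrow> real) \<Rightarrow> ereal" where
  "bdry_sup \<Omega> p U = (INF l\<in>{l::real. (\<lambda>x. max 0 (U x - l)) \<in> W1p0 \<Omega> p}. ereal l)"

text \<open>
  For \<open>U \<in> W1p \<Omega> p\<close> on a nonempty bounded open set, \<open>bdry_sup \<Omega> p U\<close> is never \<open>-\<infinity>\<close> (by the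
  Poincare inequality), so that the conversion back to real numbers is faithful;
  if it is \<open>\<infinity>\<close>, the truncation is \<open>U\<close> itself.
\<close>

definition truncate_bdry ::
    "'a::euclidean_space set \<Rightarrow> real \<Rightarrow> ('a \<Rightarrow> real) \<Rightarrow> 'a \<Rightarrow> real" where
  "truncate_bdry \<Omega> p U = (\<lambda>x. real_of_ereal (min (ereal (U x)) (bdry_sup \<Omega> p U)))"

text \<open>
  In the integrands below, \<open>0 powr a = 0\<close> for every \<open>a\<close> realises the convention that they
  vanish where the gradients do.
\<close>

definition F_fun ::
    "'a::euclidean_space set \<Rightarrow> real \<Rightarrow> ('a \<Rightarrow> real) \<Rightarrow> ('a \<Rightarrow> real) \<Rightarrow> real" where
  "F_fun \<Omega> p u v =
     (\<integral>x. (norm (weak_grad \<Omega> u x) powr (p - 2) *\<^sub>R weak_grad \<Omega> u x) \<bullet> weak_grad \<Omega> v x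
        \<partial>lebesgue_on \<Omega>)"

definition J_fun ::
    "'a::euclidean_space set \<Rightarrow> real \<Rightarrow> ('a \<Rightarrow> real) \<Rightarrow> ('a \<Rightarrow> real) \<Rightarrow> real" where
  "J_fun \<Omega> p u v =
     (\<integral>x. 1 / p * norm (weak_grad \<Omega> v x) powr p \<partial>lebesgue_on \<Omega>) - F_fun \<Omega> p u v"

definition quasi_dist ::
    "'a::euclidean_space set \<Rightarrow> real \<Rightarrow> ('a \<Rightarrow> real) \<Rightarrow> ('a \<Rightarrow> real) \<Rightarrow> real" where
  "quasi_dist \<Omega> p u v =
     sqrt (\<integral>x. (norm (weak_grad \<Omega> u x) + norm (weak_grad \<Omega> v x)) powr (p - 2) *
                 (norm (weak_grad \<Omega> u x - weak_grad \<Omega> v x))\<^sup>2 \<partial>lebesgue_on \<Omega>)"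

definition p_subharmonic :: "'a::euclidean_space set \<Rightarrow> real \<Rightarrow> ('a \<Rightarrow> real) \<Rightarrow> bool" where
  "p_subharmonic \<Omega> p u \<longleftrightarrow>
     (\<forall>v\<in>W1p0 \<Omega> p. (AE x in lebesgue_on \<Omega>. 0 \<le> v x) \<longrightarrow> F_fun \<Omega> p u v \<le> 0)"

end

theory Submission
  imports Defs "HOL-Computational_Algebra.Polynomial"
begin

text \<open>
  Write \<open>s\<close> for the boundary supremum of \<open>U\<close> and \<open>w = max 0 (U - s)\<close>, so that the truncation is
  \<open>T = U - w\<close> (if \<open>s = \<infinity>\<close> then \<open>T = U\<close> and there is nothing to show). The weak gradient of \<open>w\<close> is that
  of \<open>U\<close> where \<open>U > s\<close> and 0 elsewhere, so \<open>|\<nabla>T| \<le> |\<nabla>U|\<close> almost everywhere. Moreover \<open>w\<close> is nonnegative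
  and lies in \<open>W1p0\<close>, hence \<open>F(w) \<le> 0\<close> by subharmonicity and \<open>F(T) = F(U) - F(w) \<ge> F(U)\<close>. Together,
  \<open>J(T) \<le> J(U)\<close> (\<open>J_fun_truncation_le\<close>). If \<open>U - u\<close> is in \<open>W1p0\<close>, so is \<open>T - u = (U - u) - w\<close>, and the
  comparison of quasi-norm distances follows from
  \<open>c |||u - T|||\<^sup>2 \<le> c C (J(T) - J(u)) \<le> c C (J(U) - J(u)) \<le> C |||u - U|||\<^sup>2\<close>.

  Three facts on Sobolev functions carry this. Weak gradients are unique almost everywhere
  (\<open>is_weak_gradient_unique\<close>): smooth bumps exhaust the indicators of boxes, and cube averages
  converge almost everywhere. The weak gradient of a positive part is the expected one
  (\<open>is_weak_gradient_pos_part\<close>): the chain rule holds for mollified functions; letting the mollifier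
  tend to the normalised indicator of a cube and then the cube shrink, the functions converge in
  \<open>L1\<close> by Scheffe's lemma (\<open>weak_chain_rule\<close>), and the positive part is a limit of \<open>C1\<close> functions.
  Finally, if some level is admissible in the definition of the boundary supremum, then \<open>s\<close> is
  finite and itself admissible (\<open>bdry_sup_cases\<close>): \<open>W1p0\<close> is closed, which gives attainment, and
  functions in \<open>W1p0\<close> have their integral bounded by that of the gradient
  (\<open>coordinate_flux_W1p0\<close>), which excludes \<open>s = -\<infinity>\<close> (\<open>bdry_sup_bounded_below\<close>).
\<close>

section \<open>Calculus of \<open>C_k\<close> functions\<close>

lemma frechet_derivativeI:
  assumes "(f has_derivative f') (at x)"
  shows "frechet_derivative f (at x) = f'"
  using frechet_derivative_at[OF assms] by simp

lemma has_derivative_frechet: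
  assumes "f differentiable (at x)"
  shows "(f has_derivative frechet_derivative f (at x)) (at x)"
  using assms by (simp add: frechet_derivative_works)

lemma C_k_continuous:
  assumes "C_k k f"
  shows "continuous_on UNIV f"
proof (cases k)
  case (Suc m)
  then have "\<And>x. f differentiable (at x)" using assms by simp
  then show ?thesis
    by (simp add: continuous_at_imp_continuous_on differentiable_imp_continuous_within)
qed (use assms in simp)

lemma C_k_Suc_D: "C_k (Suc k) f \<Longrightarrow> C_k k f"
proof (induction k arbitrary: f)
  case 0
  then show ?case using C_k_continuous by (metis C_k.simps(1))
next
  case (Suc k)
  from Suc.prems have "\<And>x. f differentiable (at x)"
    and "\<And>b. b \<in> Basis \<Longrightarrow> C_k (Suc k) (\<lambda>x. frechet_derivative f (at x) b)"
    by auto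
  then show ?case using Suc.IH by (simp only: C_k.simps(2)) blast
qed

lemma C_k_const: "C_k k (\<lambda>x. c)"
  by (induction k arbitrary: c) auto

lemma C_k_add:
  assumes "C_k k f" "C_k k g"
  shows "C_k k (\<lambda>x. f x + g x)"
  using assms
proof (induction k arbitrary: f g)
  case (Suc k)
  have d: "\<And>x. f differentiable (at x)" "\<And>x. g differentiable (at x)"
    using Suc.prems by auto
  have eq: "frechet_derivative (\<lambda>x. f x + g x) (at x) b
      = frechet_derivative f (at x) b + frechet_derivative g (at x) b" for x b
    by (subst frechet_derivativeI[OF has_derivative_add[OF d[THEN has_derivative_frechet]]]) simp
  show ?case using Suc d by (simp add: eq)
qed (auto intro: continuous_intros)

lemma C_k_mult:
  assumes "C_k k f" "C_k k g"
  shows "C_k k (\<lambda>x. f x * g x)"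
  using assms
proof (induction k arbitrary: f g)
  case (Suc k)
  have d: "\<And>x. f differentiable (at x)" "\<And>x. g differentiable (at x)"
    using Suc.prems by auto
  have eq: "frechet_derivative (\<lambda>x. f x * g x) (at x) b
      = f x * frechet_derivative g (at x) b + frechet_derivative f (at x) b * g x" for x b
    by (subst frechet_derivativeI[OF has_derivative_mult[OF d[THEN has_derivative_frechet]]]) simp
  have "C_k k f" "C_k k g" using Suc.prems C_k_Suc_D by blast+
  then have "\<forall>b\<in>Basis. C_k k (\<lambda>x. frechet_derivative (\<lambda>x. f x * g x) (at x) b)"
    using Suc unfolding eq by (intro ballI C_k_add Suc.IH) auto
  then show ?case using d by simp
qed (auto intro: continuous_intros)

lemma C_k_diff:
  assumes "C_k k f" "C_k k g"
  shows "C_k k (\<lambda>x. f x - g x)"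
  using C_k_add[OF assms(1) C_k_mult[OF C_k_const[of k "-1"] assms(2)]] by simp

lemma C_k_sum:
  assumes "finite A" "\<And>i. i \<in> A \<Longrightarrow> C_k k (f i)"
  shows "C_k k (\<lambda>x. \<Sum>i\<in>A. f i x)"
  using assms by (induction A rule: finite_induct) (auto intro: C_k_const C_k_add)

lemma C_k_prod:
  assumes "finite A" "\<And>i. i \<in> A \<Longrightarrow> C_k k (f i)"
  shows "C_k k (\<lambda>x. \<Prod>i\<in>A. f i x)"
  using assms by (induction A rule: finite_induct) (auto intro: C_k_const C_k_mult)

text \<open>Source and target may differ, so this covers translations as well as functions of one
  coordinate.\<close>

lemma C_k_affine:
  fixes f :: "'b::euclidean_space \<Rightarrow> real" and L :: "'a::euclidean_space \<Rightarrow> 'b"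
  assumes "bounded_linear L" "C_k k f"
  shows "C_k k (\<lambda>x. f (L x + v))"
  using assms(2)
proof (induction k arbitrary: f)
  case 0
  have "continuous_on UNIV (\<lambda>x. L x + v)"
    using assms(1) by (intro continuous_intros linear_continuous_on)
  then show ?case using 0 by (auto intro: continuous_on_compose2)
next
  case (Suc k)
  have d: "\<And>x. f differentiable (at x)"
    using Suc.prems by auto
  have D: "((\<lambda>x. f (L x + v)) has_derivative (\<lambda>h. frechet_derivative f (at (L x + v)) (L h))) (at x)" for x
  proof -
    have "((\<lambda>x. L x + v) has_derivative L) (at x)"
      using has_derivative_add_const[OF bounded_linear_imp_has_derivative[OF assms(1)]] .
    from diff_chain_at[OF this has_derivative_frechet[OF d]]
    show ?thesis by (simp add: o_def)
  qed
  have eq: "frechet_derivative (\<lambda>x. f (L x + v)) (at x) b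
      = (\<Sum>i\<in>Basis. (L b \<bullet> i) * frechet_derivative f (at (L x + v)) i)" for x b
  proof -
    have lin: "linear (frechet_derivative f (at (L x + v)))"
      using has_derivative_frechet[OF d] has_derivative_linear by blast
    have "frechet_derivative (\<lambda>x. f (L x + v)) (at x) b = frechet_derivative f (at (L x + v)) (L b)"
      using frechet_derivativeI[OF D] by simp
    also have "L b = (\<Sum>i\<in>Basis. (L b \<bullet> i) *\<^sub>R i)" by (simp add: euclidean_representation)
    also have "frechet_derivative f (at (L x + v)) \<dots>
        = (\<Sum>i\<in>Basis. (L b \<bullet> i) * frechet_derivative f (at (L x + v)) i)"
      by (simp add: linear_sum[OF lin] linear_scale[OF lin])
    finally show ?thesis .
  qed
  have "C_k k (\<lambda>x. (L b \<bullet> i) * frechet_derivative f (at (L x + v)) i)" if "i \<in> Basis" for b i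
    using Suc that by (intro C_k_mult C_k_const Suc.IH[of "\<lambda>x. frechet_derivative f (at x) i"]) auto
  then have "\<forall>b\<in>Basis. C_k k (\<lambda>x. frechet_derivative (\<lambda>x. f (L x + v)) (at x) b)"
    unfolding eq by (intro ballI C_k_sum) auto
  then show ?case using D by (auto simp: differentiable_def)
qed

section \<open>Smooth bump functions\<close>

text \<open>As \<open>c\<close> decreases to 0, \<open>cutoff c\<close> increases to the indicator of the positive half-line.\<close>

definition cutoff :: "real \<Rightarrow> real \<Rightarrow> real" where
  "cutoff c t = (if t > 0 then exp (- c / t) else 0)"

text \<open>A smooth function with support in \<open>cbox a b\<close>, positive exactly on \<open>box a b\<close>; it tends to the
  indicator of \<open>box a b\<close> as \<open>c\<close> decreases to 0, staying between 0 and 1.\<close>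

definition bump :: "real \<Rightarrow> 'a::euclidean_space \<Rightarrow> 'a \<Rightarrow> 'a \<Rightarrow> real" where
  "bump c a b x = (\<Prod>i\<in>Basis. cutoff c (x \<bullet> i - a \<bullet> i) * cutoff c (b \<bullet> i - x \<bullet> i))"

lemma poly_exp_tendsto_0:
  fixes q :: "real poly"
  assumes "c > 0"
  shows "((\<lambda>s. poly q s * exp (- c * s)) \<longlongrightarrow> 0) at_top"
proof -
  have m: "((\<lambda>s. s ^ n * exp (- c * s)) \<longlongrightarrow> 0) at_top" for n
  proof -
    have "filterlim (\<lambda>s::real. c * s) at_top at_top"
      using assms by (simp add: filterlim_tendsto_pos_mult_at_top[OF tendsto_const] filterlim_ident)
    from filterlim_compose[OF tendsto_power_div_exp_0[of n] this]
    have "((\<lambda>s. (c * s) ^ n / exp (c * s)) \<longlongrightarrow> 0) at_top" .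
    from tendsto_mult_left[OF this, of "1 / c ^ n"]
    show ?thesis using assms by (simp add: power_mult_distrib exp_minus field_simps)
  qed
  have "((\<lambda>s. \<Sum>i\<le>degree q. coeff q i * (s ^ i * exp (- c * s))) \<longlongrightarrow> (\<Sum>i\<le>degree q. coeff q i * 0)) at_top"
    by (intro tendsto_sum tendsto_mult tendsto_const m)
  then show ?thesis
    by (simp add: poly_altdef sum_distrib_right mult.assoc)
qed

text \<open>The functions \<open>q (1 / t) exp (- c / t)\<close> on the positive half-line, with \<open>q\<close> a polynomial, form a
  class closed under differentiation, the derivative at 0 being 0. Hence they are smooth.\<close>

lemma poly_exp_has_derivative:
  fixes q :: "real poly"
  assumes "c > 0"
  defines "G \<equiv> \<lambda>q t. if t > 0 then poly q (1 / t) * exp (- c / t) else 0"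
  shows "(G q has_real_derivative G ((smult c q - pderiv q) * [:0, 0, 1:]) t) (at t)"
proof -
  consider "t > 0" | "t < 0" | "t = 0" by linarith
  then show ?thesis
  proof cases
    case 1
    have D: "((\<lambda>t. poly q (1 / t) * exp (- c / t)) has_real_derivative
        G ((smult c q - pderiv q) * [:0, 0, 1:]) t) (at t)"
      using 1 unfolding G_def
      by (auto intro!: derivative_eq_intros DERIV_chain2[OF poly_DERIV]
        simp: field_simps power2_eq_square)
    show ?thesis
      by (rule has_field_derivative_transform_within_open[OF D, of "{0<..}"])
        (use 1 in \<open>auto simp: G_def\<close>)
  next
    case 2
    have D: "((\<lambda>t. 0) has_real_derivative G ((smult c q - pderiv q) * [:0, 0, 1:]) t) (at t)"
      using 2 by (simp add: G_def)
    show ?thesis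
      by (rule has_field_derivative_transform_within_open[OF D, of "{..<0}"])
        (use 2 in \<open>auto simp: G_def\<close>)
  next
    case 3
    have r: "((\<lambda>h. G q h / h) \<longlongrightarrow> 0) (at_right 0)"
      unfolding filterlim_at_right_to_top
    proof (rule Lim_transform_eventually[OF poly_exp_tendsto_0[of c "pCons 0 q"]])
      show "\<forall>\<^sub>F s in at_top. poly (pCons 0 q) s * exp (- c * s) = G q (inverse s) / inverse s"
        using eventually_gt_at_top[of "0::real"] by eventually_elim (simp add: G_def field_simps)
    qed (use assms in auto)
    have l: "((\<lambda>h. G q h / h) \<longlongrightarrow> 0) (at_left 0)"
      by (rule Lim_transform_eventually[OF tendsto_const])
        (auto simp: G_def eventually_at_filter)
    have "((\<lambda>h. G q h / h) \<longlongrightarrow> 0) (at 0)"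
      using l r filterlim_split_at by blast
    then show ?thesis
      unfolding 3 by (subst DERIV_def) (simp add: G_def)
  qed
qed

lemma C_k_poly_exp:
  fixes q :: "real poly"
  assumes "c > 0"
  shows "C_k k (\<lambda>t. if t > 0 then poly q (1 / t) * exp (- c / t) else 0)"
proof (induction k arbitrary: q)
  case 0
  show ?case
    unfolding C_k.simps(1)
    by (intro continuous_at_imp_continuous_on ballI DERIV_isCont[OF poly_exp_has_derivative[OF assms]])
next
  case (Suc k)
  let ?G = "\<lambda>q t. if t > 0 then poly q (1 / t) * exp (- c / t) else 0"
  let ?r = "(smult c q - pderiv q) * [:0, 0, 1:]"
  have D: "(?G q has_derivative (*) (?G ?r t)) (at t)" for t
    using poly_exp_has_derivative[OF assms, of q t] by (simp add: has_field_derivative_def)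
  have eq: "frechet_derivative (?G q) (at t) 1 = ?G ?r t" for t
    by (subst frechet_derivativeI[OF D]) simp
  have dif: "?G q differentiable (at t)" for t
    using D unfolding differentiable_def by blast
  show ?case
    unfolding C_k.simps(2) using dif Suc.IH[of ?r] by (auto simp: eq simp del: mult_pCons_right)
qed

lemma C_k_cutoff:
  assumes "c > 0"
  shows "C_k k (cutoff c)"
proof -
  have "cutoff c = (\<lambda>t. if t > 0 then poly 1 (1 / t) * exp (- c / t) else 0)"
    by (auto simp: cutoff_def)
  then show ?thesis using C_k_poly_exp[OF assms, of k 1] by simp
qed

lemma cutoff_bounds: "c > 0 \<Longrightarrow> 0 \<le> cutoff c t" "c > 0 \<Longrightarrow> cutoff c t \<le> 1"
  by (auto simp: cutoff_def)

lemma C_k_bump: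
  assumes "c > 0"
  shows "C_k k (bump c a b)"
proof -
  have "C_k k (\<lambda>x. cutoff c (x \<bullet> i + - (a \<bullet> i)))" for i
    by (rule C_k_affine[OF bounded_linear_inner_left C_k_cutoff[OF assms]])
  moreover have "C_k k (\<lambda>x. cutoff c (- (x \<bullet> i) + b \<bullet> i))" for i
    by (rule C_k_affine[OF bounded_linear_minus[OF bounded_linear_inner_left] C_k_cutoff[OF assms]])
  ultimately have "C_k k (\<lambda>x. \<Prod>i\<in>Basis. cutoff c (x \<bullet> i - a \<bullet> i) * cutoff c (b \<bullet> i - x \<bullet> i))"
    by (intro C_k_prod C_k_mult) auto
  then show ?thesis by (simp add: bump_def[abs_def])
qed

lemma bump_bounds:
  assumes "c > 0"
  shows "0 \<le> bump c a b x" "bump c a b x \<le> 1"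
  unfolding bump_def
  by (intro prod_nonneg prod_le_1 mult_nonneg_nonneg mult_le_one conjI cutoff_bounds ballI assms)+

lemma bump_eq_0: "x \<notin> box a b \<Longrightarrow> bump c a b x = 0"
proof -
  assume "x \<notin> box a b"
  then obtain i where "i \<in> Basis" "\<not> (a \<bullet> i < x \<bullet> i \<and> x \<bullet> i < b \<bullet> i)"
    by (auto simp: box_def)
  then show ?thesis
    unfolding bump_def by (intro prod_zero bexI[of _ i]) (auto simp: cutoff_def)
qed

lemma bump_translate: "bump c x (x + v) y = bump c 0 v (y - x)"
  by (simp add: bump_def inner_simps algebra_simps)

lemma bump_tendsto_indicator:
  fixes x :: "'a::euclidean_space"
  shows "(\<lambda>n. bump (1 / Suc n) a b x) \<longlonglongrightarrow> indicator (box a b) x"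
proof (cases "x \<in> box a b")
  case True
  have *: "(\<lambda>n. cutoff (1 / Suc n) t) \<longlonglongrightarrow> 1" if "t > 0" for t
  proof -
    have "(\<lambda>n. exp (- ((1 / t) * inverse (real (Suc n))))) \<longlonglongrightarrow> exp (- ((1 / t) * 0))"
      by (intro tendsto_intros LIMSEQ_inverse_real_of_nat)
    then show ?thesis using that by (simp add: cutoff_def field_simps)
  qed
  have "(\<lambda>n. bump (1 / Suc n) a b x) \<longlonglongrightarrow> (\<Prod>i\<in>(Basis::'a set). 1 * 1)"
    unfolding bump_def
    by (intro tendsto_prod tendsto_mult *) (use True in \<open>auto simp: box_def\<close>)
  then show ?thesis using True by simp
qed (simp add: bump_eq_0)

lemma C_c_infinityI:
  assumes "\<And>k. C_k k \<phi>" "compact K" "K \<subseteq> \<Omega>" "\<And>x. x \<notin> K \<Longrightarrow> \<phi> x = 0"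
  shows "\<phi> \<in> C_c_infinity \<Omega>"
proof -
  have "closure {x. \<phi> x \<noteq> 0} \<subseteq> K"
    using assms by (intro closure_minimal compact_imp_closed) auto
  moreover then have "compact (closure {x. \<phi> x \<noteq> 0})"
    using assms(2) by (metis closed_closure compact_Int_closed inf.absorb2)
  ultimately show ?thesis using assms by (auto simp: C_c_infinity_def)
qed

lemma bump_in_C_c_infinity:
  assumes "c > 0" "cbox a b \<subseteq> \<Omega>"
  shows "bump c a b \<in> C_c_infinity \<Omega>"
proof (rule C_c_infinityI[OF C_k_bump compact_cbox])
  show "bump c a b x = 0" if "x \<notin> cbox a b" for x
    using that box_subset_cbox[of a b] bump_eq_0[of x a b c] by blast
qed (use assms in auto)

section \<open>Test functions\<close>

lemma C_c_infinityE:
  assumes "\<phi> \<in> C_c_infinity \<Omega>"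
  obtains K where "compact K" "K \<subseteq> \<Omega>" "\<And>x. x \<notin> K \<Longrightarrow> \<phi> x = 0"
    "\<And>x b. x \<notin> K \<Longrightarrow> frechet_derivative \<phi> (at x) b = 0"
proof
  let ?K = "closure {x. \<phi> x \<noteq> 0}"
  show "compact ?K" "?K \<subseteq> \<Omega>" using assms by (auto simp: C_c_infinity_def)
  show 0: "x \<notin> ?K \<Longrightarrow> \<phi> x = 0" for x
    using closure_subset[of "{x. \<phi> x \<noteq> 0}"] by auto
  fix x b assume x: "x \<notin> ?K"
  have "(\<phi> has_derivative (\<lambda>_. 0)) (at x)"
  proof (rule has_derivative_transform_within_open[of "\<lambda>_. 0" _ _ _ "- ?K"])
    show "open (- ?K)" by blast
    show "x \<in> - ?K" using x by blast
    show "0 = \<phi> y" if "y \<in> - ?K" for y using 0[of y] that by (metis ComplD)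
  qed simp
  then show "frechet_derivative \<phi> (at x) b = 0" using frechet_derivativeI by metis
qed

lemma C_c_infinity_continuous:
  "\<phi> \<in> C_c_infinity \<Omega> \<Longrightarrow> continuous_on UNIV \<phi>"
  by (auto simp: C_c_infinity_def intro: C_k_continuous)

lemma C_c_infinity_differentiable:
  "\<phi> \<in> C_c_infinity \<Omega> \<Longrightarrow> \<phi> differentiable (at x)"
  using C_k.simps(2)[of 0 \<phi>] by (auto simp: C_c_infinity_def simp del: C_k.simps)

lemma C_c_infinity_continuous_deriv:
  "\<phi> \<in> C_c_infinity \<Omega> \<Longrightarrow> b \<in> Basis \<Longrightarrow> continuous_on UNIV (\<lambda>x. frechet_derivative \<phi> (at x) b)"
  unfolding C_c_infinity_def using C_k.simps(2)[of 0 \<phi>] C_k_continuous by blast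

lemma C_c_infinity_diff:
  assumes "\<phi> \<in> C_c_infinity \<Omega>" "\<psi> \<in> C_c_infinity \<Omega>"
  shows "(\<lambda>x. \<phi> x - \<psi> x) \<in> C_c_infinity \<Omega>"
proof -
  obtain K L where "compact K" "K \<subseteq> \<Omega>" "\<And>x. x \<notin> K \<Longrightarrow> \<phi> x = 0"
    "compact L" "L \<subseteq> \<Omega>" "\<And>x. x \<notin> L \<Longrightarrow> \<psi> x = 0"
    by (metis assms C_c_infinityE)
  then show ?thesis using assms
    by (intro C_c_infinityI[of _ "K \<union> L"] C_k_diff) (auto simp: C_c_infinity_def)
qed

lemma compactly_supported_bounded:
  fixes f :: "'a::euclidean_space \<Rightarrow> real"
  assumes "continuous_on UNIV f" "compact K" "\<And>x. x \<notin> K \<Longrightarrow> f x = 0"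
  obtains M where "M > 0" "\<And>x. \<bar>f x\<bar> \<le> M"
proof -
  have "bounded (f ` K)"
    using assms by (intro compact_imp_bounded compact_continuous_image) (auto intro: continuous_on_subset)
  then obtain M where "M > 0" "\<And>x. x \<in> K \<Longrightarrow> \<bar>f x\<bar> \<le> M"
    by (auto simp: bounded_pos)
  then show thesis using assms(3) by (intro that[of M]) (metis abs_zero less_imp_le)+
qed

lemma C_c_infinity_bounded:
  assumes "\<phi> \<in> C_c_infinity \<Omega>"
  obtains M where "M > 0" "\<And>x. \<bar>\<phi> x\<bar> \<le> M"
proof -
  obtain K where "compact K" "\<And>x. x \<notin> K \<Longrightarrow> \<phi> x = 0"
    using C_c_infinityE[OF assms] by metis
  from compactly_supported_bounded[OF C_c_infinity_continuous[OF assms] this] that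
  show thesis by metis
qed

lemma C_c_infinity_bounded_deriv:
  assumes "\<phi> \<in> C_c_infinity \<Omega>" "b \<in> Basis"
  obtains M where "M > 0" "\<And>x. \<bar>frechet_derivative \<phi> (at x) b\<bar> \<le> M"
proof -
  obtain K where "compact K" "\<And>x. x \<notin> K \<Longrightarrow> frechet_derivative \<phi> (at x) b = 0"
    using C_c_infinityE[OF assms(1)] by metis
  from compactly_supported_bounded[OF C_c_infinity_continuous_deriv[OF assms] this] that
  show thesis by metis
qed

lemma C_c_infinity_dir_deriv:
  assumes "\<phi> \<in> C_c_infinity \<Omega>"
  shows "((\<lambda>t. \<phi> (x + t *\<^sub>R b)) has_real_derivative frechet_derivative \<phi> (at (x + t *\<^sub>R b)) b) (at t)"
proof -
  let ?D = "frechet_derivative \<phi> (at (x + t *\<^sub>R b))"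
  have D: "(\<phi> has_derivative ?D) (at (x + t *\<^sub>R b))"
    using assms C_c_infinity_differentiable has_derivative_frechet by blast
  have "((\<lambda>t. x + t *\<^sub>R b) has_derivative (\<lambda>h. h *\<^sub>R b)) (at t)"
    by (auto intro!: derivative_eq_intros)
  from diff_chain_at[OF this D]
  have "((\<lambda>t. \<phi> (x + t *\<^sub>R b)) has_derivative (\<lambda>h. ?D (h *\<^sub>R b))) (at t)" by (simp add: o_def)
  moreover have "?D (h *\<^sub>R b) = ?D b * h" for h
    using linear_scale[OF has_derivative_linear[OF D]] by simp
  ultimately show ?thesis
    by (simp add: has_field_derivative_def)
qed

section \<open>Integration by parts\<close>

lemma lborel_integral_translation:
  fixes f :: "'a::euclidean_space \<Rightarrow> real"
  assumes [measurable]: "f \<in> borel_measurable borel"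
  shows "(\<integral>x. f (x + v) \<partial>lborel) = (\<integral>x. f x \<partial>lborel)"
proof -
  have "(\<integral>x. f x \<partial>lborel) = (\<integral>x. f x \<partial>(distr lborel borel ((+) v)))"
    by (simp add: lborel_distr_plus)
  also have "\<dots> = (\<integral>x. f (v + x) \<partial>lborel)"
    by (subst integral_distr) auto
  finally show ?thesis by (simp add: add.commute)
qed

lemma integrable_mult_bounded:
  fixes f g :: "'a \<Rightarrow> real"
  assumes "integrable M f" "g \<in> borel_measurable M" "\<And>x. \<bar>g x\<bar> \<le> C"
  shows "integrable M (\<lambda>x. f x * g x)"
proof (rule Bochner_Integration.integrable_bound)
  show "integrable M (\<lambda>x. C * f x)" using assms by simp
  have "norm (f x * g x) \<le> norm (C * f x)" for x
  proof -
    have "\<bar>f x\<bar> * \<bar>g x\<bar> \<le> \<bar>f x\<bar> * \<bar>C\<bar>"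
      using assms(3)[of x] by (intro mult_left_mono) auto
    then show ?thesis by (simp add: abs_mult mult.commute)
  qed
  then show "AE x in M. norm (f x * g x) \<le> norm (C * f x)" by simp
qed (use assms in measurable)

lemma integrable_compact_support:
  fixes f :: "'a::euclidean_space \<Rightarrow> real"
  assumes "continuous_on UNIV f" "compact K" "\<And>x. x \<notin> K \<Longrightarrow> f x = 0"
  shows "integrable lborel f"
proof -
  have "set_integrable lborel K f"
    using borel_integrable_compact[of K f] assms continuous_on_subset
    by (simp add: set_integrable_def) blast
  also have "set_integrable lborel K f \<longleftrightarrow> integrable lborel f"
    unfolding set_integrable_def
  proof (intro arg_cong[of _ _ "integrable lborel"] ext)
    show "indicator K x *\<^sub>R f x = f x" for x
      using assms(3)[of x] by (cases "x \<in> K") simp_all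
  qed
  finally show ?thesis .
qed

text \<open>Translation invariance gives the difference quotients integral 0; they are dominated by the
  bound on the derivative. Only the derivative in the direction \<open>b\<close> is needed.\<close>

lemma integral_dir_deriv_eq_0:
  fixes \<psi> D :: "'a::euclidean_space \<Rightarrow> real"
  assumes cont: "continuous_on UNIV \<psi>" and K: "compact K" "\<And>x. x \<notin> K \<Longrightarrow> \<psi> x = 0"
    and der: "\<And>x t. ((\<lambda>t. \<psi> (x + t *\<^sub>R b)) has_real_derivative D (x + t *\<^sub>R b)) (at t)"
    and bound: "\<And>x. \<bar>D x\<bar> \<le> M"
  shows "integrable lborel D" "(\<integral>x. D x \<partial>lborel) = 0"
proof -
  obtain R where R: "K \<subseteq> cball 0 R"
    using compact_imp_bounded[OF K(1)] bounded_subset_ballD[of K 0] ball_subset_cball[of 0] by (meson subset_trans)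
  \<comment> \<open>The ball contains the support of each difference quotient, as the steps are at most 1.\<close>
  define B where "B = cball (0::'a) (R + norm b)"
  define Q where "Q n x = real (Suc n) * (\<psi> (x + (1 / real (Suc n)) *\<^sub>R b) - \<psi> x)" for n x
  have [measurable]: "\<psi> \<in> borel_measurable borel"
    using cont by (rule borel_measurable_continuous_onI)
  have lim: "(\<lambda>n. Q n x) \<longlonglongrightarrow> D x" for x
  proof -
    have "((\<lambda>h. (\<psi> (x + h *\<^sub>R b) - \<psi> x) / h) \<longlongrightarrow> D x) (at 0)"
      using der[of x 0] by (simp add: DERIV_def)
    moreover have "filterlim (\<lambda>n. 1 / real (Suc n)) (at 0) sequentially"
      using LIMSEQ_inverse_real_of_nat by (intro filterlim_atI) (auto simp: field_simps)
    ultimately have "(\<lambda>n. (\<psi> (x + (1 / real (Suc n)) *\<^sub>R b) - \<psi> x) / (1 / real (Suc n))) \<longlonglongrightarrow> D x"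
      by (rule filterlim_compose)
    then show ?thesis by (simp add: Q_def mult.commute)
  qed
  have Qb: "norm (Q n x) \<le> M * indicator B x" for n x
  proof (cases "x \<in> B")
    case True
    have "\<exists>z>0. z < 1 / real (Suc n) \<and> \<psi> (x + (1 / real (Suc n)) *\<^sub>R b) - \<psi> (x + 0 *\<^sub>R b)
        = (1 / real (Suc n) - 0) * D (x + z *\<^sub>R b)"
      by (rule MVT2) (auto intro: der)
    then obtain z where "\<psi> (x + (1 / real (Suc n)) *\<^sub>R b) - \<psi> x = (1 / real (Suc n)) * D (x + z *\<^sub>R b)"
      by auto
    then have "Q n x = D (x + z *\<^sub>R b)" by (simp add: Q_def del: of_nat_Suc)
    then show ?thesis using bound True by simp
  next
    case False
    then have x: "R + norm b < norm x" by (simp add: B_def)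
    have "norm x \<le> norm (x + (1 / real (Suc n)) *\<^sub>R b) + norm ((1 / real (Suc n)) *\<^sub>R b)"
      by (metis add_diff_cancel_right' norm_triangle_ineq4)
    moreover have "norm ((1 / real (Suc n)) *\<^sub>R b) \<le> 1 * norm b"
      unfolding norm_scaleR by (intro mult_right_mono) (auto simp: field_simps)
    ultimately have "R < norm (x + (1 / real (Suc n)) *\<^sub>R b)" "R < norm x"
      using x norm_ge_zero[of b] by linarith+
    then have "x + (1 / real (Suc n)) *\<^sub>R b \<notin> K" "x \<notin> K"
      using R by (auto simp: subset_iff)
    then show ?thesis using K(2) False by (simp add: Q_def)
  qed
  have \<psi>int: "integrable lborel \<psi>" by (rule integrable_compact_support[OF cont K])
  have \<psi>int': "integrable lborel (\<lambda>x. \<psi> (x + v))" for v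
  proof (rule integrable_compact_support)
    show "continuous_on UNIV (\<lambda>x. \<psi> (x + v))"
      by (rule continuous_on_compose2[OF cont]) (auto intro!: continuous_intros)
    show "compact ((+) (- v) ` K)" using K by (intro compact_translation)
    show "\<psi> (x + v) = 0" if "x \<notin> (+) (- v) ` K" for x
    proof (rule K(2))
      show "x + v \<notin> K" using that image_eqI[of x "(+) (- v)" "x + v" K] by auto
    qed
  qed
  have Q0: "(\<integral>x. Q n x \<partial>lborel) = 0" for n
    unfolding Q_def using lborel_integral_translation[of \<psi>] \<psi>int \<psi>int' by simp
  have w: "integrable lborel (\<lambda>x. M * indicator B x)"
    by (intro integrable_mult_right integrable_real_indicator)
      (use emeasure_lborel_cball_finite[of "0::'a"] in \<open>auto simp: B_def\<close>)
  have [measurable]: "Q n \<in> borel_measurable borel" for n unfolding Q_def by measurable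
  have [measurable]: "D \<in> borel_measurable borel"
    by (rule borel_measurable_LIMSEQ_real[OF lim]) auto
  show "integrable lborel D"
    by (rule integrable_dominated_convergence[where s=Q, OF _ _ w]) (use lim Qb in auto)
  have "(\<lambda>n. \<integral>x. Q n x \<partial>lborel) \<longlonglongrightarrow> (\<integral>x. D x \<partial>lborel)"
    by (rule integral_dominated_convergence[OF _ _ w]) (use lim Qb in auto)
  then show "(\<integral>x. D x \<partial>lborel) = 0" by (simp add: Q0 LIMSEQ_const_iff)
qed

lemma integral_lebesgue_on:
  fixes f :: "'a::euclidean_space \<Rightarrow> real"
  assumes "open \<Omega>"
  shows "(\<integral>x. f x \<partial>lebesgue_on \<Omega>) = (\<integral>x. indicator \<Omega> x * f x \<partial>lebesgue)"
  using assms by (subst integral_restrict_space) auto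

lemma integrable_lebesgue_on:
  fixes f :: "'a::euclidean_space \<Rightarrow> 'b::euclidean_space"
  assumes "open \<Omega>"
  shows "integrable (lebesgue_on \<Omega>) f \<longleftrightarrow> integrable lebesgue (\<lambda>x. indicator \<Omega> x *\<^sub>R f x)"
  using assms by (subst integrable_restrict_space) auto

lemma AE_lebesgue_on:
  assumes "open \<Omega>"
  shows "(AE x in lebesgue_on \<Omega>. P x) \<longleftrightarrow> (AE x in lebesgue. x \<in> \<Omega> \<longrightarrow> P x)"
  using assms by (subst AE_restrict_space_iff) auto

lemma continuous_borel_measurable_lebesgue:
  fixes f :: "'a::euclidean_space \<Rightarrow> real"
  assumes "continuous_on UNIV f"
  shows "f \<in> borel_measurable lebesgue"
  using borel_measurable_continuous_onI[OF assms] by (simp add: measurable_completion)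

lemma L1_loc_integrable_mult:
  fixes f \<phi> :: "'a::euclidean_space \<Rightarrow> real"
  assumes "open \<Omega>" "f \<in> L1_loc \<Omega>" "continuous_on UNIV \<phi>" "compact K" "K \<subseteq> \<Omega>"
    "\<And>x. x \<notin> K \<Longrightarrow> \<phi> x = 0"
  shows "integrable (lebesgue_on \<Omega>) (\<lambda>x. f x * \<phi> x)"
proof -
  obtain M where M: "\<And>x. \<bar>\<phi> x\<bar> \<le> M"
    using compactly_supported_bounded[OF assms(3,4,6)] by metis
  have "integrable lebesgue (\<lambda>x. indicator K x * f x)"
    using assms by (simp add: L1_loc_def set_integrable_def)
  from integrable_mult_bounded[OF this continuous_borel_measurable_lebesgue[OF assms(3)] M]
  have "integrable lebesgue (\<lambda>x. indicator K x * f x * \<phi> x)" .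
  also have "(\<lambda>x. indicator K x * f x * \<phi> x) = (\<lambda>x. indicator \<Omega> x *\<^sub>R (f x * \<phi> x))"
  proof
    fix x show "indicator K x * f x * \<phi> x = indicator \<Omega> x *\<^sub>R (f x * \<phi> x)"
      using assms(5,6) by (cases "x \<in> K"; cases "x \<in> \<Omega>") auto
  qed
  finally show ?thesis using assms(1) by (simp add: integrable_lebesgue_on)
qed

lemma L1_loc_integrable_mult_test:
  fixes f \<phi> :: "'a::euclidean_space \<Rightarrow> real"
  assumes "open \<Omega>" "f \<in> L1_loc \<Omega>" "\<phi> \<in> C_c_infinity \<Omega>"
  shows "integrable (lebesgue_on \<Omega>) (\<lambda>x. f x * \<phi> x)"
    "b \<in> Basis \<Longrightarrow> integrable (lebesgue_on \<Omega>) (\<lambda>x. f x * frechet_derivative \<phi> (at x) b)"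
proof -
  obtain K where K: "compact K" "K \<subseteq> \<Omega>" "\<And>x. x \<notin> K \<Longrightarrow> \<phi> x = 0"
    "\<And>x b. x \<notin> K \<Longrightarrow> frechet_derivative \<phi> (at x) b = 0"
    using C_c_infinityE[OF assms(3)] by metis
  show "integrable (lebesgue_on \<Omega>) (\<lambda>x. f x * \<phi> x)"
    by (rule L1_loc_integrable_mult[OF assms(1,2) C_c_infinity_continuous[OF assms(3)] K(1-3)])
  show "integrable (lebesgue_on \<Omega>) (\<lambda>x. f x * frechet_derivative \<phi> (at x) b)" if "b \<in> Basis"
    by (rule L1_loc_integrable_mult[OF assms(1,2) C_c_infinity_continuous_deriv[OF assms(3) that] K(1,2,4)])
qed

lemma continuous_L1_loc:
  fixes f :: "'a::euclidean_space \<Rightarrow> 'b::euclidean_space"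
  assumes "continuous_on UNIV f"
  shows "f \<in> L1_loc \<Omega>"
proof -
  have "f absolutely_integrable_on K" if "compact K" for K
  proof -
    have "integrable lborel (\<lambda>x. indicator K x *\<^sub>R f x)"
      using assms that by (intro borel_integrable_compact) (auto intro: continuous_on_subset)
    then show ?thesis
      unfolding set_integrable_def using integrable_completion[OF borel_measurable_integrable] by blast
  qed
  then show ?thesis by (simp add: L1_loc_def)
qed

lemma L1_loc_diff:
  "f \<in> L1_loc \<Omega> \<Longrightarrow> g \<in> L1_loc \<Omega> \<Longrightarrow> (\<lambda>x. f x - g x) \<in> L1_loc \<Omega>"
  by (auto simp: L1_loc_def intro: set_integral_diff)

lemma L1_loc_inner:
  assumes "f \<in> L1_loc \<Omega>"
  shows "(\<lambda>x. f x \<bullet> b) \<in> L1_loc \<Omega>"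
  using assms integrable_inner_left[of b lebesgue "\<lambda>x. indicator K x *\<^sub>R f x" for K]
  by (auto simp: L1_loc_def set_integrable_def)

section \<open>Uniqueness of weak gradients\<close>

text \<open>Bump functions on a box converge boundedly to its indicator, so a function orthogonal to all test
  functions has integral 0 over every box.\<close>

lemma L1_loc_integral_box_eq_0:
  fixes f :: "'a::euclidean_space \<Rightarrow> real"
  assumes "open \<Omega>" "f \<in> L1_loc \<Omega>" "\<And>\<phi>. \<phi> \<in> C_c_infinity \<Omega> \<Longrightarrow> (\<integral>x. f x * \<phi> x \<partial>lebesgue_on \<Omega>) = 0"
    and sub: "cbox a b \<subseteq> \<Omega>"
  shows "(\<integral>x. indicator (box a b) x * f x \<partial>lebesgue) = 0"
proof -
  let ?F = "\<lambda>x. indicator (cbox a b) x * f x"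
  have F: "integrable lebesgue ?F"
    using assms by (simp add: L1_loc_def set_integrable_def)
  have b: "bump (1 / real (Suc n)) a b \<in> borel_measurable lebesgue" for n
    by (rule continuous_borel_measurable_lebesgue[OF C_k_continuous[OF C_k_bump[of _ 0]]]) simp
  have "(\<lambda>n. \<integral>x. ?F x * bump (1 / real (Suc n)) a b x \<partial>lebesgue)
      \<longlonglongrightarrow> (\<integral>x. ?F x * indicator (box a b) x \<partial>lebesgue)"
  proof (rule integral_dominated_convergence[where w="\<lambda>x. norm (?F x)"])
    show "AE x in lebesgue. (\<lambda>n. ?F x * bump (1 / real (Suc n)) a b x) \<longlonglongrightarrow> ?F x * indicator (box a b) x"
      by (intro AE_I2 tendsto_mult tendsto_const bump_tendsto_indicator)
    show "AE x in lebesgue. norm (?F x * bump (1 / real (Suc n)) a b x) \<le> norm (?F x)" for n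
    proof (intro AE_I2)
      fix x
      have "\<bar>bump (1 / real (Suc n)) a b x\<bar> \<le> 1"
        using bump_bounds[of "1 / real (Suc n)" a b x] by auto
      then have "\<bar>?F x\<bar> * \<bar>bump (1 / real (Suc n)) a b x\<bar> \<le> \<bar>?F x\<bar> * 1"
        by (intro mult_left_mono) auto
      then show "norm (?F x * bump (1 / real (Suc n)) a b x) \<le> norm (?F x)"
        by (simp add: abs_mult)
    qed
    show "(\<lambda>x. ?F x * indicator (box a b) x) \<in> borel_measurable lebesgue"
      by (intro borel_measurable_times borel_measurable_integrable[OF F] borel_measurable_indicator) simp
  qed (use borel_measurable_integrable[OF F] b F in \<open>simp_all add: borel_measurable_times
      del: of_nat_Suc\<close>)
  moreover have "(\<integral>x. ?F x * bump (1 / real (Suc n)) a b x \<partial>lebesgue) = 0" for n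
  proof -
    have "(\<integral>x. ?F x * bump (1 / real (Suc n)) a b x \<partial>lebesgue)
        = (\<integral>x. indicator \<Omega> x * (f x * bump (1 / real (Suc n)) a b x) \<partial>lebesgue)"
    proof (intro Bochner_Integration.integral_cong refl)
      fix x show "?F x * bump (1 / real (Suc n)) a b x = indicator \<Omega> x * (f x * bump (1 / real (Suc n)) a b x)"
      proof (cases "x \<in> box a b")
        case True
        then have "x \<in> cbox a b" using box_subset_cbox[of a b] by blast
        moreover from this have "x \<in> \<Omega>" using sub by blast
        ultimately show ?thesis by simp
      qed (simp add: bump_eq_0)
    qed
    then show ?thesis
      using assms(1) assms(3)[OF bump_in_C_c_infinity[OF _ sub]] by (simp add: integral_lebesgue_on)
  qed
  moreover have "(\<lambda>x. ?F x * indicator (box a b) x) = (\<lambda>x. indicator (box a b) x * f x)"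
  proof
    fix x show "?F x * indicator (box a b) x = indicator (box a b) x * f x"
      using box_subset_cbox[of a b] by (cases "x \<in> box a b") (auto simp: subset_iff)
  qed
  ultimately have "(\<lambda>n. 0) \<longlonglongrightarrow> (\<integral>x. indicator (box a b) x * f x \<partial>lebesgue)"
    by simp
  then show ?thesis by (simp add: LIMSEQ_const_iff)
qed

text \<open>All averages over small cubes vanish, and by Lebesgue's differentiation theorem they converge to
  the function almost everywhere.\<close>

lemma fundamental_lemma_variations:
  fixes f :: "'a::euclidean_space \<Rightarrow> real"
  assumes "open \<Omega>" "f \<in> L1_loc \<Omega>" "\<And>\<phi>. \<phi> \<in> C_c_infinity \<Omega> \<Longrightarrow> (\<integral>x. f x * \<phi> x \<partial>lebesgue_on \<Omega>) = 0"
  shows "AE x in lebesgue_on \<Omega>. f x = 0"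
proof -
  have box: "AE x in lebesgue. x \<in> cbox a b \<longrightarrow> f x = 0" if sub: "cbox a b \<subseteq> \<Omega>" for a b
  proof -
    let ?F = "\<lambda>x. indicator (cbox a b) x * f x"
    have F: "integrable lebesgue ?F"
      using assms that by (simp add: L1_loc_def set_integrable_def)
    then have "?F absolutely_integrable_on UNIV" by (simp add: set_integrable_def)
    then have "?F integrable_on cbox c d" for c d
      using absolutely_integrable_on_def integrable_on_subcbox by blast
    then obtain N where N: "negligible N"
       "\<And>x e. \<lbrakk>x \<notin> N; 0 < e\<rbrakk> \<Longrightarrow> \<exists>d>0. \<forall>h. 0 < h \<and> h < d \<longrightarrow>
           norm (integral (cbox x (x + h *\<^sub>R One)) ?F /\<^sub>R h ^ DIM('a) - ?F x) < e"
      by (rule integrable_ccontinuous_explicit[of ?F]) blast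
    have f0: "f x = 0" if x: "x \<in> box a b" "x \<notin> N" for x
    proof (rule ccontr)
      assume "f x \<noteq> 0"
      then obtain d where d: "d > 0" "\<And>h. 0 < h \<Longrightarrow> h < d \<Longrightarrow>
           norm (integral (cbox x (x + h *\<^sub>R One)) ?F /\<^sub>R h ^ DIM('a) - ?F x) < norm (f x)"
        using N(2)[OF x(2), of "norm (f x)"] by auto
      obtain e where e: "e > 0" "cball x e \<subseteq> box a b"
        using open_box x(1) open_contains_cball by blast
      define h where "h = min (d / 2) (e / DIM('a))"
      have h: "0 < h" "h < d" "h * DIM('a) \<le> e"
        using d(1) e(1) by (auto simp: h_def min_def field_simps)
      have sub': "cbox x (x + h *\<^sub>R One) \<subseteq> box a b"
      proof
        fix y assume y: "y \<in> cbox x (x + h *\<^sub>R One)"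
        have "norm (y - x) \<le> (\<Sum>i\<in>Basis. \<bar>(y - x) \<bullet> i\<bar>)" by (rule norm_le_l1)
        also have "\<dots> \<le> (\<Sum>i\<in>(Basis::'a set). h)"
          using y by (intro sum_mono) (auto simp: mem_box inner_simps)
        also have "\<dots> \<le> e" using h by (simp add: mult.commute)
        finally show "y \<in> box a b" using e(2) by (auto simp: dist_norm norm_minus_commute)
      qed
      let ?B = "cbox x (x + h *\<^sub>R One)"
      have "integral ?B ?F = integral (box x (x + h *\<^sub>R One)) ?F"
        by (rule integral_open_interval[symmetric])
      also have "\<dots> = integral (box x (x + h *\<^sub>R One)) f"
        using sub' box_subset_cbox[of x "x + h *\<^sub>R One"] box_subset_cbox[of a b]
        by (intro integral_cong) (auto simp: indicator_def)
      also have "\<dots> = (\<integral>y. indicator (box x (x + h *\<^sub>R One)) y * f y \<partial>lebesgue)"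
      proof -
        have s: "cbox x (x + h *\<^sub>R One) \<subseteq> \<Omega>" using sub sub' box_subset_cbox by blast
        have "f absolutely_integrable_on cbox x (x + h *\<^sub>R One)"
          using assms(2) s by (auto simp: L1_loc_def)
        then have "f absolutely_integrable_on box x (x + h *\<^sub>R One)"
          by (rule set_integrable_subset) (auto simp: box_subset_cbox)
        then show ?thesis
          using set_lebesgue_integral_eq_integral(2) by (fastforce simp: set_lebesgue_integral_def)
      qed
      also have "\<dots> = 0"
      proof (rule L1_loc_integral_box_eq_0[OF assms(1-3)])
        show "cbox x (x + h *\<^sub>R One) \<subseteq> \<Omega>" using sub sub' box_subset_cbox[of a b] by blast
      qed
      finally show False using d(2)[OF h(1,2)] x(1) box_subset_cbox[of a b] by auto
    qed
    have "negligible (N \<union> (cbox a b - box a b))"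
      using negligible_Un[OF N(1) negligible_frontier_interval] .
    then have "N \<union> (cbox a b - box a b) \<in> null_sets lebesgue"
      by (simp add: negligible_iff_null_sets)
    then have "AE x in lebesgue. x \<notin> N \<union> (cbox a b - box a b)" by (rule AE_not_in)
    then show ?thesis by eventually_elim (use f0 in blast)
  qed
  obtain \<D> where \<D>: "countable \<D>" "\<And>X. X \<in> \<D> \<Longrightarrow> X \<subseteq> \<Omega> \<and> (\<exists>a b. X = cbox a b)" "\<Union>\<D> = \<Omega>"
    using open_countable_Union_open_cbox[OF assms(1)] by (metis PowD subsetD)
  have "AE x in lebesgue. \<forall>X\<in>\<D>. x \<in> X \<longrightarrow> f x = 0"
    unfolding AE_ball_countable[OF \<D>(1)]
  proof
    fix X assume "X \<in> \<D>"
    then obtain a b where "X = cbox a b" "cbox a b \<subseteq> \<Omega>" using \<D>(2) by metis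
    then show "AE x in lebesgue. x \<in> X \<longrightarrow> f x = 0" using box by metis
  qed
  then show ?thesis
    unfolding AE_lebesgue_on[OF assms(1)] by eventually_elim (use \<D>(3) in blast)
qed

lemma is_weak_gradient_unique:
  assumes "open \<Omega>" "is_weak_gradient \<Omega> u g" "is_weak_gradient \<Omega> u g'"
  shows "AE x in lebesgue_on \<Omega>. g x = g' x"
proof -
  have L: "(\<lambda>x. g x \<bullet> b) \<in> L1_loc \<Omega>" "(\<lambda>x. g' x \<bullet> b) \<in> L1_loc \<Omega>" for b
    using assms by (auto simp: is_weak_gradient_def intro: L1_loc_inner)
  have "AE x in lebesgue_on \<Omega>. g x \<bullet> b - g' x \<bullet> b = 0" if b: "b \<in> Basis" for b
  proof (rule fundamental_lemma_variations[OF assms(1) L1_loc_diff[OF L]])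
    fix \<phi> assume \<phi>: "\<phi> \<in> C_c_infinity \<Omega>"
    have "(\<integral>x. (g x \<bullet> b - g' x \<bullet> b) * \<phi> x \<partial>lebesgue_on \<Omega>)
      = (\<integral>x. (g x \<bullet> b) * \<phi> x \<partial>lebesgue_on \<Omega>) - (\<integral>x. (g' x \<bullet> b) * \<phi> x \<partial>lebesgue_on \<Omega>)"
      unfolding left_diff_distrib
      by (intro Bochner_Integration.integral_diff L1_loc_integrable_mult_test assms(1) L \<phi>)
    also have "\<dots> = 0"
    proof -
      have "- (\<integral>x. (g x \<bullet> b) * \<phi> x \<partial>lebesgue_on \<Omega>) = - (\<integral>x. (g' x \<bullet> b) * \<phi> x \<partial>lebesgue_on \<Omega>)"
        using assms(2,3) \<phi> b unfolding is_weak_gradient_def by simp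
      then show ?thesis by simp
    qed
    finally show "(\<integral>x. (g x \<bullet> b - g' x \<bullet> b) * \<phi> x \<partial>lebesgue_on \<Omega>) = 0" .
  qed
  then have "AE x in lebesgue_on \<Omega>. \<forall>b\<in>Basis. g x \<bullet> b - g' x \<bullet> b = 0"
    by (subst AE_ball_countable) (auto simp: countable_finite)
  then show ?thesis by eventually_elim (metis euclidean_eqI eq_iff_diff_eq_0)
qed

lemma weak_grad_AE:
  assumes "open \<Omega>" "is_weak_gradient \<Omega> u g"
  shows "AE x in lebesgue_on \<Omega>. weak_grad \<Omega> u x = g x"
  unfolding weak_grad_def
  by (rule is_weak_gradient_unique[OF assms(1) someI[of "is_weak_gradient \<Omega> u"] assms(2)]) (rule assms(2))

lemma integral_lebesgue_eq_lborel:
  fixes f :: "'a::euclidean_space \<Rightarrow> real"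
  assumes "f \<in> borel_measurable borel"
  shows "(\<integral>x. f x \<partial>lebesgue) = (\<integral>x. f x \<partial>lborel)"
  using assms by (intro integral_completion) simp

lemma integration_by_parts:
  fixes h Dh \<phi> :: "'a::euclidean_space \<Rightarrow> real"
  assumes \<phi>: "\<phi> \<in> C_c_infinity \<Omega>" and b: "b \<in> Basis" and h: "continuous_on UNIV h"
    and der: "\<And>x t. ((\<lambda>t. h (x + t *\<^sub>R b)) has_real_derivative Dh (x + t *\<^sub>R b)) (at t)"
    and bound: "\<And>x. \<bar>Dh x\<bar> \<le> M"
  shows "(\<integral>x. h x * frechet_derivative \<phi> (at x) b \<partial>lborel) = - (\<integral>x. Dh x * \<phi> x \<partial>lborel)"
proof -
  obtain K where K: "compact K" "\<And>x. x \<notin> K \<Longrightarrow> \<phi> x = 0"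
    "\<And>x b. x \<notin> K \<Longrightarrow> frechet_derivative \<phi> (at x) b = 0"
    using C_c_infinityE[OF \<phi>] by metis
  obtain M1 where M1: "\<And>x. \<bar>\<phi> x\<bar> \<le> M1"
    using C_c_infinity_bounded[OF \<phi>] by metis
  have c: "continuous_on UNIV (\<lambda>x. h x * frechet_derivative \<phi> (at x) b)"
    using h C_c_infinity_continuous_deriv[OF \<phi> b] by (rule continuous_on_mult)
  have 0: "h x * frechet_derivative \<phi> (at x) b = 0" if "x \<notin> K" for x
    using K(3)[OF that] by simp
  obtain M2 where M2: "\<And>x. \<bar>h x * frechet_derivative \<phi> (at x) b\<bar> \<le> M2"
    using compactly_supported_bounded[OF c K(1) 0] by metis
  have int: "integrable lborel (\<lambda>x. h x * frechet_derivative \<phi> (at x) b)"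
    by (rule integrable_compact_support[OF c K(1) 0])
  let ?D = "\<lambda>x. Dh x * \<phi> x + h x * frechet_derivative \<phi> (at x) b"
  have d: "((\<lambda>t. h (x + t *\<^sub>R b) * \<phi> (x + t *\<^sub>R b)) has_real_derivative ?D (x + t *\<^sub>R b)) (at t)" for x t
    using DERIV_mult[OF der[of x t] C_c_infinity_dir_deriv[OF \<phi>, of x b t]]
    by (simp add: mult.commute)
  have bd: "\<bar>?D x\<bar> \<le> M * M1 + M2" for x
  proof -
    have "\<bar>Dh x * \<phi> x\<bar> \<le> M * M1"
      using bound[of x] M1[of x] unfolding abs_mult by (intro mult_mono) auto
    then show ?thesis using M2[of x] by linarith
  qed
  have c\<phi>: "continuous_on UNIV (\<lambda>x. h x * \<phi> x)"
    using h C_c_infinity_continuous[OF \<phi>] by (rule continuous_on_mult)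
  have 0: "h x * \<phi> x = 0" if "x \<notin> K" for x using K(2)[OF that] by simp
  note D = integral_dir_deriv_eq_0[OF c\<phi> K(1) 0 d bd]
  have "(\<integral>x. Dh x * \<phi> x \<partial>lborel) = (\<integral>x. ?D x - h x * frechet_derivative \<phi> (at x) b \<partial>lborel)"
    by simp
  also have "\<dots> = (\<integral>x. ?D x \<partial>lborel) - (\<integral>x. h x * frechet_derivative \<phi> (at x) b \<partial>lborel)"
    by (intro Bochner_Integration.integral_diff D(1) int)
  finally show ?thesis using D(2) by simp
qed

text \<open>The classical gradient.\<close>

definition gradient :: "('a::euclidean_space \<Rightarrow> real) \<Rightarrow> 'a \<Rightarrow> 'a" where
  "gradient \<phi> x = (\<Sum>b\<in>Basis. frechet_derivative \<phi> (at x) b *\<^sub>R b)"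

lemma gradient_inner: "b \<in> Basis \<Longrightarrow> gradient \<phi> x \<bullet> b = frechet_derivative \<phi> (at x) b"
  by (simp add: gradient_def inner_sum_left_Basis)

lemma continuous_gradient:
  assumes "\<phi> \<in> C_c_infinity \<Omega>"
  shows "continuous_on UNIV (gradient \<phi>)"
  unfolding gradient_def[abs_def]
  by (intro continuous_on_sum continuous_on_scaleR continuous_on_const C_c_infinity_continuous_deriv[OF assms])

lemma integral_lebesgue_on_lborel:
  fixes f :: "'a::euclidean_space \<Rightarrow> real"
  assumes "open \<Omega>" "f \<in> borel_measurable borel" "\<And>x. x \<notin> \<Omega> \<Longrightarrow> f x = 0"
  shows "(\<integral>x. f x \<partial>lebesgue_on \<Omega>) = (\<integral>x. f x \<partial>lborel)"
proof -
  have "(\<integral>x. f x \<partial>lebesgue_on \<Omega>) = (\<integral>x. f x \<partial>lebesgue)"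
    unfolding integral_lebesgue_on[OF assms(1)]
  proof (rule Bochner_Integration.integral_cong[OF refl])
    show "indicator \<Omega> x * f x = f x" for x using assms(3)[of x] by (cases "x \<in> \<Omega>") auto
  qed
  then show ?thesis using integral_lebesgue_eq_lborel[OF assms(2)] by simp
qed

lemma C_c_infinity_borel:
  assumes "\<phi> \<in> C_c_infinity \<Omega>"
  shows "\<phi> \<in> borel_measurable borel"
    "b \<in> Basis \<Longrightarrow> (\<lambda>x. frechet_derivative \<phi> (at x) b) \<in> borel_measurable borel"
  using C_c_infinity_continuous[OF assms] C_c_infinity_continuous_deriv[OF assms]
  by (auto intro: borel_measurable_continuous_onI)

lemma C_c_infinity_outside:
  assumes "\<phi> \<in> C_c_infinity \<Omega>" "x \<notin> \<Omega>"
  shows "\<phi> x = 0" "frechet_derivative \<phi> (at x) b = 0"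
  using assms by (metis C_c_infinityE subsetD)+

lemma is_weak_gradient_test:
  assumes "open \<Omega>" "\<phi> \<in> C_c_infinity \<Omega>"
  shows "is_weak_gradient \<Omega> \<phi> (gradient \<phi>)"
  unfolding is_weak_gradient_def
proof (intro conjI ballI)
  show "\<phi> \<in> L1_loc \<Omega>" "gradient \<phi> \<in> L1_loc \<Omega>"
    using C_c_infinity_continuous[OF assms(2)] continuous_gradient[OF assms(2)]
    by (auto intro: continuous_L1_loc)
  fix \<psi> and b :: 'a assume \<psi>: "\<psi> \<in> C_c_infinity \<Omega>" and b: "b \<in> Basis"
  obtain M where M: "\<And>x. \<bar>frechet_derivative \<phi> (at x) b\<bar> \<le> M"
    using C_c_infinity_bounded_deriv[OF assms(2) b] by metis
  have "(\<integral>x. \<phi> x * frechet_derivative \<psi> (at x) b \<partial>lborel) = - (\<integral>x. frechet_derivative \<phi> (at x) b * \<psi> x \<partial>lborel)"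
    by (rule integration_by_parts[OF \<psi> b C_c_infinity_continuous[OF assms(2)]
          C_c_infinity_dir_deriv[OF assms(2)] M])
  moreover have "(\<integral>x. \<phi> x * frechet_derivative \<psi> (at x) b \<partial>lebesgue_on \<Omega>) = (\<integral>x. \<phi> x * frechet_derivative \<psi> (at x) b \<partial>lborel)"
    using C_c_infinity_borel[OF \<psi>] C_c_infinity_borel[OF assms(2)] b C_c_infinity_outside[OF \<psi>]
    by (intro integral_lebesgue_on_lborel assms(1)) auto
  moreover have "(\<integral>x. frechet_derivative \<phi> (at x) b * \<psi> x \<partial>lebesgue_on \<Omega>) = (\<integral>x. frechet_derivative \<phi> (at x) b * \<psi> x \<partial>lborel)"
    using C_c_infinity_borel[OF \<psi>] C_c_infinity_borel[OF assms(2)] b C_c_infinity_outside[OF \<psi>]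
    by (intro integral_lebesgue_on_lborel assms(1)) auto
  ultimately show "(\<integral>x. \<phi> x * frechet_derivative \<psi> (at x) b \<partial>lebesgue_on \<Omega>)
      = - (\<integral>x. (gradient \<phi> x \<bullet> b) * \<psi> x \<partial>lebesgue_on \<Omega>)"
    by (simp add: gradient_inner[OF b])
qed

lemma is_weak_gradient_const:
  assumes "open \<Omega>"
  shows "is_weak_gradient \<Omega> (\<lambda>x. c) (\<lambda>x. 0)"
  unfolding is_weak_gradient_def
proof (intro conjI ballI)
  show "(\<lambda>x. c) \<in> L1_loc \<Omega>" "(\<lambda>x. 0::'a) \<in> L1_loc \<Omega>" by (auto intro!: continuous_L1_loc)
  fix \<psi> and b :: 'a assume \<psi>: "\<psi> \<in> C_c_infinity \<Omega>" and b: "b \<in> Basis"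
  have "(\<integral>x. c * frechet_derivative \<psi> (at x) b \<partial>lborel) = - (\<integral>x. 0 * \<psi> x \<partial>lborel)"
    by (rule integration_by_parts[OF \<psi> b, of _ _ 0]) (auto intro!: derivative_eq_intros)
  moreover have "(\<integral>x. c * frechet_derivative \<psi> (at x) b \<partial>lebesgue_on \<Omega>) = (\<integral>x. c * frechet_derivative \<psi> (at x) b \<partial>lborel)"
    using C_c_infinity_borel[OF \<psi>] b C_c_infinity_outside[OF \<psi>]
    by (intro integral_lebesgue_on_lborel assms(1)) auto
  ultimately show "(\<integral>x. c * frechet_derivative \<psi> (at x) b \<partial>lebesgue_on \<Omega>)
      = - (\<integral>x. (0 \<bullet> b) * \<psi> x \<partial>lebesgue_on \<Omega>)"
    by (simp del: integral_mult_right_zero)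
qed

section \<open>Mollification\<close>

text \<open>Correlation with the kernel \<open>w\<close>. The kernel is evaluated at \<open>y - x\<close> rather than \<open>x - y\<close>, so that
  the kernel \<open>bump c 0 (h *\<^sub>R One)\<close> weights \<open>v\<close> over the cube with lower corner \<open>x\<close>.\<close>

definition mollify :: "('a::euclidean_space \<Rightarrow> real) \<Rightarrow> ('a \<Rightarrow> real) \<Rightarrow> 'a \<Rightarrow> real" where
  "mollify w v x = (\<integral>y. v y * w (y - x) \<partial>lebesgue)"

lemma measurable_translate:
  assumes "continuous_on UNIV w"
  shows "(\<lambda>y. w (y - x) :: real) \<in> borel_measurable lebesgue"
  by (intro continuous_borel_measurable_lebesgue continuous_on_compose2[OF assms])
    (auto intro!: continuous_intros)

lemma mollify_integrable:
  assumes "integrable lebesgue v" "continuous_on UNIV w" "\<And>x. \<bar>w x\<bar> \<le> M"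
  shows "integrable lebesgue (\<lambda>y. v y * w (y - x) :: real)"
  using integrable_mult_bounded[OF assms(1) measurable_translate[OF assms(2)] assms(3)] .

lemma abs_mollify_le:
  assumes "integrable lebesgue v" "continuous_on UNIV w" "\<And>x. \<bar>w x\<bar> \<le> M"
  shows "\<bar>mollify w v x\<bar> \<le> M * (\<integral>y. \<bar>v y\<bar> \<partial>lebesgue)"
proof -
  have "\<bar>mollify w v x\<bar> \<le> (\<integral>y. \<bar>v y * w (y - x)\<bar> \<partial>lebesgue)"
    unfolding mollify_def by (rule integral_abs_bound)
  also have "\<dots> \<le> (\<integral>y. M * \<bar>v y\<bar> \<partial>lebesgue)"
  proof (rule integral_mono)
    show "integrable lebesgue (\<lambda>y. \<bar>v y * w (y - x)\<bar>)"
      using mollify_integrable[OF assms] by simp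
    show "\<bar>v y * w (y - x)\<bar> \<le> M * \<bar>v y\<bar>" for y
      using mult_left_mono[OF assms(3)[of "y - x"], of "\<bar>v y\<bar>"] by (simp add: abs_mult mult.commute)
  qed (use assms in simp)
  finally show ?thesis by simp
qed

lemma continuous_mollify:
  assumes "integrable lebesgue v" "continuous_on UNIV w" "\<And>x. \<bar>w x\<bar> \<le> M"
  shows "continuous_on UNIV (mollify w v)"
  unfolding continuous_on_sequentially
proof (intro allI ballI impI)
  fix X :: "nat \<Rightarrow> 'a" and x assume X: "(\<forall>n. X n \<in> UNIV) \<and> X \<longlonglongrightarrow> x"
  have M: "norm (v y * w (y - X n)) \<le> norm (M * v y)" for y n
  proof -
    have "\<bar>v y\<bar> * \<bar>w (y - X n)\<bar> \<le> \<bar>v y\<bar> * \<bar>M\<bar>"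
      using assms(3)[of "y - X n"] by (intro mult_left_mono) auto
    then show ?thesis by (simp add: abs_mult mult.commute)
  qed
  have "(\<lambda>n. w (y - X n)) \<longlonglongrightarrow> w (y - x)" for y
    using X by (intro continuous_on_tendsto_compose[OF assms(2)] tendsto_intros) auto
  then have "(\<lambda>n. mollify w v (X n)) \<longlonglongrightarrow> mollify w v x"
    unfolding mollify_def using assms(1) measurable_translate[OF assms(2)] M
    by (intro integral_dominated_convergence[where w="\<lambda>y. norm (M * v y)"] AE_I2 tendsto_mult tendsto_const
        borel_measurable_times borel_measurable_integrable[OF assms(1)] integrable_norm integrable_mult_right) auto
  then show "(mollify w v \<circ> X) \<longlonglongrightarrow> mollify w v x" by (simp add: o_def)
qed

lemma mollify_dir_deriv:
  assumes v: "integrable lebesgue v" and \<eta>: "\<eta> \<in> C_c_infinity \<Omega>" and b: "b \<in> Basis"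
  shows "((\<lambda>t. mollify \<eta> v (x + t *\<^sub>R b)) has_real_derivative
      - mollify (\<lambda>z. frechet_derivative \<eta> (at z) b) v (x + t *\<^sub>R b)) (at t)"
proof -
  let ?d = "\<lambda>z. frechet_derivative \<eta> (at z) b"
  obtain M1 where M1: "\<And>x. \<bar>\<eta> x\<bar> \<le> M1"
    using C_c_infinity_bounded[OF \<eta>] by metis
  obtain M where M: "\<And>x. \<bar>?d x\<bar> \<le> M"
    using C_c_infinity_bounded_deriv[OF \<eta> b] by metis
  have c: "continuous_on UNIV \<eta>" "continuous_on UNIV ?d"
    using \<eta> b by (auto intro: C_c_infinity_continuous C_c_infinity_continuous_deriv)
  have *: "((\<lambda>t. mollify \<eta> v (x + t *\<^sub>R b)) has_real_derivative - mollify ?d v x) (at 0)" for x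
    unfolding DERIV_def tendsto_at_iff_sequentially
  proof (intro allI impI)
    fix X :: "nat \<Rightarrow> real" assume X: "\<forall>i. X i \<in> UNIV - {0}" "X \<longlonglongrightarrow> 0"
    define Q where "Q n y = (\<eta> (y - (x + X n *\<^sub>R b)) - \<eta> (y - x)) / X n" for n y
    have der: "((\<lambda>s. \<eta> ((y - x) + s *\<^sub>R (- b))) has_real_derivative
        - ?d ((y - x) + s *\<^sub>R (- b))) (at s)" for y s
    proof -
      have "((\<lambda>s. \<eta> ((y - x) + s *\<^sub>R b)) has_real_derivative ?d ((y - x) + (- s) *\<^sub>R b)) (at (- s))"
        using C_c_infinity_dir_deriv[OF \<eta>] .
      from DERIV_chain2[OF this DERIV_minus[OF DERIV_ident]] show ?thesis by simp
    qed
    have lim: "(\<lambda>n. Q n y) \<longlonglongrightarrow> - ?d (y - x)" for y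
    proof -
      have "((\<lambda>h. (\<eta> ((y - x) + h *\<^sub>R (- b)) - \<eta> (y - x)) / h) \<longlongrightarrow> - ?d (y - x)) (at 0)"
        using der[of y 0] by (simp add: DERIV_def)
      then have "((\<lambda>h. (\<eta> ((y - x) + h *\<^sub>R (- b)) - \<eta> (y - x)) / h) \<circ> X) \<longlonglongrightarrow> - ?d (y - x)"
        using X unfolding tendsto_at_iff_sequentially by blast
      then show ?thesis by (simp add: o_def Q_def algebra_simps)
    qed
    have Qb: "\<bar>Q n y\<bar> \<le> M" for n y
    proof -
      have "norm (\<eta> ((y - x) + X n *\<^sub>R (- b)) - \<eta> ((y - x) + 0 *\<^sub>R (- b))) \<le> M * norm (X n - 0)"
      proof (rule field_differentiable_bound[of UNIV])
        show "((\<lambda>s. \<eta> ((y - x) + s *\<^sub>R (- b))) has_field_derivative - ?d ((y - x) + s *\<^sub>R (- b)))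
            (at s within UNIV)" for s
          using der by blast
      qed (use M in auto)
      moreover have "X n \<noteq> 0" using X by auto
      ultimately show ?thesis by (simp add: Q_def field_simps)
    qed
    have cQ: "continuous_on UNIV (Q n)" for n
      unfolding Q_def using X(1)
      by (auto intro!: continuous_intros continuous_on_compose2[OF c(1)])
    have "(\<lambda>n. \<integral>y. v y * Q n y \<partial>lebesgue) \<longlonglongrightarrow> (\<integral>y. v y * - ?d (y - x) \<partial>lebesgue)"
    proof (rule integral_dominated_convergence[where w="\<lambda>y. norm (M * v y)"])
      show "AE y in lebesgue. norm (v y * Q n y) \<le> norm (M * v y)" for n
      proof (intro AE_I2)
        fix y
        have "\<bar>v y\<bar> * \<bar>Q n y\<bar> \<le> \<bar>v y\<bar> * \<bar>M\<bar>"
          using Qb[of n y] by (intro mult_left_mono) auto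
        then show "norm (v y * Q n y) \<le> norm (M * v y)" by (simp add: abs_mult mult.commute)
      qed
      show "AE y in lebesgue. (\<lambda>n. v y * Q n y) \<longlonglongrightarrow> v y * - ?d (y - x)"
        by (intro AE_I2 tendsto_mult tendsto_const lim)
      show "(\<lambda>y. v y * Q n y) \<in> borel_measurable lebesgue" for n
        by (intro borel_measurable_times borel_measurable_integrable[OF v]
            continuous_borel_measurable_lebesgue cQ)
      show "(\<lambda>y. v y * - ?d (y - x)) \<in> borel_measurable lebesgue"
        by (intro borel_measurable_times borel_measurable_integrable[OF v] borel_measurable_uminus
            measurable_translate c)
    qed (use v in simp)
    moreover have "(\<integral>y. v y * Q n y \<partial>lebesgue) = (mollify \<eta> v (x + X n *\<^sub>R b) - mollify \<eta> v x) / X n" for n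
    proof -
      have "mollify \<eta> v (x + X n *\<^sub>R b) - mollify \<eta> v x
          = (\<integral>y. v y * \<eta> (y - (x + X n *\<^sub>R b)) - v y * \<eta> (y - x) \<partial>lebesgue)"
        unfolding mollify_def
        by (intro Bochner_Integration.integral_diff[symmetric] mollify_integrable[OF v c(1) M1])
      also have "\<dots> / X n = (\<integral>y. (v y * \<eta> (y - (x + X n *\<^sub>R b)) - v y * \<eta> (y - x)) / X n \<partial>lebesgue)"
        by simp
      finally show ?thesis by (simp only: Q_def right_diff_distrib times_divide_eq_right)
    qed
    ultimately show "((\<lambda>h. (mollify \<eta> v (x + (0 + h) *\<^sub>R b) - mollify \<eta> v (x + 0 *\<^sub>R b)) / h) \<circ> X)
        \<longlonglongrightarrow> - mollify ?d v x"
      by (simp add: o_def mollify_def)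
  qed
  have "((\<lambda>s. mollify \<eta> v (x + (s + t) *\<^sub>R b)) has_real_derivative - mollify ?d v (x + t *\<^sub>R b)) (at 0)"
    using *[of "x + t *\<^sub>R b"] by (simp add: algebra_simps)
  then show ?thesis
    using DERIV_shift[of "\<lambda>s. mollify \<eta> v (x + s *\<^sub>R b)" "- mollify ?d v (x + t *\<^sub>R b)" 0 t] by simp
qed

section \<open>Averages over cubes\<close>

text \<open>The mean over the cube of side \<open>h\<close> with lower corner \<open>x\<close>.\<close>

definition cube_average :: "real \<Rightarrow> ('a::euclidean_space \<Rightarrow> real) \<Rightarrow> 'a \<Rightarrow> real" where
  "cube_average h v x =
     (\<integral>y. v y * indicator (box x (x + h *\<^sub>R One)) y \<partial>lebesgue) / h ^ DIM('a)"

lemma mollify_bump_tendsto: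
  fixes v :: "'a::euclidean_space \<Rightarrow> real"
  assumes v: "integrable lebesgue v" and "h > 0"
  shows "(\<lambda>n. mollify (bump (1 / Suc n) 0 (h *\<^sub>R One)) v x / h ^ DIM('a)) \<longlonglongrightarrow> cube_average h v x"
proof -
  let ?B = "\<lambda>n. bump (1 / real (Suc n)) x (x + h *\<^sub>R One)"
  have cB: "continuous_on UNIV (?B n)" for n by (rule C_k_continuous[OF C_k_bump[of _ 0]]) simp
  have "(\<lambda>n. \<integral>y. v y * ?B n y \<partial>lebesgue)
      \<longlonglongrightarrow> (\<integral>y. v y * indicator (box x (x + h *\<^sub>R One)) y \<partial>lebesgue)"
  proof (rule integral_dominated_convergence[where w="\<lambda>y. norm (v y)"])
    show "AE y in lebesgue. (\<lambda>n. v y * ?B n y) \<longlonglongrightarrow> v y * indicator (box x (x + h *\<^sub>R One)) y"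
      by (intro AE_I2 tendsto_mult tendsto_const bump_tendsto_indicator)
    show "AE y in lebesgue. norm (v y * ?B n y) \<le> norm (v y)" for n
    proof (intro AE_I2)
      fix y
      have "\<bar>?B n y\<bar> \<le> 1"
        using bump_bounds[of "1 / real (Suc n)" x "x + h *\<^sub>R One" y] by auto
      then have "\<bar>v y\<bar> * \<bar>?B n y\<bar> \<le> \<bar>v y\<bar> * 1" by (intro mult_left_mono) auto
      then show "norm (v y * ?B n y) \<le> norm (v y)" by (simp add: abs_mult)
    qed
    show "(\<lambda>y. v y * ?B n y) \<in> borel_measurable lebesgue" for n
      by (intro borel_measurable_times borel_measurable_integrable[OF v]
          continuous_borel_measurable_lebesgue cB)
    show "(\<lambda>y. v y * indicator (box x (x + h *\<^sub>R One)) y) \<in> borel_measurable lebesgue"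
      by (intro borel_measurable_times borel_measurable_integrable[OF v] borel_measurable_indicator) simp
  qed (use v in simp)
  then have "(\<lambda>n. (\<integral>y. v y * ?B n y \<partial>lebesgue) / h ^ DIM('a)) \<longlonglongrightarrow> cube_average h v x"
    unfolding cube_average_def using assms by (intro tendsto_divide tendsto_const) auto
  then show ?thesis unfolding mollify_def bump_translate .
qed

lemma continuous_mollify_bump:
  assumes "integrable lebesgue v" "c > 0"
  shows "continuous_on UNIV (mollify (bump c a b) v)"
proof (rule continuous_mollify[OF assms(1)])
  show "continuous_on UNIV (bump c a b)" by (rule C_k_continuous[OF C_k_bump[OF assms(2), of 0]])
  show "\<bar>bump c a b x\<bar> \<le> 1" for x using bump_bounds[OF assms(2), of a b x] by simp
qed

lemma cube_average_borel:
  assumes "integrable lebesgue v" "h > 0"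
  shows "cube_average h v \<in> borel_measurable borel"
  by (rule borel_measurable_LIMSEQ_real[OF mollify_bump_tendsto[OF assms]])
    (intro borel_measurable_divide borel_measurable_const borel_measurable_continuous_onI
      continuous_mollify_bump assms(1), simp)

lemma abs_cube_average_le:
  fixes v :: "'a::euclidean_space \<Rightarrow> real"
  assumes "integrable lebesgue v" "h > 0"
  shows "ennreal \<bar>cube_average h v x\<bar>
    \<le> (\<integral>\<^sup>+y. ennreal \<bar>v y\<bar> * indicator (box x (x + h *\<^sub>R One)) y \<partial>lebesgue) / ennreal (h ^ DIM('a))"
proof -
  let ?f = "\<lambda>y. v y * indicator (box x (x + h *\<^sub>R One)) y"
  have int: "integrable lebesgue ?f"
    by (rule integrable_mult_bounded[OF assms(1) borel_measurable_indicator, where C=1]) simp_all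
  have "ennreal \<bar>\<integral>y. ?f y \<partial>lebesgue\<bar> \<le> (\<integral>\<^sup>+y. ennreal (norm (?f y)) \<partial>lebesgue)"
    using integral_norm_bound_ennreal[OF int] by simp
  also have "\<dots> = (\<integral>\<^sup>+y. ennreal \<bar>v y\<bar> * indicator (box x (x + h *\<^sub>R One)) y \<partial>lebesgue)"
    by (intro nn_integral_cong) (auto simp: indicator_def)
  finally have "ennreal \<bar>\<integral>y. ?f y \<partial>lebesgue\<bar> / ennreal (h ^ DIM('a))
      \<le> (\<integral>\<^sup>+y. ennreal \<bar>v y\<bar> * indicator (box x (x + h *\<^sub>R One)) y \<partial>lebesgue) / ennreal (h ^ DIM('a))"
    by (rule divide_right_mono_ennreal)
  moreover have "ennreal \<bar>cube_average h v x\<bar> = ennreal \<bar>\<integral>y. ?f y \<partial>lebesgue\<bar> / ennreal (h ^ DIM('a))"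
    using assms(2) by (simp add: cube_average_def divide_ennreal abs_divide)
  ultimately show ?thesis by simp
qed

text \<open>Averaging is a contraction in \<open>L1\<close>, by Tonelli's theorem.\<close>

lemma nn_integral_cube_average_le:
  fixes v :: "'a::euclidean_space \<Rightarrow> real"
  assumes v: "integrable lebesgue v" and h: "h > 0"
  shows "(\<integral>\<^sup>+x. ennreal (norm (cube_average h v x)) \<partial>lebesgue) \<le> (\<integral>\<^sup>+x. ennreal (norm (v x)) \<partial>lebesgue)"
proof -
  obtain v' where v'[measurable]: "v' \<in> borel_measurable lborel" and eq: "AE x in lborel. v x = v' x"
    using completion_ex_borel_measurable_real[OF borel_measurable_integrable[OF v]] by auto
  let ?V = "\<lambda>y. ennreal \<bar>v' y\<bar>"
  let ?hd = "ennreal (h ^ DIM('a))"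
  have AEeq: "AE x in lebesgue. v x = v' x" using eq by (rule AE_completion)
  have box: "indicator (box x (x + h *\<^sub>R One)) y = (indicator (box (y - h *\<^sub>R One) y) x :: ennreal)" for x y :: 'a
    by (auto simp: indicator_def mem_box inner_simps algebra_simps)
  have [measurable]: "(\<lambda>(x, y). indicator (box x (x + h *\<^sub>R One)) y :: ennreal)
      \<in> borel_measurable (lborel \<Otimes>\<^sub>M (lborel :: 'a measure))"
  proof -
    let ?S = "\<Inter>i\<in>Basis. {p::'a \<times> 'a. fst p \<bullet> i < snd p \<bullet> i \<and> snd p \<bullet> i < (fst p + h *\<^sub>R One) \<bullet> i}"
    have "open ?S"
      by (intro open_INT finite_Basis ballI open_Collect_conj open_Collect_less continuous_intros)
    then have "?S \<in> sets (borel \<Otimes>\<^sub>M borel)" unfolding borel_prod by (rule borel_open)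
    then have S: "?S \<in> sets (lborel \<Otimes>\<^sub>M lborel)"
      by (simp cong: sets_pair_measure_cong)
    have "(\<lambda>(x, y). indicator (box x (x + h *\<^sub>R One)) y :: ennreal) = indicator ?S"
      by (auto simp: indicator_def mem_box fun_eq_iff)
    then show ?thesis using S by simp
  qed
  have "(\<integral>\<^sup>+x. ennreal (norm (cube_average h v x)) \<partial>lebesgue)
      \<le> (\<integral>\<^sup>+x. (\<integral>\<^sup>+y. ennreal \<bar>v y\<bar> * indicator (box x (x + h *\<^sub>R One)) y \<partial>lebesgue) / ?hd \<partial>lebesgue)"
    using abs_cube_average_le[OF assms] by (intro nn_integral_mono) simp
  also have "\<dots> = (\<integral>\<^sup>+x. (\<integral>\<^sup>+y. ?V y * indicator (box x (x + h *\<^sub>R One)) y \<partial>lborel) / ?hd \<partial>lborel)"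
  proof -
    have "(\<integral>\<^sup>+y. ennreal \<bar>v y\<bar> * indicator (box x (x + h *\<^sub>R One)) y \<partial>lebesgue)
        = (\<integral>\<^sup>+y. ?V y * indicator (box x (x + h *\<^sub>R One)) y \<partial>lborel)" for x
      unfolding nn_integral_completion
      using eq by (intro nn_integral_cong_AE) (auto elim: eventually_mono)
    then show ?thesis by (simp add: nn_integral_completion)
  qed
  also have "\<dots> = (\<integral>\<^sup>+x. (\<integral>\<^sup>+y. ?V y * indicator (box x (x + h *\<^sub>R One)) y \<partial>lborel) \<partial>lborel) / ?hd"
    by (intro nn_integral_divide) measurable
  also have "(\<integral>\<^sup>+x. (\<integral>\<^sup>+y. ?V y * indicator (box x (x + h *\<^sub>R One)) y \<partial>lborel) \<partial>lborel)
      = (\<integral>\<^sup>+y. (\<integral>\<^sup>+x. ?V y * indicator (box x (x + h *\<^sub>R One)) y \<partial>lborel) \<partial>lborel)"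
    by (rule lborel_pair.Fubini'[symmetric]) measurable
  also have "\<dots> = (\<integral>\<^sup>+y. ?V y * ?hd \<partial>lborel)"
  proof (intro nn_integral_cong)
    fix y
    have "(\<integral>\<^sup>+x. ?V y * indicator (box x (x + h *\<^sub>R One)) y \<partial>lborel)
        = ?V y * emeasure lborel (box (y - h *\<^sub>R One) y)"
      unfolding box by (subst nn_integral_cmult_indicator) auto
    also have "emeasure lborel (box (y - h *\<^sub>R One) y) = ?hd"
      using h by (subst emeasure_lborel_box) (auto simp: inner_simps prod_ennreal)
    finally show "(\<integral>\<^sup>+x. ?V y * indicator (box x (x + h *\<^sub>R One)) y \<partial>lborel) = ?V y * ?hd" .
  qed
  also have "\<dots> = (\<integral>\<^sup>+y. ?V y \<partial>lborel) * ?hd"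
    by (rule nn_integral_multc) measurable
  also have "\<dots> / ?hd = (\<integral>\<^sup>+y. ?V y \<partial>lborel)"
    using h by (intro ennreal_mult_divide_eq) auto
  also have "\<dots> = (\<integral>\<^sup>+x. ennreal (norm (v x)) \<partial>lebesgue)"
    unfolding nn_integral_completion using eq by (intro nn_integral_cong_AE) (auto elim: eventually_mono)
  finally show ?thesis .
qed

lemma cube_average_integrable:
  fixes v :: "'a::euclidean_space \<Rightarrow> real"
  assumes "integrable lebesgue v" "h > 0"
  shows "integrable lebesgue (cube_average h v)"
proof (rule integrableI_bounded)
  show "cube_average h v \<in> borel_measurable lebesgue"
    using cube_average_borel[OF assms] by (simp add: measurable_completion)
  have "(\<integral>\<^sup>+x. ennreal (norm (v x)) \<partial>lebesgue) < \<infinity>"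
    using assms(1) by (simp add: integrable_iff_bounded)
  then show "(\<integral>\<^sup>+x. ennreal (norm (cube_average h v x)) \<partial>lebesgue) < \<infinity>"
    using nn_integral_cube_average_le[OF assms] by (rule le_less_trans[rotated])
qed

text \<open>This is Lebesgue's differentiation theorem.\<close>

lemma cube_average_tendsto:
  fixes v :: "'a::euclidean_space \<Rightarrow> real"
  assumes v: "integrable lebesgue v" and h: "\<And>n. h n > 0" "h \<longlonglongrightarrow> 0"
  shows "AE x in lebesgue. (\<lambda>n. cube_average (h n) v x) \<longlonglongrightarrow> v x"
proof -
  have "v absolutely_integrable_on UNIV" using v by (simp add: set_integrable_def)
  then have "v integrable_on cbox c d" for c d
    using absolutely_integrable_on_def integrable_on_subcbox by blast
  then obtain N where N: "negligible N"
     "\<And>x e. \<lbrakk>x \<notin> N; 0 < e\<rbrakk> \<Longrightarrow> \<exists>d>0. \<forall>h. 0 < h \<and> h < d \<longrightarrow>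
         norm (integral (cbox x (x + h *\<^sub>R One)) v /\<^sub>R h ^ DIM('a) - v x) < e"
    by (rule integrable_ccontinuous_explicit[of v]) blast
  have eq: "integral (cbox x (x + h *\<^sub>R One)) v /\<^sub>R h ^ DIM('a) = cube_average h v x" for x h
  proof -
    let ?B = "box x (x + h *\<^sub>R One)"
    have "set_integrable lebesgue ?B v"
      using \<open>v absolutely_integrable_on UNIV\<close> by (rule set_integrable_subset) auto
    then have "integral ?B v = (\<integral>y. v y * indicator ?B y \<partial>lebesgue)"
      by (subst set_lebesgue_integral_eq_integral(2)[symmetric])
        (auto simp: set_lebesgue_integral_def mult.commute)
    then show ?thesis
      by (simp add: cube_average_def integral_open_interval divide_inverse mult.commute)
  qed
  have "(\<lambda>n. cube_average (h n) v x) \<longlonglongrightarrow> v x" if x: "x \<notin> N" for x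
  proof (rule LIMSEQ_I)
    fix e :: real assume "e > 0"
    then obtain d where d: "d > 0" "\<And>h. 0 < h \<Longrightarrow> h < d \<Longrightarrow> norm (cube_average h v x - v x) < e"
      using N(2)[OF x] unfolding eq by blast
    have "\<forall>\<^sub>F n in sequentially. h n < d"
      using order_tendstoD(2)[OF h(2) d(1)] .
    then show "\<exists>n0. \<forall>n\<ge>n0. norm (cube_average (h n) v x - v x) < e"
      using d(2) h(1) unfolding eventually_sequentially by blast
  qed
  moreover have "AE x in lebesgue. x \<notin> N"
    using N(1) by (intro AE_not_in) (simp add: negligible_iff_null_sets)
  ultimately show ?thesis by (auto elim: eventually_mono)
qed

text \<open>Pointwise convergence and the contraction property give convergence in \<open>L1\<close>, by Scheffe's
  lemma.\<close>

lemma cube_average_L1_tendsto: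
  fixes v :: "'a::euclidean_space \<Rightarrow> real"
  assumes v: "integrable lebesgue v" and h: "\<And>n. h n > 0" "h \<longlonglongrightarrow> 0"
  shows "(\<lambda>n. \<integral>x. \<bar>cube_average (h n) v x - v x\<bar> \<partial>lebesgue) \<longlonglongrightarrow> 0"
proof -
  note A = cube_average_integrable[OF v h(1)]
  have "(\<lambda>n. \<integral>\<^sup>+x. norm (cube_average (h n) v x - v x) \<partial>lebesgue) \<longlonglongrightarrow> 0"
    by (rule Scheffe_lemma1[OF A v cube_average_tendsto[OF v h]])
      (intro Limsup_bounded always_eventually allI nn_integral_cube_average_le[OF v h(1)])
  moreover have "(\<integral>\<^sup>+x. norm (cube_average (h n) v x - v x) \<partial>lebesgue)
      = ennreal (\<integral>x. \<bar>cube_average (h n) v x - v x\<bar> \<partial>lebesgue)" for n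
    using A v by (subst nn_integral_eq_integral) auto
  ultimately have "(\<lambda>n. ennreal (\<integral>x. \<bar>cube_average (h n) v x - v x\<bar> \<partial>lebesgue)) \<longlonglongrightarrow> ennreal 0"
    by simp
  then show ?thesis by (subst (asm) tendsto_ennreal_iff) auto
qed

section \<open>The chain rule\<close>

lemma frechet_derivative_bump_translate:
  assumes "c > 0"
  shows "frechet_derivative (bump c x (x + v)) (at y) = frechet_derivative (bump c 0 v) (at (y - x))"
proof -
  have "bump c 0 v differentiable (at (y - x))"
    using C_k_bump[OF assms, of 1 0 v] by simp
  from has_derivative_frechet[OF this]
  have "((bump c 0 v \<circ> (\<lambda>y. y - x)) has_derivative (frechet_derivative (bump c 0 v) (at (y - x)) \<circ> (\<lambda>h. h))) (at y)"
    by (intro diff_chain_at) (auto intro!: derivative_eq_intros)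
  then have "(bump c x (x + v) has_derivative frechet_derivative (bump c 0 v) (at (y - x))) (at y)"
    by (simp add: o_def bump_translate[symmetric])
  then show ?thesis by (rule frechet_derivativeI)
qed

text \<open>For \<open>x\<close> with \<open>cbox x (x + v)\<close> inside \<open>\<Omega>\<close>, the translated kernel is a test function on \<open>\<Omega>\<close>, so that
  the derivative of the mollified \<open>u\<close> is the mollified \<open>g\<close>, and the classical chain rule applies.\<close>

lemma mollified_chain_rule:
  fixes u g \<phi> :: "'a::euclidean_space \<Rightarrow> real"
  assumes u: "integrable lebesgue u" and b: "b \<in> Basis"
    and weak: "\<And>\<psi>. \<psi> \<in> C_c_infinity \<Omega> \<Longrightarrow>
      (\<integral>x. u x * frechet_derivative \<psi> (at x) b \<partial>lebesgue) = - (\<integral>x. g x * \<psi> x \<partial>lebesgue)"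
    and \<phi>: "\<phi> \<in> C_c_infinity \<Omega>" "\<And>x. x \<notin> K \<Longrightarrow> \<phi> x = 0"
    and sub: "\<And>x. x \<in> K \<Longrightarrow> cbox x (x + v) \<subseteq> \<Omega>" and c: "c > 0"
    and f: "\<And>t. (f has_real_derivative f' t) (at t)" "\<And>t. \<bar>f' t\<bar> \<le> M"
  defines "m \<equiv> mollify (bump c 0 v)"
  shows "(\<integral>x. f (m u x) * frechet_derivative \<phi> (at x) b \<partial>lborel)
    = - (\<integral>x. f' (m u x) * m g x * \<phi> x \<partial>lborel)"
proof -
  let ?\<eta> = "bump c 0 v"
  let ?d = "\<lambda>z. frechet_derivative ?\<eta> (at z) b"
  have \<eta>: "?\<eta> \<in> C_c_infinity UNIV" by (rule bump_in_C_c_infinity[OF c]) simp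
  obtain M1 where M1: "\<And>x. \<bar>?d x\<bar> \<le> M1"
    using C_c_infinity_bounded_deriv[OF \<eta> b] by metis
  have cm: "continuous_on UNIV (m u)" unfolding m_def by (rule continuous_mollify_bump[OF u c])
  have "continuous_on UNIV f" using f(1) DERIV_isCont by (metis continuous_at_imp_continuous_on)
  then have cf: "continuous_on UNIV (\<lambda>x. f (m u x))" using cm by (rule continuous_on_compose2) simp
  have der: "((\<lambda>t. f (m u (x + t *\<^sub>R b))) has_real_derivative
      f' (m u (x + t *\<^sub>R b)) * - mollify ?d u (x + t *\<^sub>R b)) (at t)" for x t
    unfolding m_def by (rule DERIV_chain2[OF f(1) mollify_dir_deriv[OF u \<eta> b]])
  have bound: "\<bar>f' (m u x) * - mollify ?d u x\<bar> \<le> M * (M1 * (\<integral>y. \<bar>u y\<bar> \<partial>lebesgue))" for x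
    using f(2)[of "m u x"] abs_mollify_le[OF u C_c_infinity_continuous_deriv[OF \<eta> b] M1, of x]
    unfolding abs_mult abs_minus_cancel by (intro mult_mono) auto
  have eq: "f' (m u x) * - mollify ?d u x * \<phi> x = f' (m u x) * m g x * \<phi> x" for x
  proof (cases "x \<in> K")
    case True
    have "mollify ?d u x = (\<integral>y. u y * frechet_derivative (bump c x (x + v)) (at y) b \<partial>lebesgue)"
      by (simp add: mollify_def frechet_derivative_bump_translate[OF c])
    also have "\<dots> = - (\<integral>y. g y * bump c x (x + v) y \<partial>lebesgue)"
      by (rule weak[OF bump_in_C_c_infinity[OF c sub[OF True]]])
    also have "\<dots> = - m g x" by (simp add: m_def mollify_def bump_translate)
    finally show ?thesis by simp
  qed (simp add: \<phi>(2))
  show ?thesis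
    using integration_by_parts[OF \<phi>(1) b cf der bound] unfolding eq .
qed

lemma derivative_bounded_growth:
  fixes f :: "real \<Rightarrow> real"
  assumes "\<And>t. (f has_real_derivative f' t) (at t)" "\<And>t. \<bar>f' t\<bar> \<le> M"
  shows "\<bar>f s - f t\<bar> \<le> M * \<bar>s - t\<bar>"
  using field_differentiable_bound[of UNIV f f' M s t] assms by auto

lemma C_c_infinity_integrable:
  assumes "\<phi> \<in> C_c_infinity \<Omega>"
  shows "integrable lborel \<phi>" "b \<in> Basis \<Longrightarrow> integrable lborel (\<lambda>x. frechet_derivative \<phi> (at x) b)"
proof -
  obtain K where K: "compact K" "\<And>x. x \<notin> K \<Longrightarrow> \<phi> x = 0"
    "\<And>x b. x \<notin> K \<Longrightarrow> frechet_derivative \<phi> (at x) b = 0"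
    using C_c_infinityE[OF assms] by metis
  show "integrable lborel \<phi>"
    by (rule integrable_compact_support[OF C_c_infinity_continuous[OF assms] K(1,2)])
  show "integrable lborel (\<lambda>x. frechet_derivative \<phi> (at x) b)" if "b \<in> Basis"
    by (rule integrable_compact_support[OF C_c_infinity_continuous_deriv[OF assms that] K(1,3)])
qed

lemma integral_norm_le_integral:
  fixes f g :: "'a \<Rightarrow> real"
  assumes "integrable M f" "integrable M g" "\<And>x. norm (f x) \<le> g x"
  shows "norm (\<integral>x. f x \<partial>M) \<le> (\<integral>x. g x \<partial>M)"
  using integral_norm_bound[of M f] integral_mono[OF integrable_norm[OF assms(1)] assms(2)] assms(3)
  by (meson order_trans)

lemma abs_mollify_bump_le:
  assumes "integrable lebesgue v" "c > 0"
  shows "\<bar>mollify (bump c a b) v x\<bar> \<le> (\<integral>y. \<bar>v y\<bar> \<partial>lebesgue)"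
proof -
  have "\<bar>mollify (bump c a b) v x\<bar> \<le> 1 * (\<integral>y. \<bar>v y\<bar> \<partial>lebesgue)"
  proof (rule abs_mollify_le[OF assms(1)])
    show "continuous_on UNIV (bump c a b)" by (rule C_k_continuous[OF C_k_bump[OF assms(2), of 0]])
    show "\<bar>bump c a b x\<bar> \<le> 1" for x using bump_bounds[OF assms(2), of a b x] by simp
  qed
  then show ?thesis by simp
qed

text \<open>The limit \<open>c \<rightarrow> 0\<close>, by dominated convergence. The factor \<open>1 / h ^ DIM('a)\<close> that turns the
  integrals into means is absorbed into \<open>f\<close>.\<close>

lemma cube_average_chain_rule:
  fixes u g \<phi> :: "'a::euclidean_space \<Rightarrow> real"
  assumes u: "integrable lebesgue u" and g: "integrable lebesgue g" and b: "b \<in> Basis"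
    and weak: "\<And>\<psi>. \<psi> \<in> C_c_infinity \<Omega> \<Longrightarrow>
      (\<integral>x. u x * frechet_derivative \<psi> (at x) b \<partial>lebesgue) = - (\<integral>x. g x * \<psi> x \<partial>lebesgue)"
    and \<phi>: "\<phi> \<in> C_c_infinity \<Omega>" "\<And>x. x \<notin> K \<Longrightarrow> \<phi> x = 0"
    and sub: "\<And>x. x \<in> K \<Longrightarrow> cbox x (x + h *\<^sub>R One) \<subseteq> \<Omega>" and h: "h > 0"
    and f: "\<And>t. (f has_real_derivative f' t) (at t)" "\<And>t. \<bar>f' t\<bar> \<le> M" "continuous_on UNIV f'"
  shows "(\<integral>x. f (cube_average h u x) * frechet_derivative \<phi> (at x) b \<partial>lborel)
    = - (\<integral>x. f' (cube_average h u x) * cube_average h g x * \<phi> x \<partial>lborel)"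
proof -
  define S where "S = h ^ DIM('a)"
  define m where "m v n x = mollify (bump (1 / Suc n) 0 (h *\<^sub>R One)) v x / S" for v :: "'a \<Rightarrow> real" and n x
  have S: "S > 0" using h by (simp add: S_def)
  have M: "M \<ge> 0" using f(2)[of 0] by linarith
  have cf: "continuous_on UNIV f" using f(1) DERIV_isCont by (metis continuous_at_imp_continuous_on)
  have lim: "(\<lambda>n. m v n x) \<longlonglongrightarrow> cube_average h v x" if "integrable lebesgue v" for v x
    unfolding m_def S_def by (rule mollify_bump_tendsto[OF that h])
  have cm: "continuous_on UNIV (m v n)" if "integrable lebesgue v" for v n
    unfolding m_def using S by (intro continuous_intros continuous_mollify_bump that) auto
  have mb: "\<bar>m v n x\<bar> \<le> (\<integral>y. \<bar>v y\<bar> \<partial>lebesgue) / S" if "integrable lebesgue v" for v n x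
    using abs_mollify_bump_le[OF that, of "1 / Suc n" 0 "h *\<^sub>R One" x] S
    by (simp add: m_def abs_divide divide_right_mono)
  have eq: "(\<integral>x. f (m u n x) * frechet_derivative \<phi> (at x) b \<partial>lborel)
      = - (\<integral>x. f' (m u n x) * m g n x * \<phi> x \<partial>lborel)" for n
  proof -
    \<comment> \<open>The chain rule for mollified functions is applied to the rescaled function.\<close>
    have d: "((\<lambda>t. f (t / S)) has_real_derivative f' (t / S) * (1 / S)) (at t)" for t
      using S by (intro DERIV_chain2[OF f(1)] derivative_eq_intros) auto
    have bd: "\<bar>f' (t / S) * (1 / S)\<bar> \<le> M / S" for t
      using f(2)[of "t / S"] S by (simp add: abs_mult divide_right_mono)
    show ?thesis
      using mollified_chain_rule[OF u b weak \<phi> sub _ d bd, of K "1 / Suc n"]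
      by (simp add: m_def)
  qed
  have [measurable]: "m u n \<in> borel_measurable borel" "m g n \<in> borel_measurable borel" for n
    using cm u g by (auto intro: borel_measurable_continuous_onI)
  have [measurable]: "f \<in> borel_measurable borel" "f' \<in> borel_measurable borel"
    using cf f(3) by (auto intro: borel_measurable_continuous_onI)
  have [measurable]: "cube_average h u \<in> borel_measurable borel" "cube_average h g \<in> borel_measurable borel"
    using cube_average_borel u g h by auto
  note [measurable] = C_c_infinity_borel(1)[OF \<phi>(1)] C_c_infinity_borel(2)[OF \<phi>(1) b]
  let ?d = "\<lambda>x. frechet_derivative \<phi> (at x) b"
  let ?I = "\<lambda>v. (\<integral>y. \<bar>v y\<bar> \<partial>lebesgue) / S"
  have "(\<lambda>n. \<integral>x. f (m u n x) * ?d x \<partial>lborel) \<longlonglongrightarrow> (\<integral>x. f (cube_average h u x) * ?d x \<partial>lborel)"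
  proof (rule integral_dominated_convergence[where w="\<lambda>x. (\<bar>f 0\<bar> + M * ?I u) * \<bar>?d x\<bar>"])
    show "AE x in lborel. (\<lambda>n. f (m u n x) * ?d x) \<longlonglongrightarrow> f (cube_average h u x) * ?d x"
      by (intro AE_I2 tendsto_mult tendsto_const continuous_on_tendsto_compose[OF cf] lim u) auto
    show "AE x in lborel. norm (f (m u n x) * ?d x) \<le> (\<bar>f 0\<bar> + M * ?I u) * \<bar>?d x\<bar>" for n
    proof (intro AE_I2)
      fix x
      have "\<bar>f (m u n x) - f 0\<bar> \<le> M * \<bar>m u n x - 0\<bar>" by (rule derivative_bounded_growth[OF f(1,2)])
      also have "\<dots> \<le> M * ?I u" using mb[OF u] M by (intro mult_left_mono) auto
      finally have "\<bar>f (m u n x)\<bar> \<le> \<bar>f 0\<bar> + M * ?I u" by linarith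
      then show "norm (f (m u n x) * ?d x) \<le> (\<bar>f 0\<bar> + M * ?I u) * \<bar>?d x\<bar>"
        by (simp add: abs_mult mult_right_mono del: of_nat_Suc)
    qed
    show "integrable lborel (\<lambda>x. (\<bar>f 0\<bar> + M * ?I u) * \<bar>?d x\<bar>)"
      using C_c_infinity_integrable(2)[OF \<phi>(1) b] by simp
  qed measurable
  moreover have "(\<lambda>n. \<integral>x. f' (m u n x) * m g n x * \<phi> x \<partial>lborel)
      \<longlonglongrightarrow> (\<integral>x. f' (cube_average h u x) * cube_average h g x * \<phi> x \<partial>lborel)"
  proof (rule integral_dominated_convergence[where w="\<lambda>x. (M * ?I g) * \<bar>\<phi> x\<bar>"])
    show "AE x in lborel. (\<lambda>n. f' (m u n x) * m g n x * \<phi> x)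
        \<longlonglongrightarrow> f' (cube_average h u x) * cube_average h g x * \<phi> x"
      by (intro AE_I2 tendsto_mult tendsto_const continuous_on_tendsto_compose[OF f(3)] lim u g) auto
    show "AE x in lborel. norm (f' (m u n x) * m g n x * \<phi> x) \<le> (M * ?I g) * \<bar>\<phi> x\<bar>" for n
    proof (intro AE_I2)
      fix x
      have "\<bar>f' (m u n x)\<bar> * \<bar>m g n x\<bar> \<le> M * ?I g"
        using mb[OF g] M f(2) by (intro mult_mono) auto
      then show "norm (f' (m u n x) * m g n x * \<phi> x) \<le> (M * ?I g) * \<bar>\<phi> x\<bar>"
        unfolding real_norm_def abs_mult by (intro mult_right_mono) auto
    qed
    show "integrable lborel (\<lambda>x. (M * ?I g) * \<bar>\<phi> x\<bar>)"
      using C_c_infinity_integrable(1)[OF \<phi>(1)] by simp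
  qed measurable
  ultimately show ?thesis
    unfolding eq using LIMSEQ_unique tendsto_minus by blast
qed

text \<open>The limit \<open>h \<rightarrow> 0\<close>, with averages over cubes converging in \<open>L1\<close> and almost everywhere. The
  hypothesis \<open>weak\<close> says that \<open>g\<close> is the weak derivative of \<open>u\<close> in the direction \<open>b\<close>; as test functions
  vanish outside \<open>\<Omega>\<close>, the integrals may extend over the whole space.\<close>

lemma weak_chain_rule:
  fixes u g \<phi> :: "'a::euclidean_space \<Rightarrow> real"
  assumes \<Omega>: "open \<Omega>" and u: "integrable lebesgue u" and g: "integrable lebesgue g" and b: "b \<in> Basis"
    and weak: "\<And>\<psi>. \<psi> \<in> C_c_infinity \<Omega> \<Longrightarrow>
      (\<integral>x. u x * frechet_derivative \<psi> (at x) b \<partial>lebesgue) = - (\<integral>x. g x * \<psi> x \<partial>lebesgue)"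
    and \<phi>: "\<phi> \<in> C_c_infinity \<Omega>"
    and f: "\<And>t. (f has_real_derivative f' t) (at t)" "\<And>t. \<bar>f' t\<bar> \<le> M" "continuous_on UNIV f'"
  shows "(\<integral>x. f (u x) * frechet_derivative \<phi> (at x) b \<partial>lebesgue)
    = - (\<integral>x. f' (u x) * g x * \<phi> x \<partial>lebesgue)"
proof -
  let ?d = "\<lambda>x. frechet_derivative \<phi> (at x) b"
  have cf: "continuous_on UNIV f" using f(1) DERIV_isCont by (metis continuous_at_imp_continuous_on)
  have M: "M \<ge> 0" using f(2)[of 0] by linarith
  obtain K where K: "compact K" "K \<subseteq> \<Omega>" "\<And>x. x \<notin> K \<Longrightarrow> \<phi> x = 0"
    using C_c_infinityE[OF \<phi>] by metis
  obtain e where e: "e > 0" "(\<Union>x\<in>K. cball x e) \<subseteq> \<Omega>"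
    using compact_subset_open_imp_cball_epsilon_subset[OF K(1) \<Omega> K(2)] .
  \<comment> \<open>This side length keeps the cubes with a corner in K within distance e of that corner.\<close>
  define h where "h n = e / (DIM('a) * real (Suc n))" for n
  have h: "h n > 0" for n using e(1) by (simp add: h_def)
  have h0: "h \<longlonglongrightarrow> 0"
  proof -
    have "(\<lambda>n. e / DIM('a) * inverse (real (Suc n))) \<longlonglongrightarrow> e / DIM('a) * 0"
      by (intro tendsto_mult tendsto_const LIMSEQ_inverse_real_of_nat)
    then show ?thesis by (simp add: h_def[abs_def] divide_inverse mult.assoc)
  qed
  have sub: "cbox x (x + h n *\<^sub>R One) \<subseteq> \<Omega>" if x: "x \<in> K" for x n
  proof
    fix y assume y: "y \<in> cbox x (x + h n *\<^sub>R One)"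
    have "norm (y - x) \<le> (\<Sum>i\<in>Basis. \<bar>(y - x) \<bullet> i\<bar>)" by (rule norm_le_l1)
    also have "\<dots> \<le> (\<Sum>i\<in>(Basis::'a set). h n)"
      using y by (intro sum_mono) (auto simp: mem_box inner_simps)
    also have "\<dots> = e / real (Suc n)" by (simp add: h_def)
    also have "\<dots> \<le> e" using e(1) by (simp add: field_simps)
    finally have "y \<in> cball x e" by (simp add: dist_norm norm_minus_commute)
    then show "y \<in> \<Omega>" using e(2) x by blast
  qed
  define A where "A v n = cube_average (h n) v" for v :: "'a \<Rightarrow> real" and n
  have Ai: "integrable lebesgue (A v n)" if "integrable lebesgue v" for v n
    unfolding A_def by (rule cube_average_integrable[OF that h])
  have Ab: "A v n \<in> borel_measurable borel" if "integrable lebesgue v" for v n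
    unfolding A_def by (rule cube_average_borel[OF that h])
  have AL: "(\<lambda>n. \<integral>x. \<bar>A v n x - v x\<bar> \<partial>lebesgue) \<longlonglongrightarrow> 0" if "integrable lebesgue v" for v
    unfolding A_def by (rule cube_average_L1_tendsto[OF that h h0])
  have AE: "AE x in lebesgue. (\<lambda>n. A u n x) \<longlonglongrightarrow> u x"
    unfolding A_def by (rule cube_average_tendsto[OF u h h0])
  have [measurable]: "u \<in> borel_measurable lebesgue" "g \<in> borel_measurable lebesgue"
    "A u n \<in> borel_measurable lebesgue" "A g n \<in> borel_measurable lebesgue" for n
    using u g Ai by auto
  have [measurable]: "f \<in> borel_measurable borel" "f' \<in> borel_measurable borel"
    using cf f(3) by (auto intro: borel_measurable_continuous_onI)
  have [measurable]: "\<phi> \<in> borel_measurable lebesgue" "?d \<in> borel_measurable lebesgue"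
    using C_c_infinity_continuous[OF \<phi>] C_c_infinity_continuous_deriv[OF \<phi> b]
    by (auto intro: continuous_borel_measurable_lebesgue)
  have di: "integrable lebesgue ?d" "integrable lebesgue \<phi>"
    using C_c_infinity_integrable[OF \<phi>] b C_c_infinity_borel[OF \<phi>] by (auto simp: integrable_completion)
  obtain M0 where M0: "M0 > 0" "\<And>x. \<bar>\<phi> x\<bar> \<le> M0" using C_c_infinity_bounded[OF \<phi>] by metis
  obtain M1 where M1: "M1 > 0" "\<And>x. \<bar>?d x\<bar> \<le> M1" using C_c_infinity_bounded_deriv[OF \<phi> b] by metis
  have eq: "(\<integral>x. f (A u n x) * ?d x \<partial>lebesgue) = - (\<integral>x. f' (A u n x) * A g n x * \<phi> x \<partial>lebesgue)" for n
  proof -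
    note [measurable] = Ab[OF u] Ab[OF g] C_c_infinity_borel(1)[OF \<phi>] C_c_infinity_borel(2)[OF \<phi> b]
    show ?thesis
      using cube_average_chain_rule[OF u g b weak \<phi> K(3) sub h f, of K n]
      by (simp add: integral_lebesgue_eq_lborel A_def[symmetric])
  qed
  have fi: "integrable lebesgue (\<lambda>x. f (v x) * ?d x)" if v: "integrable lebesgue v" for v
  proof -
    have [measurable]: "v \<in> borel_measurable lebesgue" using v by simp
    have i: "integrable lebesgue (\<lambda>x. f (v x) - f 0)"
    proof (rule Bochner_Integration.integrable_bound[of _ "\<lambda>x. M * v x"])
      show "AE x in lebesgue. norm (f (v x) - f 0) \<le> norm (M * v x)"
        using derivative_bounded_growth[OF f(1,2), of _ 0] M by (auto simp: abs_mult)
    qed (use v in auto)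
    have "integrable lebesgue (\<lambda>x. (f (v x) - f 0) * ?d x + f 0 * ?d x)"
      by (intro Bochner_Integration.integrable_add integrable_mult_bounded[OF i _ M1(2)] integrable_mult_right di) auto
    then show ?thesis by (simp add: algebra_simps)
  qed
  have "(\<lambda>n. \<integral>x. f (A u n x) * ?d x \<partial>lebesgue) \<longlonglongrightarrow> (\<integral>x. f (u x) * ?d x \<partial>lebesgue)"
  proof (rule LIM_zero_cancel, rule Lim_null_comparison)
    show "(\<lambda>n. M * M1 * (\<integral>x. \<bar>A u n x - u x\<bar> \<partial>lebesgue)) \<longlonglongrightarrow> 0"
      using tendsto_mult_right_zero[OF AL[OF u]] .
    show "\<forall>\<^sub>F n in sequentially. norm ((\<integral>x. f (A u n x) * ?d x \<partial>lebesgue) - (\<integral>x. f (u x) * ?d x \<partial>lebesgue))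
        \<le> M * M1 * (\<integral>x. \<bar>A u n x - u x\<bar> \<partial>lebesgue)"
    proof (intro always_eventually allI)
      fix n
      have "(\<integral>x. f (A u n x) * ?d x \<partial>lebesgue) - (\<integral>x. f (u x) * ?d x \<partial>lebesgue)
          = (\<integral>x. f (A u n x) * ?d x - f (u x) * ?d x \<partial>lebesgue)"
        by (intro Bochner_Integration.integral_diff[symmetric] fi Ai u)
      also have "norm \<dots> \<le> (\<integral>x. M * M1 * \<bar>A u n x - u x\<bar> \<partial>lebesgue)"
      proof (rule integral_norm_le_integral)
        show "norm (f (A u n x) * ?d x - f (u x) * ?d x) \<le> M * M1 * \<bar>A u n x - u x\<bar>" for x
        proof -
          have "\<bar>f (A u n x) - f (u x)\<bar> * \<bar>?d x\<bar> \<le> (M * \<bar>A u n x - u x\<bar>) * M1"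
            using derivative_bounded_growth[OF f(1,2)] M1 M by (intro mult_mono) auto
          then show ?thesis by (simp add: left_diff_distrib[symmetric] abs_mult mult_ac)
        qed
      qed (use u Ai fi in auto)
      finally show "norm ((\<integral>x. f (A u n x) * ?d x \<partial>lebesgue) - (\<integral>x. f (u x) * ?d x \<partial>lebesgue))
        \<le> M * M1 * (\<integral>x. \<bar>A u n x - u x\<bar> \<partial>lebesgue)" by simp
    qed
  qed
  moreover have "(\<lambda>n. \<integral>x. f' (A u n x) * A g n x * \<phi> x \<partial>lebesgue) \<longlonglongrightarrow> (\<integral>x. f' (u x) * g x * \<phi> x \<partial>lebesgue)"
  proof -
    \<comment> \<open>The averages of g converge in L1, the other factor only almost everywhere but boundedly.\<close>
    have i1: "integrable lebesgue (\<lambda>x. (A g n x - g x) * (f' (A u n x) * \<phi> x))" for n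
    proof (rule integrable_mult_bounded[of _ _ _ "M * M0"])
      show "\<bar>f' (A u n x) * \<phi> x\<bar> \<le> M * M0" for x
        using f(2) M0 M unfolding abs_mult by (intro mult_mono) auto
    qed (use Ai g in auto)
    have i2: "integrable lebesgue (\<lambda>x. g x * (f' (A u n x) * \<phi> x))" for n
    proof (rule integrable_mult_bounded[of _ _ _ "M * M0"])
      show "\<bar>f' (A u n x) * \<phi> x\<bar> \<le> M * M0" for x
        using f(2) M0 M unfolding abs_mult by (intro mult_mono) auto
    qed (use g in auto)
    have "(\<lambda>n. \<integral>x. (A g n x - g x) * (f' (A u n x) * \<phi> x) \<partial>lebesgue) \<longlonglongrightarrow> 0"
    proof (rule Lim_null_comparison)
      show "(\<lambda>n. M * M0 * (\<integral>x. \<bar>A g n x - g x\<bar> \<partial>lebesgue)) \<longlonglongrightarrow> 0"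
        using tendsto_mult_right_zero[OF AL[OF g]] .
      show "\<forall>\<^sub>F n in sequentially. norm (\<integral>x. (A g n x - g x) * (f' (A u n x) * \<phi> x) \<partial>lebesgue)
        \<le> M * M0 * (\<integral>x. \<bar>A g n x - g x\<bar> \<partial>lebesgue)"
      proof (intro always_eventually allI)
        fix n
        have "norm (\<integral>x. (A g n x - g x) * (f' (A u n x) * \<phi> x) \<partial>lebesgue)
            \<le> (\<integral>x. M * M0 * \<bar>A g n x - g x\<bar> \<partial>lebesgue)"
        proof (rule integral_norm_le_integral[OF i1])
          show "norm ((A g n x - g x) * (f' (A u n x) * \<phi> x)) \<le> M * M0 * \<bar>A g n x - g x\<bar>" for x
          proof -
            have "\<bar>f' (A u n x)\<bar> * \<bar>\<phi> x\<bar> \<le> M * M0"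
              using f(2) M0 M by (intro mult_mono) auto
            from mult_right_mono[OF this, of "\<bar>A g n x - g x\<bar>"]
            show ?thesis by (simp add: abs_mult mult_ac)
          qed
        qed (use g Ai in auto)
        then show "norm (\<integral>x. (A g n x - g x) * (f' (A u n x) * \<phi> x) \<partial>lebesgue)
            \<le> M * M0 * (\<integral>x. \<bar>A g n x - g x\<bar> \<partial>lebesgue)" by simp
      qed
    qed
    moreover have "(\<lambda>n. \<integral>x. g x * (f' (A u n x) * \<phi> x) \<partial>lebesgue) \<longlonglongrightarrow> (\<integral>x. g x * (f' (u x) * \<phi> x) \<partial>lebesgue)"
    proof (rule integral_dominated_convergence[where w="\<lambda>x. M * M0 * \<bar>g x\<bar>"])
      show "AE x in lebesgue. (\<lambda>n. g x * (f' (A u n x) * \<phi> x)) \<longlonglongrightarrow> g x * (f' (u x) * \<phi> x)"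
        using AE
      proof eventually_elim
        case (elim x)
        then show ?case
          by (intro tendsto_mult tendsto_const continuous_on_tendsto_compose[OF f(3)]) auto
      qed
      show "AE x in lebesgue. norm (g x * (f' (A u n x) * \<phi> x)) \<le> M * M0 * \<bar>g x\<bar>" for n
      proof (intro AE_I2)
        fix x
        have "\<bar>f' (A u n x)\<bar> * \<bar>\<phi> x\<bar> \<le> M * M0"
          using f(2) M0 M by (intro mult_mono) auto
        from mult_right_mono[OF this, of "\<bar>g x\<bar>"]
        show "norm (g x * (f' (A u n x) * \<phi> x)) \<le> M * M0 * \<bar>g x\<bar>"
          by (simp add: abs_mult mult_ac)
      qed
    qed (use g in auto)
    ultimately have "(\<lambda>n. (\<integral>x. (A g n x - g x) * (f' (A u n x) * \<phi> x) \<partial>lebesgue)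
        + (\<integral>x. g x * (f' (A u n x) * \<phi> x) \<partial>lebesgue)) \<longlonglongrightarrow> 0 + (\<integral>x. g x * (f' (u x) * \<phi> x) \<partial>lebesgue)"
      by (rule tendsto_add)
    moreover have "(\<integral>x. (A g n x - g x) * (f' (A u n x) * \<phi> x) \<partial>lebesgue)
        + (\<integral>x. g x * (f' (A u n x) * \<phi> x) \<partial>lebesgue) = (\<integral>x. f' (A u n x) * A g n x * \<phi> x \<partial>lebesgue)" for n
      by (subst Bochner_Integration.integral_add[OF i1 i2, symmetric]) (simp add: algebra_simps)
    ultimately show ?thesis by (simp add: mult_ac)
  qed
  ultimately show ?thesis
    unfolding eq using LIMSEQ_unique tendsto_minus by blast
qed

section \<open>The weak gradient of the positive part\<close>

text \<open>A continuously differentiable approximation of the positive part that vanishes on the negative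
  half-line. With it, the derivative converges to 0 also at 0, so that the limit of the chain rule
  holds with the indicator of the set where \<open>u\<close> is positive.\<close>

definition smooth_pos :: "real \<Rightarrow> real \<Rightarrow> real" where
  "smooth_pos d t = sqrt ((max 0 t)\<^sup>2 + d\<^sup>2) - d"

lemma DERIV_max_0_square: "((\<lambda>t. (max 0 t)\<^sup>2) has_real_derivative 2 * max 0 t) (at t)" for t :: real
proof -
  consider "t > 0" | "t < 0" | "t = 0" by linarith
  then show ?thesis
  proof cases
    case 1
    have "((\<lambda>t. t\<^sup>2) has_real_derivative 2 * max 0 t) (at t)"
      using 1 by (auto intro!: derivative_eq_intros)
    then show ?thesis
      by (rule has_field_derivative_transform_within_open[of _ _ _ "{0<..}"]) (use 1 in auto)
  next
    case 2
    have "((\<lambda>t. 0) has_real_derivative 2 * max 0 t) (at t)"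
      using 2 by (auto intro!: derivative_eq_intros)
    then show ?thesis
      by (rule has_field_derivative_transform_within_open[of _ _ _ "{..<0}"]) (use 2 in auto)
  next
    case 3
    have "((\<lambda>h. (max 0 h)\<^sup>2 / h) \<longlongrightarrow> 0) (at (0::real))"
    proof (rule Lim_null_comparison)
      show "((\<lambda>h. \<bar>h\<bar>) \<longlongrightarrow> 0) (at (0::real))" by (auto intro!: tendsto_eq_intros)
      show "\<forall>\<^sub>F h in at (0::real). norm ((max 0 h)\<^sup>2 / h) \<le> \<bar>h\<bar>"
        by (intro always_eventually allI) (auto simp: max_def power2_eq_square)
    qed
    then show ?thesis unfolding 3 by (subst DERIV_def) simp
  qed
qed

lemma smooth_pos_deriv:
  assumes "d > 0"
  shows "(smooth_pos d has_real_derivative max 0 t / sqrt ((max 0 t)\<^sup>2 + d\<^sup>2)) (at t)"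
proof -
  have pos: "(max 0 t)\<^sup>2 + d\<^sup>2 > 0" using assms by (simp add: add_nonneg_pos)
  have "((\<lambda>t. sqrt ((max 0 t)\<^sup>2 + d\<^sup>2) - d) has_real_derivative
      (2 * max 0 t + 0) * (inverse (sqrt ((max 0 t)\<^sup>2 + d\<^sup>2)) / 2) - 0) (at t)"
    using DERIV_chain2[OF DERIV_real_sqrt[OF pos] DERIV_add[OF DERIV_max_0_square DERIV_const]]
    by (intro DERIV_diff DERIV_const) (simp add: mult.commute)
  moreover have "(2 * max 0 t + 0) * (inverse (sqrt ((max 0 t)\<^sup>2 + d\<^sup>2)) / 2) - 0
      = max 0 t / sqrt ((max 0 t)\<^sup>2 + d\<^sup>2)"
    by (simp only: divide_inverse add_0_right diff_zero) simp
  ultimately show ?thesis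
    unfolding smooth_pos_def[abs_def] by (simp only:)
qed

lemma smooth_pos_deriv_bound:
  assumes "d > 0"
  shows "\<bar>max 0 t / sqrt ((max 0 t)\<^sup>2 + d\<^sup>2)\<bar> \<le> 1"
proof -
  have pos: "(max 0 t)\<^sup>2 + d\<^sup>2 > 0" using assms by (simp add: add_nonneg_pos)
  have "max 0 t \<le> sqrt ((max 0 t)\<^sup>2 + d\<^sup>2)" by (rule real_le_rsqrt) simp
  then show ?thesis using pos by (simp add: abs_divide divide_le_eq)
qed

lemma abs_smooth_pos_le:
  assumes "d > 0"
  shows "\<bar>smooth_pos d t\<bar> \<le> \<bar>t\<bar>"
proof -
  have "\<bar>smooth_pos d t - smooth_pos d 0\<bar> \<le> 1 * \<bar>t - 0\<bar>"
    by (rule derivative_bounded_growth[OF smooth_pos_deriv[OF assms] smooth_pos_deriv_bound[OF assms]])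
  moreover have "smooth_pos d 0 = 0" using assms by (simp add: smooth_pos_def)
  ultimately show ?thesis by simp
qed

lemma smooth_pos_tendsto:
  shows "(\<lambda>n. smooth_pos (1 / Suc n) t) \<longlonglongrightarrow> max 0 t"
    and "(\<lambda>n. max 0 t / sqrt ((max 0 t)\<^sup>2 + (1 / Suc n)\<^sup>2)) \<longlonglongrightarrow> (if t > 0 then 1 else 0)"
proof -
  have d: "(\<lambda>n. 1 / real (Suc n)) \<longlonglongrightarrow> 0"
    using LIMSEQ_inverse_real_of_nat by (simp add: divide_inverse)
  have s: "(\<lambda>n. sqrt ((max 0 t)\<^sup>2 + (1 / real (Suc n))\<^sup>2)) \<longlonglongrightarrow> sqrt ((max 0 t)\<^sup>2 + 0\<^sup>2)"
    by (intro tendsto_intros d)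
  from tendsto_diff[OF this d] show "(\<lambda>n. smooth_pos (1 / Suc n) t) \<longlonglongrightarrow> max 0 t"
    by (simp add: smooth_pos_def)
  show "(\<lambda>n. max 0 t / sqrt ((max 0 t)\<^sup>2 + (1 / Suc n)\<^sup>2)) \<longlonglongrightarrow> (if t > 0 then 1 else 0)"
  proof (cases "t > 0")
    case True
    have "(\<lambda>n. max 0 t / sqrt ((max 0 t)\<^sup>2 + (1 / Suc n)\<^sup>2)) \<longlonglongrightarrow> max 0 t / sqrt ((max 0 t)\<^sup>2 + 0\<^sup>2)"
      by (intro tendsto_divide tendsto_const s) (use True in simp)
    then show ?thesis using True by simp
  next
    case False
    then have "max 0 t = 0" by simp
    then show ?thesis using False by simp
  qed
qed

lemma weak_derivative_pos_part:
  fixes u g \<phi> :: "'a::euclidean_space \<Rightarrow> real"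
  assumes \<Omega>: "open \<Omega>" and u: "integrable lebesgue u" and g: "integrable lebesgue g" and b: "b \<in> Basis"
    and weak: "\<And>\<psi>. \<psi> \<in> C_c_infinity \<Omega> \<Longrightarrow>
      (\<integral>x. u x * frechet_derivative \<psi> (at x) b \<partial>lebesgue) = - (\<integral>x. g x * \<psi> x \<partial>lebesgue)"
    and \<phi>: "\<phi> \<in> C_c_infinity \<Omega>"
  shows "(\<integral>x. max 0 (u x) * frechet_derivative \<phi> (at x) b \<partial>lebesgue)
    = - (\<integral>x. (if u x > 0 then g x else 0) * \<phi> x \<partial>lebesgue)"
proof -
  let ?d = "\<lambda>x. frechet_derivative \<phi> (at x) b"
  define f where "f n = smooth_pos (1 / Suc n)" for n
  define f' where "f' n t = max 0 t / sqrt ((max 0 t)\<^sup>2 + (1 / Suc n)\<^sup>2)" for n and t :: real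
  have der: "(f n has_real_derivative f' n t) (at t)" for n t
    unfolding f_def f'_def by (rule smooth_pos_deriv) simp
  have bd: "\<bar>f' n t\<bar> \<le> 1" for n t
    unfolding f'_def by (rule smooth_pos_deriv_bound) simp
  have c: "continuous_on UNIV (f' n)" for n
  proof -
    have "(max 0 t)\<^sup>2 + (1 / real (Suc n))\<^sup>2 > 0" for t :: real
      by (intro add_nonneg_pos) auto
    then have "sqrt ((max 0 t)\<^sup>2 + (1 / real (Suc n))\<^sup>2) \<noteq> 0" for t :: real
      by (metis less_irrefl real_sqrt_eq_zero_cancel_iff)
    then show ?thesis unfolding f'_def by (intro continuous_intros) blast
  qed
  have cf: "continuous_on UNIV (f n)" for n
    using der DERIV_isCont by (metis continuous_at_imp_continuous_on)
  have [measurable]: "f n \<in> borel_measurable borel" "f' n \<in> borel_measurable borel" for n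
    using c cf by (auto intro: borel_measurable_continuous_onI)
  have [measurable]: "u \<in> borel_measurable lebesgue" "g \<in> borel_measurable lebesgue"
    using u g by auto
  have [measurable]: "\<phi> \<in> borel_measurable lebesgue" "?d \<in> borel_measurable lebesgue"
    using C_c_infinity_continuous[OF \<phi>] C_c_infinity_continuous_deriv[OF \<phi> b]
    by (auto intro: continuous_borel_measurable_lebesgue)
  obtain M0 where M0: "M0 > 0" "\<And>x. \<bar>\<phi> x\<bar> \<le> M0" using C_c_infinity_bounded[OF \<phi>] by metis
  obtain M1 where M1: "M1 > 0" "\<And>x. \<bar>?d x\<bar> \<le> M1" using C_c_infinity_bounded_deriv[OF \<phi> b] by metis
  have lim: "(\<lambda>n. \<integral>x. f n (u x) * ?d x \<partial>lebesgue) \<longlonglongrightarrow> (\<integral>x. max 0 (u x) * ?d x \<partial>lebesgue)"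
  proof (rule integral_dominated_convergence[where w="\<lambda>x. M1 * \<bar>u x\<bar>"])
    show "AE x in lebesgue. (\<lambda>n. f n (u x) * ?d x) \<longlonglongrightarrow> max 0 (u x) * ?d x"
      unfolding f_def by (intro AE_I2 tendsto_mult tendsto_const smooth_pos_tendsto)
    show "AE x in lebesgue. norm (f n (u x) * ?d x) \<le> M1 * \<bar>u x\<bar>" for n
    proof (intro AE_I2)
      fix x
      have "\<bar>f n (u x)\<bar> * \<bar>?d x\<bar> \<le> \<bar>u x\<bar> * M1"
        unfolding f_def by (intro mult_mono abs_smooth_pos_le M1) auto
      then show "norm (f n (u x) * ?d x) \<le> M1 * \<bar>u x\<bar>" by (simp add: abs_mult mult.commute)
    qed
  qed (use u in auto)
  have "(\<lambda>n. \<integral>x. f' n (u x) * g x * \<phi> x \<partial>lebesgue)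
      \<longlonglongrightarrow> (\<integral>x. (if u x > 0 then 1 else 0) * g x * \<phi> x \<partial>lebesgue)"
  proof (rule integral_dominated_convergence[where w="\<lambda>x. M0 * \<bar>g x\<bar>"])
    show "AE x in lebesgue. (\<lambda>n. f' n (u x) * g x * \<phi> x) \<longlonglongrightarrow> (if u x > 0 then 1 else 0) * g x * \<phi> x"
      unfolding f'_def by (intro AE_I2 tendsto_mult tendsto_const smooth_pos_tendsto)
    show "AE x in lebesgue. norm (f' n (u x) * g x * \<phi> x) \<le> M0 * \<bar>g x\<bar>" for n
    proof (intro AE_I2)
      fix x
      have "\<bar>f' n (u x)\<bar> * \<bar>\<phi> x\<bar> \<le> 1 * M0"
        by (intro mult_mono bd M0) auto
      from mult_right_mono[OF this, of "\<bar>g x\<bar>"]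
      show "norm (f' n (u x) * g x * \<phi> x) \<le> M0 * \<bar>g x\<bar>" by (simp add: abs_mult mult_ac)
    qed
  qed (use g in auto)
  note lim' = tendsto_minus[OF this]
  have eq: "(\<integral>x. f n (u x) * ?d x \<partial>lebesgue) = - (\<integral>x. f' n (u x) * g x * \<phi> x \<partial>lebesgue)" for n
    by (rule weak_chain_rule[OF \<Omega> u g b weak \<phi> der bd c])
  have "(\<integral>x. max 0 (u x) * ?d x \<partial>lebesgue)
      = - (\<integral>x. (if u x > 0 then 1 else 0) * g x * \<phi> x \<partial>lebesgue)"
    by (rule LIMSEQ_unique[OF lim[unfolded eq] lim'])
  also have "(\<lambda>x. (if u x > 0 then 1 else 0) * g x * \<phi> x) = (\<lambda>x. (if u x > 0 then g x else 0) * \<phi> x)"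
    by auto
  finally show ?thesis .
qed

lemma integrable_L1_loc:
  assumes "open \<Omega>" "integrable (lebesgue_on \<Omega>) f"
  shows "f \<in> L1_loc \<Omega>"
proof -
  have "set_integrable lebesgue \<Omega> f"
    using assms by (simp add: integrable_lebesgue_on set_integrable_def)
  then have "f absolutely_integrable_on K" if "compact K" "K \<subseteq> \<Omega>" for K
    using that fmeasurableD[OF lmeasurable_compact] by (blast intro: set_integrable_subset)
  then show ?thesis by (simp add: L1_loc_def)
qed

lemma is_weak_gradient_pos_part:
  assumes \<Omega>: "open \<Omega>" and int: "integrable (lebesgue_on \<Omega>) u" "integrable (lebesgue_on \<Omega>) g"
    and weak: "is_weak_gradient \<Omega> u g"
  shows "is_weak_gradient \<Omega> (\<lambda>x. max 0 (u x)) (\<lambda>x. if u x > 0 then g x else 0)"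
  unfolding is_weak_gradient_def
proof (intro conjI ballI)
  have [measurable]: "u \<in> borel_measurable (lebesgue_on \<Omega>)" "g \<in> borel_measurable (lebesgue_on \<Omega>)"
    using int by auto
  show "(\<lambda>x. max 0 (u x)) \<in> L1_loc \<Omega>"
    by (rule integrable_L1_loc[OF \<Omega> Bochner_Integration.integrable_bound[OF int(1)]]) auto
  show "(\<lambda>x. if u x > 0 then g x else 0) \<in> L1_loc \<Omega>"
    by (rule integrable_L1_loc[OF \<Omega> Bochner_Integration.integrable_bound[OF int(2)]]) auto
  fix \<phi> and b :: 'a assume \<phi>: "\<phi> \<in> C_c_infinity \<Omega>" and b: "b \<in> Basis"
  let ?u = "\<lambda>x. indicator \<Omega> x * u x" and ?g = "\<lambda>x. indicator \<Omega> x * (g x \<bullet> b)"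
  have i: "integrable lebesgue ?u" "integrable lebesgue ?g"
    using int(1) integrable_inner_left[OF int(2), of b] \<Omega> by (auto simp: integrable_lebesgue_on)
  have w: "(\<integral>x. ?u x * frechet_derivative \<psi> (at x) b \<partial>lebesgue) = - (\<integral>x. ?g x * \<psi> x \<partial>lebesgue)"
    if "\<psi> \<in> C_c_infinity \<Omega>" for \<psi>
    using weak that b by (simp add: is_weak_gradient_def integral_lebesgue_on[OF \<Omega>] mult.assoc)
  have "(\<integral>x. max 0 (u x) * frechet_derivative \<phi> (at x) b \<partial>lebesgue_on \<Omega>)
      = (\<integral>x. max 0 (?u x) * frechet_derivative \<phi> (at x) b \<partial>lebesgue)"
    unfolding integral_lebesgue_on[OF \<Omega>]
    by (rule Bochner_Integration.integral_cong) (auto simp: indicator_def)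
  also have "\<dots> = - (\<integral>x. (if ?u x > 0 then ?g x else 0) * \<phi> x \<partial>lebesgue)"
    by (rule weak_derivative_pos_part[OF \<Omega> i b w \<phi>])
  also have "(\<integral>x. (if ?u x > 0 then ?g x else 0) * \<phi> x \<partial>lebesgue)
      = (\<integral>x. ((if u x > 0 then g x else 0) \<bullet> b) * \<phi> x \<partial>lebesgue_on \<Omega>)"
    unfolding integral_lebesgue_on[OF \<Omega>]
    by (rule Bochner_Integration.integral_cong) (auto simp: indicator_def)
  finally show "(\<integral>x. max 0 (u x) * frechet_derivative \<phi> (at x) b \<partial>lebesgue_on \<Omega>)
      = - (\<integral>x. ((if u x > 0 then g x else 0) \<bullet> b) * \<phi> x \<partial>lebesgue_on \<Omega>)" .
qed

lemma is_weak_gradient_diff: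
  assumes \<Omega>: "open \<Omega>" and u: "is_weak_gradient \<Omega> u g" and v: "is_weak_gradient \<Omega> v h"
  shows "is_weak_gradient \<Omega> (\<lambda>x. u x - v x) (\<lambda>x. g x - h x)"
  unfolding is_weak_gradient_def
proof (intro conjI ballI)
  have L: "u \<in> L1_loc \<Omega>" "v \<in> L1_loc \<Omega>" "g \<in> L1_loc \<Omega>" "h \<in> L1_loc \<Omega>"
    using u v unfolding is_weak_gradient_def by blast+
  then show "(\<lambda>x. u x - v x) \<in> L1_loc \<Omega>" "(\<lambda>x. g x - h x) \<in> L1_loc \<Omega>"
    by (auto intro: L1_loc_diff)
  fix \<phi> and b :: 'a assume \<phi>: "\<phi> \<in> C_c_infinity \<Omega>" and b: "b \<in> Basis"
  let ?d = "\<lambda>x. frechet_derivative \<phi> (at x) b"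
  have "(\<integral>x. (u x - v x) * ?d x \<partial>lebesgue_on \<Omega>)
      = (\<integral>x. u x * ?d x \<partial>lebesgue_on \<Omega>) - (\<integral>x. v x * ?d x \<partial>lebesgue_on \<Omega>)"
    unfolding left_diff_distrib
    by (intro Bochner_Integration.integral_diff L1_loc_integrable_mult_test \<Omega> L \<phi> b)
  also have "\<dots> = - ((\<integral>x. (g x \<bullet> b) * \<phi> x \<partial>lebesgue_on \<Omega>) - (\<integral>x. (h x \<bullet> b) * \<phi> x \<partial>lebesgue_on \<Omega>))"
    using u v \<phi> b by (simp add: is_weak_gradient_def)
  also have "\<dots> = - (\<integral>x. ((g x - h x) \<bullet> b) * \<phi> x \<partial>lebesgue_on \<Omega>)"
    unfolding inner_diff_left left_diff_distrib
    by (subst Bochner_Integration.integral_diff) (intro L1_loc_integrable_mult_test L1_loc_inner \<Omega> L \<phi> refl)+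
  finally show "(\<integral>x. (u x - v x) * ?d x \<partial>lebesgue_on \<Omega>)
      = - (\<integral>x. ((g x - h x) \<bullet> b) * \<phi> x \<partial>lebesgue_on \<Omega>)" .
qed

section \<open>The spaces \<open>Lp\<close> and \<open>W1p\<close>\<close>

lemma powr_norm_diff_le:
  fixes a b :: "'b::real_normed_vector"
  assumes "p > 0"
  shows "norm (a - b) powr p \<le> 2 powr p * (norm a powr p + norm b powr p)"
proof -
  let ?m = "max (norm a) (norm b)"
  have "norm (a - b) \<le> 2 * ?m" using norm_triangle_ineq4[of a b] by linarith
  then have "norm (a - b) powr p \<le> (2 * ?m) powr p"
    using assms by (intro powr_mono2) auto
  also have "\<dots> = 2 powr p * ?m powr p" by (rule powr_mult)
  also have "\<dots> \<le> 2 powr p * (norm a powr p + norm b powr p)"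
    by (intro mult_left_mono) (auto simp: max_def)
  finally show ?thesis .
qed

text \<open>A bounded open set and an exponent greater than 1.\<close>

locale sobolev_domain =
  fixes \<Omega> :: "'a::euclidean_space set" and p :: real
  assumes open_domain: "open \<Omega>" and bounded_domain: "bounded \<Omega>" and p_gt_1: "1 < p"
begin

lemma p_pos: "p > 0" "p \<noteq> 0" using p_gt_1 by auto

lemma finite_measure_domain: "finite_measure (lebesgue_on \<Omega>)"
  by (rule finite_measure_lebesgue_on[OF lmeasurable_open[OF bounded_domain open_domain]])

lemma Lp_measurable: "f \<in> Lp \<Omega> p \<Longrightarrow> f \<in> borel_measurable (lebesgue_on \<Omega>)"
  by (simp add: Lp_def)

lemma Lp_powr_integrable: "f \<in> Lp \<Omega> p \<Longrightarrow> integrable (lebesgue_on \<Omega>) (\<lambda>x. norm (f x) powr p)"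
  by (simp add: Lp_def)

lemma Lp_integrable:
  assumes "f \<in> Lp \<Omega> p"
  shows "integrable (lebesgue_on \<Omega>) f"
proof (rule Bochner_Integration.integrable_bound)
  show "integrable (lebesgue_on \<Omega>) (\<lambda>x. 1 + norm (f x) powr p)"
    using Lp_powr_integrable[OF assms] finite_measure.integrable_const[OF finite_measure_domain]
    by (intro Bochner_Integration.integrable_add)
  have "norm (f x) \<le> 1 + norm (f x) powr p" for x
  proof (cases "norm (f x) \<le> 1")
    case False
    then have "norm (f x) powr 1 \<le> norm (f x) powr p" using p_gt_1 by (intro powr_mono) auto
    then show ?thesis using False by simp
  qed (use powr_ge_zero[of "norm (f x)" p] in linarith)
  then show "AE x in lebesgue_on \<Omega>. norm (f x) \<le> norm (1 + norm (f x) powr p)"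
    by (auto intro: order_trans)
qed (rule Lp_measurable[OF assms])

lemma Lp_mono:
  assumes "g \<in> Lp \<Omega> p" "f \<in> borel_measurable (lebesgue_on \<Omega>)"
    "AE x in lebesgue_on \<Omega>. norm (f x) \<le> norm (g x)"
  shows "f \<in> Lp \<Omega> p"
  unfolding Lp_def
proof (intro CollectI conjI)
  show "integrable (lebesgue_on \<Omega>) (\<lambda>x. norm (f x) powr p)"
  proof (rule Bochner_Integration.integrable_bound[OF Lp_powr_integrable[OF assms(1)]])
    show "(\<lambda>x. norm (f x) powr p) \<in> borel_measurable (lebesgue_on \<Omega>)"
      using assms(2) by measurable
    show "AE x in lebesgue_on \<Omega>. norm (norm (f x) powr p) \<le> norm (norm (g x) powr p)"
      using assms(3) by eventually_elim (use p_pos in \<open>auto intro!: powr_mono2\<close>)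
  qed
qed (rule assms(2))

lemma Lp_diff:
  fixes f g :: "'a \<Rightarrow> 'b::euclidean_space"
  assumes "f \<in> Lp \<Omega> p" "g \<in> Lp \<Omega> p"
  shows "(\<lambda>x. f x - g x) \<in> Lp \<Omega> p"
  unfolding Lp_def
proof (intro CollectI conjI)
  note [measurable] = Lp_measurable[OF assms(1)] Lp_measurable[OF assms(2)]
  show m: "(\<lambda>x. f x - g x) \<in> borel_measurable (lebesgue_on \<Omega>)" by measurable
  show "integrable (lebesgue_on \<Omega>) (\<lambda>x. norm (f x - g x) powr p)"
  proof (rule Bochner_Integration.integrable_bound)
    show "integrable (lebesgue_on \<Omega>) (\<lambda>x. 2 powr p * (norm (f x) powr p + norm (g x) powr p))"
      using assms[THEN Lp_powr_integrable] by simp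
    show "AE x in lebesgue_on \<Omega>. norm (norm (f x - g x) powr p)
        \<le> norm (2 powr p * (norm (f x) powr p + norm (g x) powr p))"
    proof (intro AE_I2)
      fix x
      show "norm (norm (f x - g x) powr p) \<le> norm (2 powr p * (norm (f x) powr p + norm (g x) powr p))"
        using powr_norm_diff_le[OF p_pos(1), of "f x" "g x"] by simp
    qed
  qed measurable
qed

lemma Lp_continuous:
  fixes f :: "'a \<Rightarrow> 'b::euclidean_space"
  assumes "continuous_on UNIV f" "compact K" "\<And>x. x \<notin> K \<Longrightarrow> f x = 0"
  shows "f \<in> Lp \<Omega> p"
proof -
  have "continuous_on UNIV (\<lambda>x. norm (f x))" using assms(1) by (intro continuous_intros)
  from compactly_supported_bounded[OF this assms(2)] assms(3)
  obtain M where M: "\<And>x. norm (f x) \<le> M" by (metis abs_norm_cancel norm_zero)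
  have [measurable]: "f \<in> borel_measurable (lebesgue_on \<Omega>)"
    using borel_measurable_continuous_onI[OF assms(1)]
    by (intro measurable_restrict_space1 measurable_completion) simp
  have "integrable (lebesgue_on \<Omega>) (\<lambda>x. norm (f x) powr p)"
    by (rule finite_measure.integrable_const_bound[OF finite_measure_domain, of _ "M powr p"]) (use M p_pos in \<open>auto intro!: powr_mono2\<close>)
  then show ?thesis by (simp add: Lp_def)
qed

lemma Lp_const: "(\<lambda>x. c) \<in> Lp \<Omega> p"
  by (simp add: Lp_def finite_measure.integrable_const[OF finite_measure_domain])

lemma W1pI:
  assumes "u \<in> Lp \<Omega> p" "g \<in> Lp \<Omega> p" "is_weak_gradient \<Omega> u g"
  shows "u \<in> W1p \<Omega> p" "AE x in lebesgue_on \<Omega>. weak_grad \<Omega> u x = g x"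
  using assms(1,2,3) weak_grad_AE[OF open_domain assms(3)] unfolding W1p_def by blast+

text \<open>The chosen representative \<open>weak_grad\<close> is a priori only locally integrable; as weak gradients are
  unique almost everywhere, it lies in \<open>Lp\<close>.\<close>

lemma W1pD:
  assumes "u \<in> W1p \<Omega> p"
  shows "u \<in> Lp \<Omega> p" "is_weak_gradient \<Omega> u (weak_grad \<Omega> u)" "weak_grad \<Omega> u \<in> Lp \<Omega> p"
proof -
  obtain g where g: "g \<in> Lp \<Omega> p" "is_weak_gradient \<Omega> u g" and u: "u \<in> Lp \<Omega> p"
    using assms by (auto simp: W1p_def)
  show "u \<in> Lp \<Omega> p" by fact
  show "is_weak_gradient \<Omega> u (weak_grad \<Omega> u)"
    unfolding weak_grad_def by (rule someI[of "is_weak_gradient \<Omega> u"]) (rule g(2))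
  have ae: "AE x in lebesgue_on \<Omega>. weak_grad \<Omega> u x = g x"
    by (rule weak_grad_AE[OF open_domain g(2)])
  have "(\<lambda>x. indicator \<Omega> x *\<^sub>R weak_grad \<Omega> u x) \<in> borel_measurable lebesgue"
  proof (rule borel_measurable_AE)
    show "(\<lambda>x. indicator \<Omega> x *\<^sub>R g x) \<in> borel_measurable lebesgue"
      using Lp_measurable[OF g(1)] open_domain by (subst (asm) borel_measurable_restrict_space_iff) auto
    show "AE x in lebesgue. indicator \<Omega> x *\<^sub>R g x = indicator \<Omega> x *\<^sub>R weak_grad \<Omega> u x"
      using ae unfolding AE_lebesgue_on[OF open_domain]
      by eventually_elim (auto simp: indicator_def)
  qed
  then have m: "weak_grad \<Omega> u \<in> borel_measurable (lebesgue_on \<Omega>)"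
    using open_domain by (subst borel_measurable_restrict_space_iff) auto
  show "weak_grad \<Omega> u \<in> Lp \<Omega> p"
    by (rule Lp_mono[OF g(1) m]) (use ae in \<open>auto elim: eventually_mono\<close>)
qed

lemma W1p_diff:
  assumes "u \<in> W1p \<Omega> p" "v \<in> W1p \<Omega> p"
  shows "(\<lambda>x. u x - v x) \<in> W1p \<Omega> p"
    "AE x in lebesgue_on \<Omega>. weak_grad \<Omega> (\<lambda>x. u x - v x) x = weak_grad \<Omega> u x - weak_grad \<Omega> v x"
proof -
  note D = Lp_diff[OF assms[THEN W1pD(1)]] Lp_diff[OF assms[THEN W1pD(3)]]
    is_weak_gradient_diff[OF open_domain assms[THEN W1pD(2)]]
  show "(\<lambda>x. u x - v x) \<in> W1p \<Omega> p" by (rule W1pI(1)[OF D])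
  show "AE x in lebesgue_on \<Omega>. weak_grad \<Omega> (\<lambda>x. u x - v x) x = weak_grad \<Omega> u x - weak_grad \<Omega> v x"
    by (rule W1pI(2)[OF D])
qed

lemma W1p_test:
  assumes "\<phi> \<in> C_c_infinity \<Omega>"
  shows "\<phi> \<in> W1p \<Omega> p" "AE x in lebesgue_on \<Omega>. weak_grad \<Omega> \<phi> x = gradient \<phi> x"
proof -
  obtain K where K: "compact K" "\<And>x. x \<notin> K \<Longrightarrow> \<phi> x = 0"
    "\<And>x b. x \<notin> K \<Longrightarrow> frechet_derivative \<phi> (at x) b = 0"
    using C_c_infinityE[OF assms] by metis
  have "\<phi> \<in> Lp \<Omega> p"
    by (rule Lp_continuous[OF C_c_infinity_continuous[OF assms] K(1,2)])
  moreover have "gradient \<phi> \<in> Lp \<Omega> p"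
    by (rule Lp_continuous[OF continuous_gradient[OF assms] K(1)]) (simp add: gradient_def K(3))
  ultimately show "\<phi> \<in> W1p \<Omega> p" "AE x in lebesgue_on \<Omega>. weak_grad \<Omega> \<phi> x = gradient \<phi> x"
    using W1pI[OF _ _ is_weak_gradient_test[OF open_domain assms]] by blast+
qed

lemma W1p_truncation:
  assumes U: "U \<in> W1p \<Omega> p"
  shows "(\<lambda>x. max 0 (U x - l)) \<in> W1p \<Omega> p"
    "AE x in lebesgue_on \<Omega>. weak_grad \<Omega> (\<lambda>x. max 0 (U x - l)) x = (if U x > l then weak_grad \<Omega> U x else 0)"
proof -
  let ?w = "\<lambda>x. U x - l" and ?g = "\<lambda>x. weak_grad \<Omega> U x - 0"
  have w: "?w \<in> Lp \<Omega> p" "?g \<in> Lp \<Omega> p"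
    using Lp_diff[OF W1pD(1)[OF U] Lp_const] W1pD(3)[OF U] by auto
  have wk: "is_weak_gradient \<Omega> ?w ?g"
    by (rule is_weak_gradient_diff[OF open_domain W1pD(2)[OF U] is_weak_gradient_const[OF open_domain]])
  note [measurable] = W1pD(1,3)[OF U, THEN Lp_measurable]
  have "is_weak_gradient \<Omega> (\<lambda>x. max 0 (?w x)) (\<lambda>x. if ?w x > 0 then ?g x else 0)"
    by (rule is_weak_gradient_pos_part[OF open_domain w[THEN Lp_integrable] wk])
  moreover have "(\<lambda>x. max 0 (?w x)) \<in> Lp \<Omega> p" by (rule Lp_mono[OF w(1)]) auto
  moreover have "(\<lambda>x. if ?w x > 0 then ?g x else 0) \<in> Lp \<Omega> p"
  proof (rule Lp_mono[OF w(2)])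
    show "(\<lambda>x. if ?w x > 0 then ?g x else 0) \<in> borel_measurable (lebesgue_on \<Omega>)" by measurable
  qed auto
  ultimately have D: "(\<lambda>x. max 0 (?w x)) \<in> Lp \<Omega> p" "(\<lambda>x. if ?w x > 0 then ?g x else 0) \<in> Lp \<Omega> p"
      "is_weak_gradient \<Omega> (\<lambda>x. max 0 (?w x)) (\<lambda>x. if ?w x > 0 then ?g x else 0)"
    by blast+
  show "(\<lambda>x. max 0 (U x - l)) \<in> W1p \<Omega> p" by (rule W1pI(1)[OF D])
  show "AE x in lebesgue_on \<Omega>. weak_grad \<Omega> (\<lambda>x. max 0 (U x - l)) x = (if U x > l then weak_grad \<Omega> U x else 0)"
    using W1pI(2)[OF D] by eventually_elim simp
qed

text \<open>The \<open>p\<close>-th power of the Sobolev norm.\<close>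

definition energy :: "('a \<Rightarrow> real) \<Rightarrow> real" where
  "energy u = (\<integral>x. \<bar>u x\<bar> powr p \<partial>lebesgue_on \<Omega>) +
      (\<integral>x. norm (weak_grad \<Omega> u x) powr p \<partial>lebesgue_on \<Omega>)"

lemma energy_nonneg: "energy u \<ge> 0"
  by (simp add: energy_def Bochner_Integration.integral_nonneg)

lemma W1p_norm_less_iff:
  assumes "e > 0"
  shows "W1p_norm \<Omega> p u < e \<longleftrightarrow> energy u < e powr p"
proof -
  have "W1p_norm \<Omega> p u = energy u powr (1 / p)" by (simp add: W1p_norm_def energy_def)
  moreover have "energy u powr (1 / p) < e \<longleftrightarrow> (energy u powr (1 / p)) powr p < e powr p"
    using assms p_pos powr_less_mono2[of p "energy u powr (1 / p)" e] powr_mono2[of p e "energy u powr (1 / p)"]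
    by (smt (verit) powr_ge_zero)
  moreover have "(energy u powr (1 / p)) powr p = energy u"
    using p_pos energy_nonneg[of u] by (simp add: powr_powr)
  ultimately show ?thesis by simp
qed

lemma W1p0_iff:
  "u \<in> W1p0 \<Omega> p \<longleftrightarrow> u \<in> W1p \<Omega> p \<and> (\<forall>e>0. \<exists>\<phi>\<in>C_c_infinity \<Omega>. energy (\<lambda>x. u x - \<phi> x) < e)"
  (is "_ \<longleftrightarrow> _ \<and> ?R")
proof -
  have "(\<forall>e>0. \<exists>\<phi>\<in>C_c_infinity \<Omega>. W1p_norm \<Omega> p (\<lambda>x. u x - \<phi> x) < e) \<longleftrightarrow> ?R"
  proof (intro iffI allI impI)
    fix e :: real assume L: "\<forall>e>0. \<exists>\<phi>\<in>C_c_infinity \<Omega>. W1p_norm \<Omega> p (\<lambda>x. u x - \<phi> x) < e" and e: "e > 0"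
    have "e powr (1 / p) > 0" "(e powr (1 / p)) powr p = e"
      using e p_pos by (auto simp: powr_powr)
    then show "\<exists>\<phi>\<in>C_c_infinity \<Omega>. energy (\<lambda>x. u x - \<phi> x) < e"
      using L W1p_norm_less_iff by metis
  next
    fix e :: real assume R: ?R and e: "e > 0"
    then have "e powr p > 0" by simp
    then show "\<exists>\<phi>\<in>C_c_infinity \<Omega>. W1p_norm \<Omega> p (\<lambda>x. u x - \<phi> x) < e"
      using R W1p_norm_less_iff[OF e] by blast
  qed
  then show ?thesis by (simp add: W1p0_def)
qed

lemma integral_powr_weak_grad:
  assumes "u \<in> W1p \<Omega> p" "g \<in> borel_measurable (lebesgue_on \<Omega>)" "AE x in lebesgue_on \<Omega>. weak_grad \<Omega> u x = g x"
  shows "(\<integral>x. norm (weak_grad \<Omega> u x) powr p \<partial>lebesgue_on \<Omega>) = (\<integral>x. norm (g x) powr p \<partial>lebesgue_on \<Omega>)"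
proof -
  note [measurable] = assms(2) Lp_measurable[OF W1pD(3)[OF assms(1)]]
  show ?thesis
    by (rule integral_cong_AE) (measurable, use assms(3) in \<open>auto elim: eventually_mono\<close>)
qed

lemma integral_powr_diff_le:
  fixes f g :: "'a \<Rightarrow> 'b::euclidean_space"
  assumes "f \<in> Lp \<Omega> p" "g \<in> Lp \<Omega> p"
  shows "(\<integral>x. norm (f x - g x) powr p \<partial>lebesgue_on \<Omega>)
    \<le> 2 powr p * ((\<integral>x. norm (f x) powr p \<partial>lebesgue_on \<Omega>) + (\<integral>x. norm (g x) powr p \<partial>lebesgue_on \<Omega>))"
proof -
  have "(\<integral>x. norm (f x - g x) powr p \<partial>lebesgue_on \<Omega>)
      \<le> (\<integral>x. 2 powr p * (norm (f x) powr p + norm (g x) powr p) \<partial>lebesgue_on \<Omega>)"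
    using assms Lp_diff[OF assms] powr_norm_diff_le[OF p_pos(1)]
    by (intro integral_mono) (auto intro!: Lp_powr_integrable)
  then show ?thesis
    using assms by (simp add: Lp_powr_integrable)
qed

lemma energy_diff_le:
  assumes "u \<in> W1p \<Omega> p" "v \<in> W1p \<Omega> p"
  shows "energy (\<lambda>x. u x - v x) \<le> 2 powr p * (energy u + energy v)"
proof -
  note [measurable] = Lp_measurable[OF W1pD(3)[OF assms(1)]] Lp_measurable[OF W1pD(3)[OF assms(2)]]
  have "(\<integral>x. norm (weak_grad \<Omega> (\<lambda>x. u x - v x) x) powr p \<partial>lebesgue_on \<Omega>)
      = (\<integral>x. norm (weak_grad \<Omega> u x - weak_grad \<Omega> v x) powr p \<partial>lebesgue_on \<Omega>)"
    by (rule integral_powr_weak_grad[OF W1p_diff(1)[OF assms] _ W1p_diff(2)[OF assms]]) measurable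
  then show ?thesis
    using integral_powr_diff_le[OF assms[THEN W1pD(1)]] integral_powr_diff_le[OF assms[THEN W1pD(3)]]
    by (simp add: energy_def algebra_simps)
qed

lemma energy_commute:
  assumes "u \<in> W1p \<Omega> p" "v \<in> W1p \<Omega> p"
  shows "energy (\<lambda>x. u x - v x) = energy (\<lambda>x. v x - u x)"
proof -
  note [measurable] = Lp_measurable[OF W1pD(3)[OF assms(1)]] Lp_measurable[OF W1pD(3)[OF assms(2)]]
  have "(\<integral>x. norm (weak_grad \<Omega> (\<lambda>x. u x - v x) x) powr p \<partial>lebesgue_on \<Omega>)
      = (\<integral>x. norm (weak_grad \<Omega> u x - weak_grad \<Omega> v x) powr p \<partial>lebesgue_on \<Omega>)"
    by (rule integral_powr_weak_grad[OF W1p_diff(1)[OF assms] _ W1p_diff(2)[OF assms]]) measurable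
  moreover have "(\<integral>x. norm (weak_grad \<Omega> (\<lambda>x. v x - u x) x) powr p \<partial>lebesgue_on \<Omega>)
      = (\<integral>x. norm (weak_grad \<Omega> v x - weak_grad \<Omega> u x) powr p \<partial>lebesgue_on \<Omega>)"
    by (rule integral_powr_weak_grad[OF W1p_diff(1)[OF assms(2,1)] _ W1p_diff(2)[OF assms(2,1)]]) measurable
  ultimately show ?thesis
    by (simp add: energy_def norm_minus_commute abs_minus_commute)
qed

lemma W1p0_closed:
  assumes u: "u \<in> W1p \<Omega> p" and approx: "\<And>e. e > 0 \<Longrightarrow> \<exists>v\<in>W1p0 \<Omega> p. energy (\<lambda>x. u x - v x) < e"
  shows "u \<in> W1p0 \<Omega> p"
  unfolding W1p0_iff
proof (intro conjI allI impI)
  fix e :: real assume e: "e > 0"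
  define e' where "e' = e / (2 * 2 powr p)"
  have e': "e' > 0" using e by (simp add: e'_def)
  obtain v where v: "v \<in> W1p0 \<Omega> p" "energy (\<lambda>x. u x - v x) < e'" using approx[OF e'] by blast
  then obtain \<phi> where \<phi>: "\<phi> \<in> C_c_infinity \<Omega>" "energy (\<lambda>x. v x - \<phi> x) < e'"
    using e' W1p0_iff by blast
  have W: "v \<in> W1p \<Omega> p" "\<phi> \<in> W1p \<Omega> p" using v \<phi> W1p0_iff W1p_test by blast+
  have "energy (\<lambda>x. (u x - v x) - (\<phi> x - v x)) \<le> 2 powr p * (energy (\<lambda>x. u x - v x) + energy (\<lambda>x. \<phi> x - v x))"
    by (intro energy_diff_le W1p_diff(1) u W)
  also have "\<dots> < 2 powr p * (e' + e')"
    using v(2) \<phi>(2) energy_commute[OF W] by (intro mult_strict_left_mono add_strict_mono) auto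
  also have "\<dots> = e" by (simp add: e'_def)
  finally show "\<exists>\<phi>\<in>C_c_infinity \<Omega>. energy (\<lambda>x. u x - \<phi> x) < e" using \<phi>(1) by auto
qed (rule u)

lemma W1p0_diff:
  assumes "u \<in> W1p0 \<Omega> p" "v \<in> W1p0 \<Omega> p"
  shows "(\<lambda>x. u x - v x) \<in> W1p0 \<Omega> p"
  unfolding W1p0_iff
proof (intro conjI allI impI)
  have W: "u \<in> W1p \<Omega> p" "v \<in> W1p \<Omega> p" using assms W1p0_iff by blast+
  then show "(\<lambda>x. u x - v x) \<in> W1p \<Omega> p" by (rule W1p_diff)
  fix e :: real assume e: "e > 0"
  define e' where "e' = e / (2 * 2 powr p)"
  have e': "e' > 0" using e by (simp add: e'_def)
  obtain \<phi> \<psi> where \<phi>: "\<phi> \<in> C_c_infinity \<Omega>" "energy (\<lambda>x. u x - \<phi> x) < e'"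
    and \<psi>: "\<psi> \<in> C_c_infinity \<Omega>" "energy (\<lambda>x. v x - \<psi> x) < e'"
    using e' assms W1p0_iff by meson
  have "energy (\<lambda>x. (u x - \<phi> x) - (v x - \<psi> x)) \<le> 2 powr p * (energy (\<lambda>x. u x - \<phi> x) + energy (\<lambda>x. v x - \<psi> x))"
    by (intro energy_diff_le W1p_diff(1) W W1p_test \<phi> \<psi>)
  also have "\<dots> < 2 powr p * (e' + e')"
    using \<phi>(2) \<psi>(2) by (intro mult_strict_left_mono add_strict_mono) auto
  also have "\<dots> = e" by (simp add: e'_def)
  finally have "energy (\<lambda>x. (u x - v x) - (\<phi> x - \<psi> x)) < e" by (simp add: algebra_simps)
  then show "\<exists>\<phi>\<in>C_c_infinity \<Omega>. energy (\<lambda>x. (u x - v x) - \<phi> x) < e"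
    using C_c_infinity_diff[OF \<phi>(1) \<psi>(1)] by (intro bexI[of _ "\<lambda>x. \<phi> x - \<psi> x"])
qed

section \<open>The boundary supremum\<close>

text \<open>The integral of the weak derivative of \<open>(x \<bullet> b) v\<close> in the direction \<open>b\<close>. It vanishes on \<open>W1p0\<close>,
  which bounds the integral of \<open>v\<close> by that of its gradient; this takes the place of the Poincare
  inequality.\<close>

definition coordinate_flux :: "'a \<Rightarrow> ('a \<Rightarrow> real) \<Rightarrow> real" where
  "coordinate_flux b v = (\<integral>x. v x \<partial>lebesgue_on \<Omega>) + (\<integral>x. (weak_grad \<Omega> v x \<bullet> b) * (x \<bullet> b) \<partial>lebesgue_on \<Omega>)"

lemma coordinate_measurable [measurable]: "(\<lambda>x. x \<bullet> b) \<in> borel_measurable (lebesgue_on \<Omega>)"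
  by (intro measurable_restrict_space1 measurable_completion) simp

lemma integrable_weak_grad_coordinate:
  assumes "g \<in> Lp \<Omega> p" "b \<in> Basis"
  shows "integrable (lebesgue_on \<Omega>) (\<lambda>x. (g x \<bullet> b) * (x \<bullet> b))"
proof -
  obtain R where R: "R \<ge> 0" "\<And>x. x \<in> \<Omega> \<Longrightarrow> norm x \<le> R"
    using bounded_domain by (auto simp: bounded_pos intro: less_imp_le)
  note [measurable] = Lp_measurable[OF assms(1)]
  show ?thesis
  proof (rule Bochner_Integration.integrable_bound[of _ "\<lambda>x. R * norm (g x)"])
    show "AE x in lebesgue_on \<Omega>. norm ((g x \<bullet> b) * (x \<bullet> b)) \<le> norm (R * norm (g x))"
    proof (rule AE_I2)
      fix x assume "x \<in> space (lebesgue_on \<Omega>)"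
      then have "\<bar>x \<bullet> b\<bar> \<le> R" using R Basis_le_norm[OF assms(2), of x] by (fastforce intro: order_trans)
      then have "\<bar>g x \<bullet> b\<bar> * \<bar>x \<bullet> b\<bar> \<le> norm (g x) * R"
        by (intro mult_mono Basis_le_norm assms) auto
      then show "norm ((g x \<bullet> b) * (x \<bullet> b)) \<le> norm (R * norm (g x))"
        using R(1) by (simp add: abs_mult mult.commute)
    qed
  qed (use Lp_integrable[OF assms(1)] in \<open>auto\<close>)
qed

lemma coordinate_flux_diff:
  assumes "u \<in> W1p \<Omega> p" "v \<in> W1p \<Omega> p" "b \<in> Basis"
  shows "coordinate_flux b (\<lambda>x. u x - v x) = coordinate_flux b u - coordinate_flux b v"
proof -
  note g = W1pD(3)[OF assms(1)] W1pD(3)[OF assms(2)] W1pD(3)[OF W1p_diff(1)[OF assms(1,2)]]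
  note [measurable] = g[THEN Lp_measurable]
  have "(\<integral>x. (weak_grad \<Omega> (\<lambda>x. u x - v x) x \<bullet> b) * (x \<bullet> b) \<partial>lebesgue_on \<Omega>)
      = (\<integral>x. (weak_grad \<Omega> u x \<bullet> b) * (x \<bullet> b) - (weak_grad \<Omega> v x \<bullet> b) * (x \<bullet> b) \<partial>lebesgue_on \<Omega>)"
  proof (rule integral_cong_AE)
    note i = integrable_weak_grad_coordinate[OF _ assms(3)]
    show "(\<lambda>x. (weak_grad \<Omega> (\<lambda>x. u x - v x) x \<bullet> b) * (x \<bullet> b)) \<in> borel_measurable (lebesgue_on \<Omega>)"
      by (rule borel_measurable_integrable[OF i[OF g(3)]])
    show "(\<lambda>x. (weak_grad \<Omega> u x \<bullet> b) * (x \<bullet> b) - (weak_grad \<Omega> v x \<bullet> b) * (x \<bullet> b))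
        \<in> borel_measurable (lebesgue_on \<Omega>)"
      by (intro borel_measurable_diff borel_measurable_integrable i g)
    show "AE x in lebesgue_on \<Omega>. (weak_grad \<Omega> (\<lambda>x. u x - v x) x \<bullet> b) * (x \<bullet> b)
        = (weak_grad \<Omega> u x \<bullet> b) * (x \<bullet> b) - (weak_grad \<Omega> v x \<bullet> b) * (x \<bullet> b)"
      using W1p_diff(2)[OF assms(1,2)] by eventually_elim (simp add: inner_diff_left left_diff_distrib)
  qed
  then show ?thesis
    using assms g by (simp add: coordinate_flux_def integrable_weak_grad_coordinate Lp_integrable W1pD(1))
qed

lemma coordinate_flux_test:
  assumes \<phi>: "\<phi> \<in> C_c_infinity \<Omega>" and b: "b \<in> Basis"
  shows "coordinate_flux b \<phi> = 0"
proof -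
  note [measurable] = C_c_infinity_borel(1)[OF \<phi>] C_c_infinity_borel(2)[OF \<phi> b]
  have "(\<integral>x. (weak_grad \<Omega> \<phi> x \<bullet> b) * (x \<bullet> b) \<partial>lebesgue_on \<Omega>)
      = (\<integral>x. (x \<bullet> b) * frechet_derivative \<phi> (at x) b \<partial>lebesgue_on \<Omega>)"
  proof (rule integral_cong_AE)
    have [measurable]: "weak_grad \<Omega> \<phi> \<in> borel_measurable (lebesgue_on \<Omega>)"
      by (rule Lp_measurable[OF W1pD(3)[OF W1p_test(1)[OF \<phi>]]])
    show "(\<lambda>x. (weak_grad \<Omega> \<phi> x \<bullet> b) * (x \<bullet> b)) \<in> borel_measurable (lebesgue_on \<Omega>)" by measurable
    show "(\<lambda>x. (x \<bullet> b) * frechet_derivative \<phi> (at x) b) \<in> borel_measurable (lebesgue_on \<Omega>)"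
      by (intro measurable_restrict_space1 measurable_completion) simp
    show "AE x in lebesgue_on \<Omega>. (weak_grad \<Omega> \<phi> x \<bullet> b) * (x \<bullet> b) = (x \<bullet> b) * frechet_derivative \<phi> (at x) b"
      using W1p_test(2)[OF \<phi>] by eventually_elim (simp add: gradient_inner[OF b])
  qed
  also have "\<dots> = (\<integral>x. (x \<bullet> b) * frechet_derivative \<phi> (at x) b \<partial>lborel)"
    using C_c_infinity_outside[OF \<phi>] by (intro integral_lebesgue_on_lborel open_domain) auto
  also have "\<dots> = - (\<integral>x. 1 * \<phi> x \<partial>lborel)"
    by (rule integration_by_parts[OF \<phi> b, of _ "\<lambda>_. 1" 1])
      (auto intro!: continuous_intros derivative_eq_intros simp: inner_simps b)
  also have "(\<integral>x. 1 * \<phi> x \<partial>lborel) = (\<integral>x. \<phi> x \<partial>lebesgue_on \<Omega>)"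
    using C_c_infinity_outside[OF \<phi>] by (subst integral_lebesgue_on_lborel[OF open_domain]) auto
  finally show ?thesis by (simp add: coordinate_flux_def)
qed

text \<open>A substitute for Hoelder's inequality on a set of finite measure: \<open>t \<le> d + d powr (1 - p) * t powr p\<close>
  for nonnegative \<open>t\<close>.\<close>

lemma integral_norm_le_powr:
  fixes f :: "'a \<Rightarrow> 'b::euclidean_space"
  assumes f: "f \<in> Lp \<Omega> p" and d: "d > 0"
  shows "(\<integral>x. norm (f x) \<partial>lebesgue_on \<Omega>)
    \<le> d * measure lebesgue \<Omega> + d powr (1 - p) * (\<integral>x. norm (f x) powr p \<partial>lebesgue_on \<Omega>)"
proof -
  interpret finite_measure "lebesgue_on \<Omega>" by (rule finite_measure_domain)
  have "(\<integral>x. norm (f x) \<partial>lebesgue_on \<Omega>) \<le> (\<integral>x. d + d powr (1 - p) * norm (f x) powr p \<partial>lebesgue_on \<Omega>)"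
  proof (rule integral_mono)
    show "norm (f x) \<le> d + d powr (1 - p) * norm (f x) powr p" for x
    proof (cases "norm (f x) \<le> d")
      case False
      then have n: "norm (f x) > d" by simp
      have "norm (f x) = norm (f x) powr (1 - p) * norm (f x) powr p"
        using n d by (simp add: powr_add[symmetric])
      also have "\<dots> \<le> d powr (1 - p) * norm (f x) powr p"
        using n d p_gt_1 by (intro mult_right_mono powr_mono2') auto
      finally show ?thesis using d by linarith
    qed (use mult_nonneg_nonneg[OF powr_ge_zero powr_ge_zero, of d "1 - p" "norm (f x)" p] in linarith)
  qed (use Lp_integrable[OF f] Lp_powr_integrable[OF f] in auto)
  also have "\<dots> = d * measure (lebesgue_on \<Omega>) (space (lebesgue_on \<Omega>)) + d powr (1 - p) * (\<integral>x. norm (f x) powr p \<partial>lebesgue_on \<Omega>)"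
    using Lp_powr_integrable[OF f] by simp
  also have "measure (lebesgue_on \<Omega>) (space (lebesgue_on \<Omega>)) = measure lebesgue \<Omega>"
    using open_domain by (simp add: measure_restrict_space)
  finally show ?thesis .
qed

lemma coordinate_flux_W1p0:
  assumes v: "v \<in> W1p0 \<Omega> p" and b: "b \<in> Basis"
  shows "coordinate_flux b v = 0"
proof -
  obtain R where R: "R \<ge> 0" "\<And>x. x \<in> \<Omega> \<Longrightarrow> norm x \<le> R"
    using bounded_domain by (auto simp: bounded_pos intro: less_imp_le)
  let ?m = "measure lebesgue \<Omega>"
  have bound: "\<bar>coordinate_flux b v\<bar> \<le> (1 + R) * (d * (?m + 1))" if d: "d > 0" for d
  proof -
    \<comment> \<open>With this accuracy both terms of the interpolation inequality are multiples of d.\<close>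
    obtain \<phi> where \<phi>: "\<phi> \<in> C_c_infinity \<Omega>" "energy (\<lambda>x. v x - \<phi> x) < d powr p"
      using v d W1p0_iff by (metis powr_gt_zero less_irrefl)
    let ?w = "\<lambda>x. v x - \<phi> x"
    have vW: "v \<in> W1p \<Omega> p" using v W1p0_iff by blast
    have w: "?w \<in> W1p \<Omega> p" by (intro W1p_diff W1p_test vW \<phi>)
    have "coordinate_flux b v = coordinate_flux b ?w"
      using coordinate_flux_diff[OF vW W1p_test(1)[OF \<phi>(1)] b] coordinate_flux_test[OF \<phi>(1) b] by simp
    also have "\<bar>\<dots>\<bar> \<le> (\<integral>x. \<bar>?w x\<bar> \<partial>lebesgue_on \<Omega>) + (\<integral>x. R * norm (weak_grad \<Omega> ?w x) \<partial>lebesgue_on \<Omega>)"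
    proof -
      have "\<bar>\<integral>x. (weak_grad \<Omega> ?w x \<bullet> b) * (x \<bullet> b) \<partial>lebesgue_on \<Omega>\<bar>
          \<le> (\<integral>x. \<bar>(weak_grad \<Omega> ?w x \<bullet> b) * (x \<bullet> b)\<bar> \<partial>lebesgue_on \<Omega>)" by (rule integral_abs_bound)
      also have "\<dots> \<le> (\<integral>x. R * norm (weak_grad \<Omega> ?w x) \<partial>lebesgue_on \<Omega>)"
      proof (rule integral_mono)
        fix x assume "x \<in> space (lebesgue_on \<Omega>)"
        then have "\<bar>x \<bullet> b\<bar> \<le> R" using R Basis_le_norm[OF b, of x] by (fastforce intro: order_trans)
        then have "\<bar>weak_grad \<Omega> ?w x \<bullet> b\<bar> * \<bar>x \<bullet> b\<bar> \<le> norm (weak_grad \<Omega> ?w x) * R"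
          by (intro mult_mono Basis_le_norm b) auto
        then show "\<bar>(weak_grad \<Omega> ?w x \<bullet> b) * (x \<bullet> b)\<bar> \<le> R * norm (weak_grad \<Omega> ?w x)"
          by (simp add: abs_mult mult.commute)
      qed (use integrable_weak_grad_coordinate[OF W1pD(3)[OF w] b] Lp_integrable[OF W1pD(3)[OF w]] in auto)
      finally have "\<bar>\<integral>x. (weak_grad \<Omega> ?w x \<bullet> b) * (x \<bullet> b) \<partial>lebesgue_on \<Omega>\<bar>
          \<le> (\<integral>x. R * norm (weak_grad \<Omega> ?w x) \<partial>lebesgue_on \<Omega>)" .
      moreover have "\<bar>\<integral>x. ?w x \<partial>lebesgue_on \<Omega>\<bar> \<le> (\<integral>x. \<bar>?w x\<bar> \<partial>lebesgue_on \<Omega>)" by (rule integral_abs_bound)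
      ultimately show ?thesis unfolding coordinate_flux_def by linarith
    qed
    also have "\<dots> \<le> (1 + R) * (d * (?m + 1))"
    proof -
      let ?A = "\<integral>x. \<bar>?w x\<bar> powr p \<partial>lebesgue_on \<Omega>" and ?B = "\<integral>x. norm (weak_grad \<Omega> ?w x) powr p \<partial>lebesgue_on \<Omega>"
      have AB: "?A \<ge> 0" "?B \<ge> 0" "?A + ?B < d powr p"
        using \<phi>(2) by (auto simp: energy_def Bochner_Integration.integral_nonneg)
      have dd: "d powr (1 - p) * d powr p = d" using d by (simp add: powr_add[symmetric])
      have "d powr (1 - p) * ?A \<le> d powr (1 - p) * d powr p" "d powr (1 - p) * ?B \<le> d powr (1 - p) * d powr p"
        by (rule mult_left_mono, use AB in linarith, simp)+
      then have "(\<integral>x. \<bar>?w x\<bar> \<partial>lebesgue_on \<Omega>) \<le> d * ?m + d" "(\<integral>x. norm (weak_grad \<Omega> ?w x) \<partial>lebesgue_on \<Omega>) \<le> d * ?m + d"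
        using integral_norm_le_powr[OF W1pD(1)[OF w] d] integral_norm_le_powr[OF W1pD(3)[OF w] d] unfolding dd
        by simp_all
      then have "(\<integral>x. \<bar>?w x\<bar> \<partial>lebesgue_on \<Omega>) + R * (\<integral>x. norm (weak_grad \<Omega> ?w x) \<partial>lebesgue_on \<Omega>)
          \<le> (d * ?m + d) + R * (d * ?m + d)"
        using R(1) by (intro add_mono mult_left_mono) auto
      then show ?thesis by (simp add: algebra_simps)
    qed
    finally show ?thesis .
  qed
  show ?thesis
  proof (rule ccontr)
    assume n: "coordinate_flux b v \<noteq> 0"
    define k where "k = (1 + R) * (?m + 1)"
    have k: "k > 0" using R(1) by (simp add: k_def add_nonneg_pos)
    have "\<bar>coordinate_flux b v\<bar> \<le> (1 + R) * ((\<bar>coordinate_flux b v\<bar> / (2 * k)) * (?m + 1))"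
      using n k by (intro bound) auto
    also have "\<dots> = (\<bar>coordinate_flux b v\<bar> / (2 * k)) * k" by (simp only: k_def mult_ac)
    also have "\<dots> = \<bar>coordinate_flux b v\<bar> / 2" using k by simp
    finally show False using n by simp
  qed
qed

text \<open>If the truncation at level \<open>l\<close> lies in \<open>W1p0\<close>, its integral is at most the integral of
  \<open>R |\<nabla>U|\<close>, where \<open>R\<close> bounds \<open>\<Omega>\<close>; but it is at least the integral of \<open>U - l\<close>, which is large for very
  negative \<open>l\<close>.\<close>

lemma bdry_sup_bounded_below:
  assumes ne: "\<Omega> \<noteq> {}" and U: "U \<in> W1p \<Omega> p"
  shows "bdd_below {l. (\<lambda>x. max 0 (U x - l)) \<in> W1p0 \<Omega> p}"
proof -
  interpret finite_measure "lebesgue_on \<Omega>" by (rule finite_measure_domain)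
  obtain R where R: "R \<ge> 0" "\<And>x. x \<in> \<Omega> \<Longrightarrow> norm x \<le> R"
    using bounded_domain by (auto simp: bounded_pos intro: less_imp_le)
  obtain b :: 'a where b: "b \<in> Basis" using nonempty_Basis by blast
  let ?m = "measure lebesgue \<Omega>" and ?G = "\<integral>x. R * norm (weak_grad \<Omega> U x) \<partial>lebesgue_on \<Omega>"
  have m: "?m > 0"
  proof -
    have "\<not> negligible \<Omega>" using open_not_negligible[OF open_domain ne] .
    then have "?m \<noteq> 0"
      using lmeasurable_open[OF bounded_domain open_domain] by (simp add: negligible_iff_measure)
    then show ?thesis using measure_nonneg[of lebesgue \<Omega>] by linarith
  qed
  have "((\<integral>x. U x \<partial>lebesgue_on \<Omega>) - ?G) / ?m \<le> l" if l: "(\<lambda>x. max 0 (U x - l)) \<in> W1p0 \<Omega> p" for l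
  proof -
    let ?w = "\<lambda>x. max 0 (U x - l)"
    note w = W1p_truncation[OF U, of l]
    have "(\<integral>x. U x \<partial>lebesgue_on \<Omega>) - l * ?m = (\<integral>x. U x - l \<partial>lebesgue_on \<Omega>)"
      using Lp_integrable[OF W1pD(1)[OF U]] open_domain by (simp add: measure_restrict_space)
    also have "\<dots> \<le> (\<integral>x. ?w x \<partial>lebesgue_on \<Omega>)"
      using Lp_integrable[OF W1pD(1)[OF U]] Lp_integrable[OF W1pD(1)[OF w(1)]] by (intro integral_mono) auto
    also have "\<dots> = - (\<integral>x. (weak_grad \<Omega> ?w x \<bullet> b) * (x \<bullet> b) \<partial>lebesgue_on \<Omega>)"
      using coordinate_flux_W1p0[OF l b] by (simp add: coordinate_flux_def)
    also have "\<dots> = (\<integral>x. - ((weak_grad \<Omega> ?w x \<bullet> b) * (x \<bullet> b)) \<partial>lebesgue_on \<Omega>)" by simp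
    also have "\<dots> \<le> ?G"
    proof (rule integral_mono_AE)
      have "AE x in lebesgue_on \<Omega>. x \<in> \<Omega>" by (rule AE_I2) simp
      then show "AE x in lebesgue_on \<Omega>. - ((weak_grad \<Omega> ?w x \<bullet> b) * (x \<bullet> b)) \<le> R * norm (weak_grad \<Omega> U x)"
        using w(2)
      proof eventually_elim
        case (elim x)
        have "\<bar>x \<bullet> b\<bar> \<le> R" using R(2)[OF elim(1)] Basis_le_norm[OF b, of x] by linarith
        moreover have "norm (weak_grad \<Omega> ?w x) \<le> norm (weak_grad \<Omega> U x)" using elim(2) by simp
        then have "\<bar>weak_grad \<Omega> ?w x \<bullet> b\<bar> \<le> norm (weak_grad \<Omega> U x)"
          using Basis_le_norm[OF b, of "weak_grad \<Omega> ?w x"] by linarith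
        ultimately have "\<bar>weak_grad \<Omega> ?w x \<bullet> b\<bar> * \<bar>x \<bullet> b\<bar> \<le> norm (weak_grad \<Omega> U x) * R"
          by (intro mult_mono) auto
        then show ?case by (simp add: abs_mult[symmetric] mult.commute[of R] abs_le_iff)
      qed
    qed (use integrable_weak_grad_coordinate[OF W1pD(3)[OF w(1)] b] Lp_integrable[OF W1pD(3)[OF U]] in auto)
    finally show ?thesis using m by (simp add: field_simps)
  qed
  then show ?thesis by (intro bdd_belowI) auto
qed

text \<open>As the levels decrease to \<open>s\<close>, the truncations and their gradients converge in \<open>Lp\<close> by dominated
  convergence. Hence the infimum that defines the boundary supremum is attained.\<close>

lemma W1p0_truncation_limit:
  assumes U: "U \<in> W1p \<Omega> p" and l: "\<And>n. (\<lambda>x. max 0 (U x - l n)) \<in> W1p0 \<Omega> p"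
    and ls: "\<And>n. s \<le> l n" "l \<longlonglongrightarrow> s"
  shows "(\<lambda>x. max 0 (U x - s)) \<in> W1p0 \<Omega> p"
proof -
  interpret finite_measure "lebesgue_on \<Omega>" by (rule finite_measure_domain)
  let ?D = "\<lambda>n x. max 0 (U x - s) - max 0 (U x - l n)"
  let ?g = "\<lambda>n x. (if U x > s then weak_grad \<Omega> U x else 0) - (if U x > l n then weak_grad \<Omega> U x else 0)"
  note W = W1p_truncation[OF U]
  note [measurable] = Lp_measurable[OF W1pD(1)[OF U]] Lp_measurable[OF W1pD(3)[OF U]]
  have D: "?D n \<in> W1p \<Omega> p" "AE x in lebesgue_on \<Omega>. weak_grad \<Omega> (?D n) x = ?g n x" for n
  proof -
    show "?D n \<in> W1p \<Omega> p" by (intro W1p_diff W)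
    show "AE x in lebesgue_on \<Omega>. weak_grad \<Omega> (?D n) x = ?g n x"
      using W1p_diff(2)[OF W(1) W(1), of s "l n"] W(2)[of s] W(2)[of "l n"] by eventually_elim simp
  qed
  have "(\<lambda>n. \<integral>x. norm (?g n x) powr p \<partial>lebesgue_on \<Omega>) \<longlonglongrightarrow> (\<integral>x. 0 \<partial>lebesgue_on \<Omega>)"
  proof (rule integral_dominated_convergence[where w="\<lambda>x. norm (weak_grad \<Omega> U x) powr p"])
    show "AE x in lebesgue_on \<Omega>. (\<lambda>n. norm (?g n x) powr p) \<longlonglongrightarrow> 0"
    proof (intro AE_I2 tendsto_eventually)
      fix x
      show "\<forall>\<^sub>F n in sequentially. norm (?g n x) powr p = 0"
      proof (cases "U x > s")
        case True
        then have "\<forall>\<^sub>F n in sequentially. l n < U x" using order_tendstoD(2)[OF ls(2)] by blast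
        then show ?thesis by eventually_elim (use True in simp)
      next
        case False
        then have "\<not> U x > l n" for n using ls(1)[of n] by linarith
        then show ?thesis using False by simp
      qed
    qed
    show "AE x in lebesgue_on \<Omega>. norm (norm (?g n x) powr p) \<le> norm (weak_grad \<Omega> U x) powr p" for n
      using p_pos ls(1)[of n] by (intro AE_I2) (auto intro!: powr_mono2)
  qed (use Lp_powr_integrable[OF W1pD(3)[OF U]] in auto)
  moreover have "(\<lambda>n. \<integral>x. \<bar>?D n x\<bar> powr p \<partial>lebesgue_on \<Omega>) \<longlonglongrightarrow> (\<integral>x. 0 \<partial>lebesgue_on \<Omega>)"
  proof (rule integral_dominated_convergence[where w="\<lambda>x. \<bar>max 0 (U x - s)\<bar> powr p"])
    show "AE x in lebesgue_on \<Omega>. (\<lambda>n. \<bar>?D n x\<bar> powr p) \<longlonglongrightarrow> 0"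
    proof (intro AE_I2)
      fix x
      have "(\<lambda>n. ?D n x) \<longlonglongrightarrow> max 0 (U x - s) - max 0 (U x - s)"
        by (intro tendsto_intros ls(2))
      then have "(\<lambda>n. \<bar>?D n x\<bar> powr p) \<longlonglongrightarrow> \<bar>0\<bar> powr p"
        using p_pos by (intro tendsto_powr2 tendsto_rabs tendsto_const) auto
      then show "(\<lambda>n. \<bar>?D n x\<bar> powr p) \<longlonglongrightarrow> 0" by simp
    qed
    show "AE x in lebesgue_on \<Omega>. norm (\<bar>?D n x\<bar> powr p) \<le> \<bar>max 0 (U x - s)\<bar> powr p" for n
      using p_pos ls(1)[of n] by (intro AE_I2) (auto intro!: powr_mono2)
  qed (use Lp_powr_integrable[OF W1pD(1)[OF W(1), of s]] in auto)
  ultimately have "(\<lambda>n. (\<integral>x. \<bar>?D n x\<bar> powr p \<partial>lebesgue_on \<Omega>) + (\<integral>x. norm (?g n x) powr p \<partial>lebesgue_on \<Omega>)) \<longlonglongrightarrow> 0"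
    using tendsto_add_zero by simp
  moreover have "(\<integral>x. norm (?g n x) powr p \<partial>lebesgue_on \<Omega>)
      = (\<integral>x. norm (weak_grad \<Omega> (?D n) x) powr p \<partial>lebesgue_on \<Omega>)" for n
    by (rule integral_powr_weak_grad[OF D(1) _ D(2), symmetric]) measurable
  ultimately have E: "(\<lambda>n. energy (?D n)) \<longlonglongrightarrow> 0" by (simp add: energy_def)
  show ?thesis
  proof (rule W1p0_closed[OF W(1)])
    fix e :: real assume "e > 0"
    then have "\<forall>\<^sub>F n in sequentially. energy (?D n) < e" by (rule order_tendstoD(2)[OF E])
    then obtain n where "energy (?D n) < e" by (auto simp: eventually_sequentially)
    then show "\<exists>v\<in>W1p0 \<Omega> p. energy (\<lambda>x. max 0 (U x - s) - v x) < e"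
      by (intro bexI[of _ "\<lambda>x. max 0 (U x - l n)"] l)
  qed
qed

lemma bdry_sup_cases:
  assumes ne: "\<Omega> \<noteq> {}" and U: "U \<in> W1p \<Omega> p"
  obtains "bdry_sup \<Omega> p U = \<infinity>"
  | s where "bdry_sup \<Omega> p U = ereal s" "(\<lambda>x. max 0 (U x - s)) \<in> W1p0 \<Omega> p"
proof -
  let ?S = "{l. (\<lambda>x. max 0 (U x - l)) \<in> W1p0 \<Omega> p}"
  show thesis
  proof (cases "?S = {}")
    case True
    then show ?thesis using that(1) by (simp add: bdry_sup_def top_ereal_def)
  next
    case False
    define s where "s = Inf ?S"
    note bdd = bdry_sup_bounded_below[OF assms]
    have "\<exists>l. l \<in> ?S \<and> l < s + 1 / real (Suc n)" for n
      using cInf_lessD[OF False, of "s + 1 / real (Suc n)"] by (auto simp: s_def)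
    then obtain l where l: "\<And>n. l n \<in> ?S" "\<And>n. l n < s + 1 / real (Suc n)" by metis
    have sl: "s \<le> l n" for n unfolding s_def by (rule cInf_lower[OF l(1) bdd])
    have "(\<lambda>n. s + 1 / real (Suc n)) \<longlonglongrightarrow> s + 0"
      using LIMSEQ_inverse_real_of_nat by (intro tendsto_add tendsto_const) (simp add: divide_inverse)
    then have "l \<longlonglongrightarrow> s"
      by (intro tendsto_sandwich[OF _ _ tendsto_const, of s l sequentially "\<lambda>n. s + 1 / real (Suc n)"])
        (simp_all add: sl less_imp_le[OF l(2)] del: of_nat_Suc)
    then have "(\<lambda>x. max 0 (U x - s)) \<in> W1p0 \<Omega> p"
      by (intro W1p0_truncation_limit[OF U _ sl]) (use l(1) in blast)
    moreover have "bdry_sup \<Omega> p U = ereal s"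
      unfolding bdry_sup_def s_def using ereal_Inf'[OF bdd False] by simp
    ultimately show ?thesis using that(2) by blast
  qed
qed

section \<open>The energy functional\<close>

text \<open>The integrand is bounded by \<open>|g| powr (p - 1) * |h|\<close>, hence by \<open>|g| powr p + |h| powr p\<close>.\<close>

lemma F_integrable:
  assumes g: "g \<in> Lp \<Omega> p" and h: "h \<in> Lp \<Omega> p"
  shows "integrable (lebesgue_on \<Omega>) (\<lambda>x. (norm (g x) powr (p - 2) *\<^sub>R g x) \<bullet> (h x :: 'a))"
proof (rule Bochner_Integration.integrable_bound)
  note [measurable] = g[THEN Lp_measurable] h[THEN Lp_measurable]
  show "(\<lambda>x. (norm (g x) powr (p - 2) *\<^sub>R g x) \<bullet> h x) \<in> borel_measurable (lebesgue_on \<Omega>)" by measurable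
  show "integrable (lebesgue_on \<Omega>) (\<lambda>x. norm (g x) powr p + norm (h x) powr p)"
    using Lp_powr_integrable[OF g] Lp_powr_integrable[OF h] by simp
  have "norm ((norm a powr (p - 2) *\<^sub>R a) \<bullet> b) \<le> norm a powr p + norm b powr p" for a b :: 'a
  proof -
    define m where "m = max (norm a) (norm b)"
    have m0: "m \<ge> 0" by (simp add: m_def le_max_iff_disj)
    have red: "t powr (p - 2) * t = t powr (p - 1)" "t powr (p - 1) * t = t powr p" if "t \<ge> 0" for t
      using that powr_add[of t "p - 2" 1] powr_add[of t "p - 1" 1] by (cases "t = 0"; simp)+
    have "norm ((norm a powr (p - 2) *\<^sub>R a) \<bullet> b) \<le> norm (norm a powr (p - 2) *\<^sub>R a) * norm b"
      by (simp only: real_norm_def Cauchy_Schwarz_ineq2)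
    also have "\<dots> = norm a powr (p - 1) * norm b" using red(1)[of "norm a"] by simp
    also have "\<dots> \<le> m powr (p - 1) * m"
      using p_gt_1 m0 by (intro mult_mono powr_mono2) (auto simp: m_def)
    also have "\<dots> = m powr p" using red(2) m0 by simp
    also have "\<dots> \<le> norm a powr p + norm b powr p" by (auto simp: m_def max_def)
    finally show ?thesis .
  qed
  then show "AE x in lebesgue_on \<Omega>. norm ((norm (g x) powr (p - 2) *\<^sub>R g x) \<bullet> h x)
      \<le> norm (norm (g x) powr p + norm (h x) powr p)"
    by (auto intro: order_trans)
qed

lemma F_fun_diff:
  assumes "u \<in> W1p \<Omega> p" "v \<in> W1p \<Omega> p" "w \<in> W1p \<Omega> p"
  shows "F_fun \<Omega> p u (\<lambda>x. v x - w x) = F_fun \<Omega> p u v - F_fun \<Omega> p u w"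
proof -
  let ?A = "\<lambda>x. norm (weak_grad \<Omega> u x) powr (p - 2) *\<^sub>R weak_grad \<Omega> u x"
  note [measurable] = assms[THEN W1pD(3), THEN Lp_measurable]
    Lp_measurable[OF W1pD(3)[OF W1p_diff(1)[OF assms(2,3)]]]
  have "F_fun \<Omega> p u (\<lambda>x. v x - w x)
      = (\<integral>x. ?A x \<bullet> weak_grad \<Omega> v x - ?A x \<bullet> weak_grad \<Omega> w x \<partial>lebesgue_on \<Omega>)"
    unfolding F_fun_def
    by (rule integral_cong_AE)
      (measurable, use W1p_diff(2)[OF assms(2,3)] in \<open>auto elim!: eventually_mono simp: inner_diff_right right_diff_distrib\<close>)
  then show ?thesis
    unfolding F_fun_def using assms[THEN W1pD(3)] by (simp add: F_integrable del: inner_scaleR_left)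
qed

text \<open>Cutting off at \<open>s\<close> replaces the gradient by 0 where \<open>U\<close> exceeds \<open>s\<close>, and subtracts from \<open>U\<close> a nonnegative
  function in \<open>W1p0\<close>, on which \<open>F\<close> is nonpositive.\<close>

lemma J_fun_truncation_le:
  assumes u: "u \<in> W1p \<Omega> p" "p_subharmonic \<Omega> p u" and U: "U \<in> W1p \<Omega> p"
    and w: "(\<lambda>x. max 0 (U x - s)) \<in> W1p0 \<Omega> p"
  shows "J_fun \<Omega> p u (\<lambda>x. U x - max 0 (U x - s)) \<le> J_fun \<Omega> p u U"
proof -
  let ?w = "\<lambda>x. max 0 (U x - s)"
  let ?T = "\<lambda>x. U x - ?w x"
  note W = W1p_truncation[OF U, of s]
  note T = W1p_diff[OF U W(1)]
  have "F_fun \<Omega> p u ?w \<le> 0" using u(2) w by (simp add: p_subharmonic_def)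
  then have F: "F_fun \<Omega> p u U \<le> F_fun \<Omega> p u ?T" using F_fun_diff[OF u(1) U W(1)] by simp
  have "(\<integral>x. 1 / p * norm (weak_grad \<Omega> ?T x) powr p \<partial>lebesgue_on \<Omega>)
      \<le> (\<integral>x. 1 / p * norm (weak_grad \<Omega> U x) powr p \<partial>lebesgue_on \<Omega>)"
  proof (rule integral_mono_AE)
    show "AE x in lebesgue_on \<Omega>. 1 / p * norm (weak_grad \<Omega> ?T x) powr p \<le> 1 / p * norm (weak_grad \<Omega> U x) powr p"
      using W(2) T(2) by eventually_elim (use p_pos in \<open>auto intro!: divide_right_mono powr_mono2\<close>)
  qed (use Lp_powr_integrable[OF W1pD(3)[OF U]] Lp_powr_integrable[OF W1pD(3)[OF T(1)]] in auto)
  then show ?thesis using F by (simp add: J_fun_def)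
qed

lemma truncate_bdry_cases:
  assumes ne: "\<Omega> \<noteq> {}" and U: "U \<in> W1p \<Omega> p"
  obtains "truncate_bdry \<Omega> p U = U"
  | s where "truncate_bdry \<Omega> p U = (\<lambda>x. U x - max 0 (U x - s))" "(\<lambda>x. max 0 (U x - s)) \<in> W1p0 \<Omega> p"
proof (rule bdry_sup_cases[OF assms])
  assume "bdry_sup \<Omega> p U = \<infinity>"
  then have "truncate_bdry \<Omega> p U = U" by (simp add: truncate_bdry_def fun_eq_iff)
  then show thesis by (rule that(1))
next
  fix s assume s: "bdry_sup \<Omega> p U = ereal s" "(\<lambda>x. max 0 (U x - s)) \<in> W1p0 \<Omega> p"
  have "truncate_bdry \<Omega> p U = (\<lambda>x. U x - max 0 (U x - s))"
    by (auto simp: truncate_bdry_def s(1) fun_eq_iff min_def max_def)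
  then show thesis using s(2) by (rule that(2))
qed

end

lemma quasi_dist_nonneg: "quasi_dist \<Omega> p u v \<ge> 0"
  by (simp add: quasi_dist_def Bochner_Integration.integral_nonneg)

theorem mainTheorem4:
  fixes \<Omega> :: "'a::euclidean_space set" and p :: real and u U :: "'a \<Rightarrow> real"
  assumes "open \<Omega>" and "connected \<Omega>" and "\<Omega> \<noteq> {}" and "bounded \<Omega>"
    and "1 < p"
    and "u \<in> W1p \<Omega> p"
    and "p_subharmonic \<Omega> p u"
    and "U \<in> W1p \<Omega> p"
  shows "truncate_bdry \<Omega> p U \<in> W1p \<Omega> p
    \<and> J_fun \<Omega> p u (truncate_bdry \<Omega> p U) \<le> J_fun \<Omega> p u U
    \<and> J_fun \<Omega> p u (truncate_bdry \<Omega> p U) - J_fun \<Omega> p u u \<le> J_fun \<Omega> p u U - J_fun \<Omega> p u u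
    \<and> (U \<in> W1p0_shift \<Omega> p u \<longrightarrow>
        truncate_bdry \<Omega> p U \<in> W1p0_shift \<Omega> p u \<and>
        (\<forall>c C :: real. 0 < c \<and> 0 < C \<and>
           (\<forall>v\<in>W1p0_shift \<Omega> p u.
              c * (J_fun \<Omega> p u v - J_fun \<Omega> p u u) \<le> (quasi_dist \<Omega> p u v)\<^sup>2 \<and>
              (quasi_dist \<Omega> p u v)\<^sup>2 \<le> C * (J_fun \<Omega> p u v - J_fun \<Omega> p u u)) \<longrightarrow>
           sqrt c * quasi_dist \<Omega> p u (truncate_bdry \<Omega> p U) \<le> sqrt C * quasi_dist \<Omega> p u U))"
proof -
  interpret sobolev_domain \<Omega> p using assms by unfold_locales
  define T where "T = truncate_bdry \<Omega> p U"
  have T: "T \<in> W1p \<Omega> p" "J_fun \<Omega> p u T \<le> J_fun \<Omega> p u U"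
    "U \<in> W1p0_shift \<Omega> p u \<Longrightarrow> T \<in> W1p0_shift \<Omega> p u"
  proof (atomize (full), rule truncate_bdry_cases[OF assms(3,8)])
    assume "truncate_bdry \<Omega> p U = U"
    then show "T \<in> W1p \<Omega> p \<and> J_fun \<Omega> p u T \<le> J_fun \<Omega> p u U \<and> (U \<in> W1p0_shift \<Omega> p u \<longrightarrow> T \<in> W1p0_shift \<Omega> p u)"
      using assms(8) by (simp add: T_def)
  next
    fix s assume s: "truncate_bdry \<Omega> p U = (\<lambda>x. U x - max 0 (U x - s))"
      and w: "(\<lambda>x. max 0 (U x - s)) \<in> W1p0 \<Omega> p"
    have "T \<in> W1p0_shift \<Omega> p u" if "U \<in> W1p0_shift \<Omega> p u"
    proof -
      have "(\<lambda>x. (U x - u x) - max 0 (U x - s)) \<in> W1p0 \<Omega> p"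
        using W1p0_diff[of "\<lambda>x. U x - u x"] that w by (auto simp: W1p0_shift_def)
      then show ?thesis by (simp add: W1p0_shift_def T_def s algebra_simps)
    qed
    moreover have "T \<in> W1p \<Omega> p"
      unfolding T_def s by (rule W1p_diff(1)[OF assms(8) W1p_truncation(1)[OF assms(8)]])
    moreover have "J_fun \<Omega> p u T \<le> J_fun \<Omega> p u U"
      unfolding T_def s by (rule J_fun_truncation_le[OF assms(6,7,8) w])
    ultimately show "T \<in> W1p \<Omega> p \<and> J_fun \<Omega> p u T \<le> J_fun \<Omega> p u U \<and> (U \<in> W1p0_shift \<Omega> p u \<longrightarrow> T \<in> W1p0_shift \<Omega> p u)"
      by blast
  qed
  have "sqrt c * quasi_dist \<Omega> p u T \<le> sqrt C * quasi_dist \<Omega> p u U"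
    if U: "U \<in> W1p0_shift \<Omega> p u" and c: "0 < c" "0 < C" and
      cC: "\<forall>v\<in>W1p0_shift \<Omega> p u.
        c * (J_fun \<Omega> p u v - J_fun \<Omega> p u u) \<le> (quasi_dist \<Omega> p u v)\<^sup>2 \<and>
        (quasi_dist \<Omega> p u v)\<^sup>2 \<le> C * (J_fun \<Omega> p u v - J_fun \<Omega> p u u)" for c C
  proof (rule power2_le_imp_le)
    have "c * (quasi_dist \<Omega> p u T)\<^sup>2 \<le> c * (C * (J_fun \<Omega> p u T - J_fun \<Omega> p u u))"
      using cC T(3)[OF U] c by (intro mult_left_mono) auto
    also have "\<dots> \<le> c * (C * (J_fun \<Omega> p u U - J_fun \<Omega> p u u))"
      using T(2) c by (intro mult_left_mono) auto
    also have "\<dots> = C * (c * (J_fun \<Omega> p u U - J_fun \<Omega> p u u))" by simp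
    also have "\<dots> \<le> C * (quasi_dist \<Omega> p u U)\<^sup>2"
      using cC U c by (intro mult_left_mono) auto
    finally show "(sqrt c * quasi_dist \<Omega> p u T)\<^sup>2 \<le> (sqrt C * quasi_dist \<Omega> p u U)\<^sup>2"
      using c by (simp add: power_mult_distrib)
    show "0 \<le> sqrt C * quasi_dist \<Omega> p u U" using c by (simp add: quasi_dist_nonneg)
  qed
  then show ?thesis using T unfolding T_def[symmetric] by auto
qed

end
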